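(* Let $\nu$ be a Gibbs measure with respect to a $C^{1}$-conformal iterated function system on $\mathbb{R}^{d}$, with no assumptions on separation conditions. Then, for every $r>0$, the quantization dimension $D_r(\nu)$ exists and \[ D_{r}(\nu)=\frac{rq_{r}}{1-q_{r}}. \]
   Context: Conformal IFS: let $U\subset\mathbb{R}^d$ be open. A $C^1$-map $S:U\to\mathbb{R}^d$ is conformal if for every $x\in U$ the total derivative $S'(x)$ satisfies $|S'(x)\cdot y|=\|S'(x)\|\,|y|$ for all $y\in\mathbb{R}^d$, and $\|S'(x)\|=\sup_{|z|=1}|S'(x)\cdot z|>0$. A family of conformal mappings $(S_i:K\to K)_{i\in\{1,\dots,N\}}$, for some compact $K$ and $N\ge2$, is a $C^1$-conformal iterated function system if each contraction $S_i$ extends to an injective conformal map $S_i:U\to U$ on an open set $U\supset K$ with $\sup\{\|S_i'(x)\|:x\in U\}<1$. The self-conformal set is the unique non-empty compact $L$ with $L=\bigcup_{i=1}^N S_i(L)$, and $\pi:\{1,\dots,N\}^{\mathbb{N}}\to L$ is the canonical coding map $\pi(\omega)=\lim_{n\to\infty}S_{\omega_1}\circ\cdots\circ S_{\omega_n}(x)$ (for any $x\in K$). For a Gibbs measure $\mu$ on the full shift $\{1,\dots,N\}^{\mathbb{N}}$, the measure $\nu=\mu\circ\pi^{-1}$ is called the Gibbs measure with respect to $(S_i)_{i}$. Here "Gibbs measure" has its standard meaning: a Borel probability measure $\mu$ for which there are a continuous potential $\psi:\{1,\dots,N\}^{\mathbb{N}}\to\mathbb{R}$ and constants $c\ge1$,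 $p\in\mathbb{R}$ such that $c^{-1}\le\mu([\omega_1\cdots\omega_n])/\exp\left(\sum_{k=0}^{n-1}\psi(\sigma^k\omega)-np\right)\le c$ for all $\omega$ and $n\in\mathbb{N}$, where $\sigma$ is the shift and $[\omega_1\cdots\omega_n]$ the cylinder set. Quantization dimension: for $r>0$ let $\mathfrak{e}_{n,r}(\nu)=\inf\left\{\left(\int d(x,\alpha)^r\,d\nu(x)\right)^{1/r}:\alpha\subset\mathbb{R}^d,\ 1\le\mathrm{card}(\alpha)\le n\right\}$ with $d(x,\alpha)=\min_{y\in\alpha}\|x-y\|$; $D_r(\nu)=\lim_{n\to\infty}\frac{\log n}{-\log\mathfrak{e}_{n,r}(\nu)}$ whenever this limit exists (the quotient is $0$ if $\mathfrak{e}_{n,r}(\nu)=0$). $L^q$-spectrum: let $\mathcal{D}_n$ be the partition of $\mathbb{R}^d$ into half-open cubes $\prod_{i=1}^d(k_i2^{-n},(k_i+1)2^{-n}]$, $k\in\mathbb{Z}^d$; $\beta_\nu(q)=\limsup_{n\to\infty}\frac{\log\left(\sum_{C\in\mathcal{D}_n}\nu(C)^q\right)}{\log(2^n)}$ for $q\ge0$ (with $0^0=0$), and $q_r=\inf\{q>0:\beta_\nu(q)<rq\}$. *)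

theory Defs
  imports "HOL-Probability.Probability"
begin

section \<open>Conformal iterated function systems\<close>

text \<open>The norm on bounded linear maps is the operator norm; the derivative is carried
  as an explicit argument \<open>D\<close>, which is determined by \<open>T\<close> on the open set \<open>U\<close>.\<close>

definition C1_conformal_on ::
  "(real^'d) set \<Rightarrow> (real^'d \<Rightarrow> real^'d) \<Rightarrow> (real^'d \<Rightarrow> (real^'d) \<Rightarrow>\<^sub>L (real^'d)) \<Rightarrow> bool" where
  "C1_conformal_on U T D \<longleftrightarrow>
     open U \<and>
     (\<forall>x\<in>U. (T has_derivative blinfun_apply (D x)) (at x)) \<and>
     continuous_on U D \<and>
     (\<forall>x\<in>U. (\<forall>y. norm (blinfun_apply (D x) y) = norm (D x) * norm y) \<and> norm (D x) > 0)"

text \<open>Only the values of the maps \<open>S i\<close>, \<open>i \<in> {1..N}\<close>, on \<open>K\<close> are relevant. The Lipschitz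
  condition on \<open>K\<close> does not follow from the derivative bound, as \<open>U\<close> need not be convex.\<close>

definition C1_conformal_ifs :: "nat \<Rightarrow> (real^'d) set \<Rightarrow> (nat \<Rightarrow> real^'d \<Rightarrow> real^'d) \<Rightarrow> bool" where
  "C1_conformal_ifs N K S \<longleftrightarrow>
     N \<ge> 2 \<and> compact K \<and> K \<noteq> {} \<and>
     (\<forall>i\<in>{1..N}.
        S i ` K \<subseteq> K \<and>
        (\<exists>c<1. c-lipschitz_on K (S i)) \<and>
        (\<exists>U T D. K \<subseteq> U \<and> C1_conformal_on U T D \<and> (\<forall>x\<in>K. T x = S i x) \<and>
           T ` U \<subseteq> U \<and> inj_on T U \<and>
           bdd_above ((\<lambda>x. norm (D x)) ` U) \<and> (SUP x\<in>U. norm (D x)) < 1))"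

section \<open>Gibbs measures on the full shift and their images\<close>

text \<open>Sequences are indexed from \<open>0\<close>, so \<open>\<omega> k\<close> is the letter usually written with index
  \<open>k + 1\<close>. The type \<open>nat \<Rightarrow> nat\<close> carries the product of the discrete topologies, so
  continuity on \<open>full_shift N\<close> and its Borel sets are the usual ones.\<close>

definition full_shift :: "nat \<Rightarrow> (nat \<Rightarrow> nat) set" where
  "full_shift N = {\<omega>. \<forall>k. \<omega> k \<in> {1..N}}"

definition shift :: "(nat \<Rightarrow> nat) \<Rightarrow> nat \<Rightarrow> nat" where
  "shift \<omega> = (\<lambda>k. \<omega> (Suc k))"

definition cylinder :: "nat \<Rightarrow> (nat \<Rightarrow> nat) \<Rightarrow> nat \<Rightarrow> (nat \<Rightarrow> nat) set" where
  "cylinder N \<omega> n = {\<tau> \<in> full_shift N. \<forall>k<n. \<tau> k = \<omega> k}"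

definition shift_gibbs_measure :: "nat \<Rightarrow> (nat \<Rightarrow> nat) measure \<Rightarrow> bool" where
  "shift_gibbs_measure N \<mu> \<longleftrightarrow>
     prob_space \<mu> \<and> sets \<mu> = sets (restrict_space borel (full_shift N)) \<and>
     (\<exists>(\<psi> :: (nat \<Rightarrow> nat) \<Rightarrow> real) (c::real) (p::real).
        continuous_on (full_shift N) \<psi> \<and> c \<ge> 1 \<and>
        (\<forall>\<omega>\<in>full_shift N. \<forall>n.
           (let R = measure \<mu> (cylinder N \<omega> n) /
                      exp ((\<Sum>k<n. \<psi> ((shift ^^ k) \<omega>)) - real n * p)
            in 1 / c \<le> R \<and> R \<le> c)))"

primrec word_map :: "(nat \<Rightarrow> 'a \<Rightarrow> 'a) \<Rightarrow> (nat \<Rightarrow> nat) \<Rightarrow> nat \<Rightarrow> 'a \<Rightarrow> 'a" where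
  "word_map S \<omega> 0 = id"
| "word_map S \<omega> (Suc n) = word_map S \<omega> n \<circ> S (\<omega> n)"

definition coding_map ::
  "(real^'d) set \<Rightarrow> (nat \<Rightarrow> real^'d \<Rightarrow> real^'d) \<Rightarrow> (nat \<Rightarrow> nat) \<Rightarrow> real^'d" where
  "coding_map K S \<omega> = (THE y. \<forall>x\<in>K. (\<lambda>n. word_map S \<omega> n x) \<longlonglongrightarrow> y)"

definition ifs_gibbs_measure ::
  "nat \<Rightarrow> (real^'d) set \<Rightarrow> (nat \<Rightarrow> real^'d \<Rightarrow> real^'d) \<Rightarrow> (real^'d) measure \<Rightarrow> bool" where
  "ifs_gibbs_measure N K S \<nu> \<longleftrightarrow>
     (\<exists>\<mu>. shift_gibbs_measure N \<mu> \<and> \<nu> = distr \<mu> borel (coding_map K S))"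

section \<open>Quantization dimension\<close>

text \<open>Here and below the measures in question have compact support: the integrals in the
  quantization error exist, and the sums over dyadic cubes have finitely many nonzero terms.
  (For other measures the Bochner integral and \<open>infsum\<close> may default to \<open>0\<close>.)
  For finite nonempty \<open>\<alpha>\<close> the infimum in \<open>infdist\<close> is a minimum.\<close>

definition quantization_error :: "nat \<Rightarrow> real \<Rightarrow> (real^'d) measure \<Rightarrow> real" where
  "quantization_error n r \<nu> =
     Inf {(\<integral>x. infdist x \<alpha> powr r \<partial>\<nu>) powr (1 / r) |
            \<alpha>. finite \<alpha> \<and> 1 \<le> card \<alpha> \<and> card \<alpha> \<le> n}"

definition quantization_quotient :: "real \<Rightarrow> (real^'d) measure \<Rightarrow> nat \<Rightarrow> real" where
  "quantization_quotient r \<nu> n =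
     (if quantization_error n r \<nu> = 0 then 0
      else ln (real n) / - ln (quantization_error n r \<nu>))"

definition quantization_dim_exists :: "real \<Rightarrow> (real^'d) measure \<Rightarrow> bool" where
  "quantization_dim_exists r \<nu> \<longleftrightarrow> convergent (quantization_quotient r \<nu>)"

definition quantization_dim :: "real \<Rightarrow> (real^'d) measure \<Rightarrow> real" where
  "quantization_dim r \<nu> = lim (quantization_quotient r \<nu>)"

section \<open>The \<open>L\<^sup>q\<close>-spectrum\<close>

definition dyadic_cube :: "nat \<Rightarrow> int^'d \<Rightarrow> (real^'d) set" where
  "dyadic_cube n k =
     {x. \<forall>i. of_int (k $ i) / 2 ^ n < x $ i \<and> x $ i \<le> (of_int (k $ i) + 1) / 2 ^ n}"

definition dyadic_cubes :: "nat \<Rightarrow> (real^'d) set set" where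
  "dyadic_cubes n = range (dyadic_cube n)"

text \<open>Note that \<open>0 powr 0 = 0\<close>, so cubes of measure zero do not contribute for \<open>q = 0\<close>.\<close>

definition Lq_spectrum :: "(real^'d) measure \<Rightarrow> real \<Rightarrow> ereal" where
  "Lq_spectrum \<nu> q =
     limsup (\<lambda>n. ereal (ln (\<Sum>\<^sub>\<infinity>C\<in>dyadic_cubes n. measure \<nu> C powr q) / ln (2 ^ n)))"

definition critical_q :: "real \<Rightarrow> (real^'d) measure \<Rightarrow> real" where
  "critical_q r \<nu> = Inf {q. q > 0 \<and> Lq_spectrum \<nu> q < ereal (r * q)}"

end

theory Submission imports Defs begin

text \<open>Upper bound, for \<open>q\<close> with \<open>\<beta>(q) < r q\<close>: the sum of \<open>J(C)^q\<close>, \<open>J(C) = \<nu>(C) 2^(-n r)\<close>, over all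
  dyadic cubes \<open>C\<close> of all levels \<open>n\<close> converges. Taking as centers the corners of the cubes with
  \<open>J(C) \<ge> \<tau>\<close> uses \<open>O(\<tau>^(-q))\<close> centers and leaves an \<open>r\<close>-th power error \<open>O(\<tau>^(1-q))\<close>.

  Lower bound, for \<open>0 < q < q_r\<close>: since \<open>\<beta>(q) > r q\<close>, there are arbitrarily fine levels \<open>n\<close> with
  \<open>\<Sum> \<nu>(C)^q\<close> far above \<open>2^(n r q)\<close>, and a single such level suffices. Thin it out to well separated cubes
  and cut \<open>\<mu>\<close> into cylinders whose pieces have diameter at most \<open>2^(-n)\<close>. By the Gibbs property \<open>\<nu>\<close>
  dominates a mixture of contracted copies of itself, and although only subexponential distortion
  is available for \<open>C\<^sup>1\<close> maps, the contraction factors are at least \<open>2^(-n(1+\<epsilon>))\<close>. Centers near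
  different cubes do not interact, so an error bound \<open>A k^(-(1-q)/q)\<close> for fewer than \<open>m\<close> centers passes,
  by Hoelder's inequality, to \<open>m\<close> centers with the same constant \<open>A\<close>: the factor lost is compensated by
  \<open>(\<Sum> \<nu>(C)^q)^(1/q)\<close>.\<close>

section \<open>Distortion of conformal maps\<close>

text \<open>The spectrum is a limsup, so below \<open>q_r\<close> the power sums are known to be
  large only along some levels, whereas the quantization dimension asks for a bound at every
  \<open>n\<close>. The two fit together because the chosen level is applied again and again: the
  induction on the number of centers returns the same constant each time, so it bounds the error for
  all \<open>n\<close> at once. Above \<open>q_r\<close> the limsup controls all large levels, which
  is what summability requires. Overlaps of the images do no harm: disjointness is asked of
  cylinders in the shift, and separation of dyadic cubes, where it is gained by keeping one residue
  class of indices. Both bounds have the exponent \<open>(1 - q) / q\<close> because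
  \<open>r / ((1 - q) / q) = r * q / (1 - q)\<close>, the asserted dimension with \<open>q\<close>
  in place of \<open>q_r\<close>. In the lower bound the strict room between the growth rate of the
  power sums and \<open>r * q\<close> pays for everything: one half for the distortion loss
  \<open>\<epsilon>\<close>, the other half for the constants, all of which are fixed before the
  level is chosen.\<close>

lemma conformal_local_ratio:
  fixes T :: "real^'d \<Rightarrow> real^'d"
  assumes C1: "C1_conformal_on U T D" and p: "p \<in> U" and \<theta>: "0 < \<theta>"
  shows "\<exists>e>0. \<forall>x\<in>ball p e. \<forall>y\<in>ball p e.
     norm (D p) * (1 - \<theta>) * dist x y \<le> dist (T x) (T y) \<and>
     dist (T x) (T y) \<le> norm (D p) * (1 + \<theta>) * dist x y"
proof -
  have U: "open U" and der: "\<And>x. x \<in> U \<Longrightarrow> (T has_derivative blinfun_apply (D x)) (at x)"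
    and cont: "continuous_on U D" and pos: "norm (D p) > 0"
    and conf: "\<And>y. norm (blinfun_apply (D p) y) = norm (D p) * norm y"
    using C1 p by (auto simp: C1_conformal_on_def)
  define \<epsilon> where "\<epsilon> = \<theta> * norm (D p)"
  have "\<epsilon> > 0" using pos \<theta> by (simp add: \<epsilon>_def)
  have "continuous (at p) D" using cont U p by (simp add: continuous_on_eq_continuous_at)
  then obtain e1 where e1: "e1 > 0" "\<And>x. dist x p < e1 \<Longrightarrow> dist (D x) (D p) < \<epsilon>"
    using \<open>\<epsilon> > 0\<close> by (auto simp: continuous_at_eps_delta)
  obtain e2 where e2: "e2 > 0" "ball p e2 \<subseteq> U" using U p open_contains_ball by blast
  define e where "e = min e1 e2"
  have "e > 0" using e1 e2 by (simp add: e_def)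
  moreover have "norm (D p) * (1 - \<theta>) * dist x y \<le> dist (T x) (T y) \<and>
     dist (T x) (T y) \<le> norm (D p) * (1 + \<theta>) * dist x y"
    if xy: "x \<in> ball p e" "y \<in> ball p e" for x y
  proof -
    \<comment> \<open>Mean value inequality for \<open>T\<close> minus its linear part at
      \<open>p\<close>, on the convex ball where \<open>D\<close> varies by at most
      \<open>\<epsilon>\<close>. Since \<open>D p\<close> scales all vectors alike, this becomes a
      two-sided bound on the increments of \<open>T\<close>.\<close>
    have "norm (T x - T y - D p (x - y)) \<le> norm (x - y) * \<epsilon>"
    proof (rule differentiable_bound_linearization[where S = "ball p e" and
          f' = "\<lambda>z. blinfun_apply (D z)"])
      fix t :: real assume "t \<in> {0..1}"
      then have "(1 - t) *\<^sub>R y + t *\<^sub>R x \<in> ball p e"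
        using convexD_alt[OF convex_ball xy(2,1), of t] by simp
      then show "y + t *\<^sub>R (x - y) \<in> ball p e" by (simp add: algebra_simps)
    next
      fix z assume z: "z \<in> ball p e"
      show "(T has_derivative blinfun_apply (D z)) (at z within ball p e)"
        using der[of z] z subsetD[OF e2(2), of z]
        by (subst has_derivative_at_withinI) (auto simp: e_def)
      have "norm (D z - D p) \<le> \<epsilon>"
        using e1(2)[of z] z by (auto simp: e_def dist_norm norm_minus_commute)
      then show "onorm (blinfun_apply (D z) - blinfun_apply (D p)) \<le> \<epsilon>"
        by (simp add: norm_blinfun.rep_eq minus_blinfun.rep_eq fun_diff_def)
    next
      show "p \<in> ball p e" using \<open>e > 0\<close> by simp
    qed
    then have 1: "norm ((T x - T y) - D p (x - y)) \<le> \<theta> * norm (D p) * norm (x - y)"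
      by (simp add: \<epsilon>_def mult.commute)
    have 2: "norm (D p (x - y)) = norm (D p) * norm (x - y)" by (rule conf)
    have 3: "\<bar>norm (T x - T y) - norm (D p) * norm (x - y)\<bar> \<le> \<theta> * norm (D p) * norm (x - y)"
      using norm_triangle_ineq3[of "T x - T y" "D p (x - y)"] 1 2 by linarith
    then show ?thesis
      unfolding dist_norm abs_le_iff by (simp add: algebra_simps)
  qed
  ultimately show ?thesis by blast
qed

text \<open>Comparing two pairs in the same ball cancels the unknown factor
  \<open>norm (D p)\<close>. The inequality is cross-multiplied so that it also covers pairs of
  equal points.\<close>

lemma conformal_local_distortion:
  fixes T :: "real^'d \<Rightarrow> real^'d"
  assumes C1: "C1_conformal_on U T D" and K: "compact K" "K \<subseteq> U" and \<eta>: "\<eta> > 1"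
  obtains \<delta> where "\<delta> > 0"
    "\<And>p x y x' y'. p \<in> K \<Longrightarrow> {x, y, x', y'} \<subseteq> ball p \<delta> \<Longrightarrow>
       dist (T x) (T y) * dist x' y' \<le> \<eta> * dist (T x') (T y') * dist x y"
proof -
  \<comment> \<open>The solution of \<open>(1 + \<theta>) / (1 - \<theta>) = \<eta>\<close>.\<close>
  define \<theta> where "\<theta> = (\<eta> - 1) / (\<eta> + 1)"
  have \<theta>: "0 < \<theta>" "\<theta> < 1" "1 + \<theta> = \<eta> * (1 - \<theta>)"
    using \<eta> by (simp_all add: \<theta>_def field_simps)
  have "\<exists>e>0. \<forall>x\<in>ball p e. \<forall>y\<in>ball p e.
     norm (D p) * (1 - \<theta>) * dist x y \<le> dist (T x) (T y) \<and>
     dist (T x) (T y) \<le> norm (D p) * (1 + \<theta>) * dist x y" if "p \<in> K" for p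
  proof -
    have "p \<in> U" using that K by blast
    from conformal_local_ratio[OF C1 this \<theta>(1)] show ?thesis .
  qed
  then obtain e where e: "\<And>p. p \<in> K \<Longrightarrow> e p > 0"
    "\<And>p x y. p \<in> K \<Longrightarrow> x \<in> ball p (e p) \<Longrightarrow> y \<in> ball p (e p) \<Longrightarrow>
     norm (D p) * (1 - \<theta>) * dist x y \<le> dist (T x) (T y) \<and>
     dist (T x) (T y) \<le> norm (D p) * (1 + \<theta>) * dist x y"
    by metis
  have "K \<subseteq> \<Union> ((\<lambda>p. ball p (e p)) ` K)" using e(1) by force
  \<comment> \<open>A Lebesgue number of the cover makes the radius uniform over
    \<open>K\<close>.\<close>
  from Heine_Borel_lemma[OF K(1) this]
  obtain \<delta> where \<delta>: "\<delta> > 0" "\<And>x. x \<in> K \<Longrightarrow> \<exists>G\<in>(\<lambda>p. ball p (e p)) ` K. ball x \<delta> \<subseteq> G"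
    by auto
  have "dist (T x) (T y) * dist x' y' \<le> \<eta> * dist (T x') (T y') * dist x y"
    if "z \<in> K" and sub: "{x, y, x', y'} \<subseteq> ball z \<delta>" for z x y x' y'
  proof -
    obtain p where p: "p \<in> K" "ball z \<delta> \<subseteq> ball p (e p)" using \<delta>(2)[OF \<open>z \<in> K\<close>] by auto
    then have "{x, y, x', y'} \<subseteq> ball p (e p)" using sub by blast
    then have in_ball: "x \<in> ball p (e p)" "y \<in> ball p (e p)" "x' \<in> ball p (e p)" "y' \<in> ball p (e p)"
      by auto
    have "dist (T x) (T y) * dist x' y' \<le> (norm (D p) * (1 + \<theta>) * dist x y) * dist x' y'"
      using e(2)[OF p(1) in_ball(1,2)] by (intro mult_right_mono) auto
    also have "\<dots> = \<eta> * (norm (D p) * (1 - \<theta>) * dist x' y') * dist x y"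
      by (simp add: \<theta>(3))
    also have "\<dots> \<le> \<eta> * dist (T x') (T y') * dist x y"
      using e(2)[OF p(1) in_ball(3,4)] \<eta> by (intro mult_right_mono mult_left_mono) auto
    finally show ?thesis .
  qed
  then show ?thesis using that \<delta>(1) by blast
qed

text \<open>Near pairs are controlled by the derivative, whose norm is bounded away from zero on
  \<open>K\<close>; far pairs by injectivity together with compactness.\<close>

lemma conformal_lower_lipschitz:
  fixes T :: "real^'d \<Rightarrow> real^'d"
  assumes C1: "C1_conformal_on U T D" and K: "compact K" "K \<subseteq> U" and inj: "inj_on T U"
  obtains b where "b > 0" "\<And>x y. x \<in> K \<Longrightarrow> y \<in> K \<Longrightarrow> b * dist x y \<le> dist (T x) (T y)"
proof (cases "K = {}")
  case True
  then show ?thesis using that[of 1] by simp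
next
  case False
  have T: "continuous_on U T"
    using C1 unfolding C1_conformal_on_def
    by (meson continuous_at_imp_continuous_on has_derivative_continuous)
  have D: "continuous_on K (\<lambda>x. norm (D x))"
    using C1 K unfolding C1_conformal_on_def
    by (intro continuous_on_norm) (auto intro: continuous_on_subset)
  obtain p0 where p0: "p0 \<in> K" "\<And>x. x \<in> K \<Longrightarrow> norm (D p0) \<le> norm (D x)"
    using continuous_attains_inf[OF K(1) False D] by auto
  have g0: "norm (D p0) > 0" using C1 K p0 by (auto simp: C1_conformal_on_def)
  have "\<exists>e>0. \<forall>x\<in>ball p e. \<forall>y\<in>ball p e.
     norm (D p) * (1 - 1/2) * dist x y \<le> dist (T x) (T y)" if "p \<in> K" for p
  proof -
    have "p \<in> U" using that K by blast
    from conformal_local_ratio[OF C1 this, of "1/2"] obtain e where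
      "e > 0" "\<forall>x\<in>ball p e. \<forall>y\<in>ball p e. norm (D p) * (1 - 1/2) * dist x y \<le> dist (T x) (T y) \<and>
        dist (T x) (T y) \<le> norm (D p) * (1 + 1/2) * dist x y" by auto
    then show ?thesis by blast
  qed
  then obtain e where e: "\<And>p. p \<in> K \<Longrightarrow> e p > 0"
    "\<And>p x y. p \<in> K \<Longrightarrow> x \<in> ball p (e p) \<Longrightarrow> y \<in> ball p (e p) \<Longrightarrow>
     norm (D p) * (1 - 1/2) * dist x y \<le> dist (T x) (T y)"
    by metis
  have "K \<subseteq> \<Union> ((\<lambda>p. ball p (e p)) ` K)" using e(1) by force
  from Heine_Borel_lemma[OF K(1) this]
  obtain \<delta> where \<delta>: "\<delta> > 0" "\<And>x. x \<in> K \<Longrightarrow> \<exists>G\<in>(\<lambda>p. ball p (e p)) ` K. ball x \<delta> \<subseteq> G"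
    by auto
  have near: "norm (D p0) / 2 * dist x y \<le> dist (T x) (T y)"
    if "x \<in> K" "y \<in> K" "dist x y < \<delta>" for x y
  proof -
    obtain p where p: "p \<in> K" "ball x \<delta> \<subseteq> ball p (e p)" using \<delta>(2)[OF \<open>x \<in> K\<close>] by auto
    have "norm (D p0) / 2 * dist x y \<le> norm (D p) * (1 - 1/2) * dist x y"
      using p0(2)[OF p(1)] by (intro mult_right_mono) auto
    also have "\<dots> \<le> dist (T x) (T y)" using e(2)[OF p(1), of x y] subsetD[OF p(2), of x] subsetD[OF p(2), of y] that \<delta>(1) by auto
    finally show ?thesis .
  qed
  \<comment> \<open>The far pairs form a compact set, on which the distance of the images is
    positive by injectivity and so has a positive minimum.\<close>
  define Q where "Q = (K \<times> K) \<inter> {z. \<delta> \<le> dist (fst z) (snd z)}"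
  have "compact Q" unfolding Q_def
    by (intro compact_Int_closed compact_Times K closed_Collect_le continuous_intros)
  have far: "\<exists>m>0. \<forall>x\<in>K. \<forall>y\<in>K. \<delta> \<le> dist x y \<longrightarrow> m \<le> dist (T x) (T y)"
  proof (cases "Q = {}")
    case True
    then have *: "\<not> \<delta> \<le> dist x y" if "x \<in> K" "y \<in> K" for x y
      using that unfolding Q_def by force
    show ?thesis by (rule exI[of _ 1]) (use * zero_less_one in blast)
  next
    case False
    have "continuous_on Q (\<lambda>z. dist (T (fst z)) (T (snd z)))"
      using K by (intro continuous_intros continuous_on_compose2[OF T]) (auto simp: Q_def)
    from continuous_attains_inf[OF \<open>compact Q\<close> False this]
    obtain u v where uv: "(u, v) \<in> Q"
      "\<And>x y. (x, y) \<in> Q \<Longrightarrow> dist (T u) (T v) \<le> dist (T x) (T y)" by force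
    have "dist (T u) (T v) > 0"
      using uv(1) \<delta>(1) inj K by (auto simp: Q_def dest!: inj_onD)
    then show ?thesis using uv(2) by (intro exI[of _ "dist (T u) (T v)"]) (auto simp: Q_def)
  qed
  then obtain m where m: "m > 0" "\<And>x y. x \<in> K \<Longrightarrow> y \<in> K \<Longrightarrow> \<delta> \<le> dist x y \<Longrightarrow> m \<le> dist (T x) (T y)"
    by blast
  define d where "d = diameter K + 1"
  have d: "d > 0" "\<And>x y. x \<in> K \<Longrightarrow> y \<in> K \<Longrightarrow> dist x y \<le> d"
    using diameter_bounded_bound[OF compact_imp_bounded[OF K(1)]]
      diameter_ge_0[OF compact_imp_bounded[OF K(1)]] by (force simp: d_def)+
  \<comment> \<open>Far pairs satisfy \<open>(m / d) * dist x y \<le> m\<close>, as \<open>d\<close>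
    bounds all distances in \<open>K\<close>; the \<open>+ 1\<close> in \<open>d\<close> keeps it
    positive.\<close>
  define b where "b = min (norm (D p0) / 2) (m / d)"
  have "b * dist x y \<le> dist (T x) (T y)" if xy: "x \<in> K" "y \<in> K" for x y
  proof (cases "dist x y < \<delta>")
    case True
    have "b * dist x y \<le> norm (D p0) / 2 * dist x y"
      unfolding b_def by (intro mult_right_mono min.cobounded1 zero_le_dist)
    then show ?thesis using near[OF xy True] by simp
  next
    case False
    have "b * dist x y \<le> (m / d) * d"
      using d m xy by (intro mult_mono) (auto simp: b_def)
    then show ?thesis using m(2)[OF xy] False d by simp
  qed
  moreover have "b > 0" using g0 m d by (simp add: b_def)
  ultimately show ?thesis using that by blast
qed

section \<open>Words and the coding map\<close>

primrec comp_word :: "(nat \<Rightarrow> 'a \<Rightarrow> 'a) \<Rightarrow> nat list \<Rightarrow> 'a \<Rightarrow> 'a" where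
  "comp_word S [] = id"
| "comp_word S (i # w) = S i \<circ> comp_word S w"

lemma comp_word_append: "comp_word S (v @ w) = comp_word S v \<circ> comp_word S w"
  by (induction v) (auto simp: comp_assoc)

lemma word_map_eq_comp_word: "word_map S \<omega> n = comp_word S (map \<omega> [0..<n])"
  by (induction n) (auto simp: comp_word_append)

definition prepend :: "nat list \<Rightarrow> (nat \<Rightarrow> nat) \<Rightarrow> nat \<Rightarrow> nat" where
  "prepend w \<omega> = (\<lambda>k. if k < length w then w ! k else \<omega> (k - length w))"

text \<open>A cylinder is formed from an infinite sequence; \<open>(!) w\<close> serves as one,
  since its values from \<open>length w\<close> on are never consulted.\<close>

abbreviation word_cyl :: "nat \<Rightarrow> nat list \<Rightarrow> (nat \<Rightarrow> nat) set" where
  "word_cyl N w \<equiv> cylinder N ((!) w) (length w)"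

lemma word_cyl_iff: "\<omega> \<in> word_cyl N w \<longleftrightarrow> \<omega> \<in> full_shift N \<and> map \<omega> [0..<length w] = w"
  unfolding cylinder_def list_eq_iff_nth_eq by simp

lemma prepend_in_full_shift:
  "w \<in> lists {1..N} \<Longrightarrow> \<omega> \<in> full_shift N \<Longrightarrow> prepend w \<omega> \<in> full_shift N"
  unfolding full_shift_def prepend_def by (auto simp: in_lists_conv_set dest: nth_mem)

lemma map_prepend: "map (prepend w \<omega>) [0..<length w + n] = w @ map \<omega> [0..<n]"
  by (rule nth_equalityI) (simp_all add: prepend_def nth_append)

lemma prepend_take_drop: "prepend (map \<omega> [0..<n]) (\<lambda>k. \<omega> (n + k)) = \<omega>"
  by (auto simp: prepend_def)

lemma map_upt_in_lists: "\<omega> \<in> full_shift N \<Longrightarrow> map \<omega> [0..<n] \<in> lists {1..N}"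
  by (auto simp: full_shift_def)

lemma drop_in_full_shift: "\<omega> \<in> full_shift N \<Longrightarrow> (\<lambda>k. \<omega> (n + k)) \<in> full_shift N"
  by (auto simp: full_shift_def)

text \<open>What conformality contributes, freed of derivatives and of the open sets
  \<open>U\<close>. Those sets depend on the letter, so the extensions cannot simply be composed,
  while estimates between points of \<open>K\<close> can be iterated along words.\<close>

locale quasi_conformal_ifs =
  fixes N :: nat and K :: "(real^'d) set" and S :: "nat \<Rightarrow> real^'d \<Rightarrow> real^'d" and c b :: real
  assumes compact_K: "compact K" and K_nonempty: "K \<noteq> {}" and N_pos: "N > 0"
    and S_in: "\<And>i x. i \<in> {1..N} \<Longrightarrow> x \<in> K \<Longrightarrow> S i x \<in> K"
    and c: "0 < c" "c < 1" and b: "0 < b" "b \<le> 1"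
    and upper: "\<And>i x y. i \<in> {1..N} \<Longrightarrow> x \<in> K \<Longrightarrow> y \<in> K \<Longrightarrow> dist (S i x) (S i y) \<le> c * dist x y"
    and lower: "\<And>i x y. i \<in> {1..N} \<Longrightarrow> x \<in> K \<Longrightarrow> y \<in> K \<Longrightarrow> b * dist x y \<le> dist (S i x) (S i y)"
    and local_distortion: "\<And>\<eta>. \<eta> > 1 \<Longrightarrow> \<exists>\<delta>>0. \<forall>i\<in>{1..N}. \<forall>p\<in>K. \<forall>x y x' y'.
       {x, y, x', y'} \<subseteq> K \<inter> ball p \<delta> \<longrightarrow>
       dist (S i x) (S i y) * dist x' y' \<le> \<eta> * dist (S i x') (S i y') * dist x y"

lemma C1_conformal_ifs_imp_quasi_conformal:
  fixes K :: "(real^'d) set"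
  assumes ifs: "C1_conformal_ifs N K S"
  obtains c b where "quasi_conformal_ifs N K S c b"
proof -
  have N: "N \<ge> 2" and K: "compact K" "K \<noteq> {}" and SK: "\<And>i. i \<in> {1..N} \<Longrightarrow> S i ` K \<subseteq> K"
    using ifs by (auto simp: C1_conformal_ifs_def)
  have "\<forall>i\<in>{1..N}. \<exists>c<1. c-lipschitz_on K (S i)"
    using ifs by (auto simp: C1_conformal_ifs_def)
  then obtain c where c: "\<And>i. i \<in> {1..N} \<Longrightarrow> c i < 1 \<and> (c i)-lipschitz_on K (S i)"
    by metis
  have UTD: "\<exists>U T D. K \<subseteq> U \<and> C1_conformal_on U T D \<and> (\<forall>x\<in>K. T x = S i x) \<and> inj_on T U"
    if "i \<in> {1..N}" for i
    using ifs that unfolding C1_conformal_ifs_def by blast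
  have "\<exists>b>0. \<forall>x\<in>K. \<forall>y\<in>K. b * dist x y \<le> dist (S i x) (S i y)" if i: "i \<in> {1..N}" for i
  proof -
    obtain U T D where "K \<subseteq> U" "C1_conformal_on U T D" and T: "\<forall>x\<in>K. T x = S i x" and "inj_on T U"
      using UTD[OF i] by blast
    then obtain b where "b > 0" "\<And>x y. x \<in> K \<Longrightarrow> y \<in> K \<Longrightarrow> b * dist x y \<le> dist (T x) (T y)"
      using conformal_lower_lipschitz K(1) by metis
    then show ?thesis using T by auto
  qed
  then obtain b where b: "\<And>i. i \<in> {1..N} \<Longrightarrow> b i > 0"
    "\<And>i x y. i \<in> {1..N} \<Longrightarrow> x \<in> K \<Longrightarrow> y \<in> K \<Longrightarrow> b i * dist x y \<le> dist (S i x) (S i y)"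
    by metis
  have dist_S: "\<exists>\<delta>>0. \<forall>p\<in>K. \<forall>x y x' y'. {x, y, x', y'} \<subseteq> K \<inter> ball p \<delta> \<longrightarrow>
       dist (S i x) (S i y) * dist x' y' \<le> \<eta> * dist (S i x') (S i y') * dist x y"
    if i: "i \<in> {1..N}" and \<eta>: "\<eta> > 1" for i \<eta>
  proof -
    obtain U T D where U: "K \<subseteq> U" "C1_conformal_on U T D" and T: "\<forall>x\<in>K. T x = S i x"
      using UTD[OF i] by blast
    obtain \<delta> where \<delta>: "\<delta> > 0" "\<And>p x y x' y'. p \<in> K \<Longrightarrow> {x, y, x', y'} \<subseteq> ball p \<delta> \<Longrightarrow>
       dist (T x) (T y) * dist x' y' \<le> \<eta> * dist (T x') (T y') * dist x y"
      using conformal_local_distortion[OF U(2) K(1) U(1) \<eta>] by metis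
    show ?thesis
    proof (intro exI[of _ \<delta>] conjI \<delta>(1) ballI allI impI)
      fix p x y x' y' assume "p \<in> K" and sub: "{x, y, x', y'} \<subseteq> K \<inter> ball p \<delta>"
      then show "dist (S i x) (S i y) * dist x' y' \<le> \<eta> * dist (S i x') (S i y') * dist x y"
        using \<delta>(2)[of p x y x' y'] T by simp
    qed
  qed
  \<comment> \<open>The inserted \<open>1/2\<close> and \<open>1\<close> secure
    \<open>0 < c0\<close> and \<open>b0 \<le> 1\<close>.\<close>
  define c0 where "c0 = Max (insert (1/2) (c ` {1..N}))"
  define b0 where "b0 = Min (insert 1 (b ` {1..N}))"
  have c0: "0 < c0" "c0 < 1" "\<And>i. i \<in> {1..N} \<Longrightarrow> c i \<le> c0"
  proof -
    have "1/2 \<le> c0" unfolding c0_def by (intro Max_ge) auto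
    then show "0 < c0" by simp
    show "c0 < 1" using c unfolding c0_def by (subst Max_less_iff) auto
    show "c i \<le> c0" if "i \<in> {1..N}" for i using that unfolding c0_def by (intro Max_ge) auto
  qed
  have b0: "0 < b0" "b0 \<le> 1" "\<And>i. i \<in> {1..N} \<Longrightarrow> b0 \<le> b i"
  proof -
    show "0 < b0" using b(1) unfolding b0_def by (subst Min_gr_iff) auto
    show "b0 \<le> 1" unfolding b0_def by (intro Min_le) auto
    show "b0 \<le> b i" if "i \<in> {1..N}" for i using that unfolding b0_def by (intro Min_le) auto
  qed
  have "quasi_conformal_ifs N K S c0 b0"
  proof
    show "compact K" "K \<noteq> {}" "N > 0" "0 < c0" "c0 < 1" "0 < b0" "b0 \<le> 1"
      using K N c0 b0 by auto
    show "S i x \<in> K" if "i \<in> {1..N}" "x \<in> K" for i x using SK that by auto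
    show "dist (S i x) (S i y) \<le> c0 * dist x y" if "i \<in> {1..N}" "x \<in> K" "y \<in> K" for i x y
    proof -
      have "dist (S i x) (S i y) \<le> c i * dist x y"
        using c[OF that(1)] that lipschitz_onD by blast
      also have "\<dots> \<le> c0 * dist x y" using c0(3)[OF that(1)] by (intro mult_right_mono) auto
      finally show ?thesis .
    qed
    show "b0 * dist x y \<le> dist (S i x) (S i y)" if "i \<in> {1..N}" "x \<in> K" "y \<in> K" for i x y
    proof -
      have "b0 * dist x y \<le> b i * dist x y" using b0(3)[OF that(1)] by (intro mult_right_mono) auto
      also have "\<dots> \<le> dist (S i x) (S i y)" by (rule b(2)[OF that])
      finally show ?thesis .
    qed
    fix \<eta> :: real assume \<eta>: "\<eta> > 1"
    obtain \<delta> where \<delta>: "\<And>i. i \<in> {1..N} \<Longrightarrow> \<delta> i > 0"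
      "\<And>i p x y x' y'. i \<in> {1..N} \<Longrightarrow> p \<in> K \<Longrightarrow> {x, y, x', y'} \<subseteq> K \<inter> ball p (\<delta> i) \<Longrightarrow>
       dist (S i x) (S i y) * dist x' y' \<le> \<eta> * dist (S i x') (S i y') * dist x y"
      using dist_S[OF _ \<eta>] by metis
    define \<delta>0 where "\<delta>0 = Min (insert 1 (\<delta> ` {1..N}))"
    have \<delta>0: "0 < \<delta>0" "\<And>i. i \<in> {1..N} \<Longrightarrow> \<delta>0 \<le> \<delta> i"
    proof -
      show "0 < \<delta>0" using \<delta>(1) unfolding \<delta>0_def by (subst Min_gr_iff) auto
      show "\<delta>0 \<le> \<delta> i" if "i \<in> {1..N}" for i using that unfolding \<delta>0_def by (intro Min_le) auto
    qed
    show "\<exists>\<delta>>0. \<forall>i\<in>{1..N}. \<forall>p\<in>K. \<forall>x y x' y'. {x, y, x', y'} \<subseteq> K \<inter> ball p \<delta> \<longrightarrow>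
       dist (S i x) (S i y) * dist x' y' \<le> \<eta> * dist (S i x') (S i y') * dist x y"
    proof (intro exI[of _ \<delta>0] conjI \<delta>0(1) ballI allI impI)
      fix i p x y x' y' assume i: "i \<in> {1..N}" and "p \<in> K" and sub: "{x, y, x', y'} \<subseteq> K \<inter> ball p \<delta>0"
      have "{x, y, x', y'} \<subseteq> K \<inter> ball p (\<delta> i)"
        using sub subset_ball[OF \<delta>0(2)[OF i], of p] by blast
      then show "dist (S i x) (S i y) * dist x' y' \<le> \<eta> * dist (S i x') (S i y') * dist x y"
        using \<delta>(2)[OF i \<open>p \<in> K\<close>] by blast
    qed
  qed
  then show ?thesis by (rule that)
qed

section \<open>Iterated maps, the coding map, distortion along words and cut sets\<close>

context quasi_conformal_ifs
begin

abbreviation "words \<equiv> lists {1..N}"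
abbreviation "\<Sigma> \<equiv> full_shift N"
abbreviation "\<pi> \<equiv> coding_map K S"
abbreviation "\<Phi> \<equiv> comp_word S"

lemma dist_K: "x \<in> K \<Longrightarrow> y \<in> K \<Longrightarrow> dist x y \<le> diameter K"
  using diameter_bounded_bound[OF compact_imp_bounded[OF compact_K]] .

lemma comp_word_in: "w \<in> words \<Longrightarrow> x \<in> K \<Longrightarrow> \<Phi> w x \<in> K"
  by (induction w) (auto intro: S_in)

lemma comp_word_upper:
  assumes "w \<in> words" "x \<in> K" "y \<in> K"
  shows "dist (\<Phi> w x) (\<Phi> w y) \<le> c ^ length w * dist x y"
  using assms(1)
proof (induction w)
  case (Cons i w)
  have "dist (\<Phi> (i # w) x) (\<Phi> (i # w) y) \<le> c * dist (\<Phi> w x) (\<Phi> w y)"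
    using Cons assms by (auto intro!: upper comp_word_in)
  also have "\<dots> \<le> c * (c ^ length w * dist x y)"
    using Cons c by (intro mult_left_mono) auto
  finally show ?case by simp
qed simp

lemma comp_word_lower:
  assumes "w \<in> words" "x \<in> K" "y \<in> K"
  shows "b ^ length w * dist x y \<le> dist (\<Phi> w x) (\<Phi> w y)"
  using assms(1)
proof (induction w)
  case (Cons i w)
  have "b ^ length (i # w) * dist x y \<le> b * dist (\<Phi> w x) (\<Phi> w y)"
    using Cons b by (auto simp: mult.assoc)
  also have "\<dots> \<le> dist (\<Phi> (i # w) x) (\<Phi> (i # w) y)"
    using Cons assms by (auto intro!: lower comp_word_in)
  finally show ?case .
qed simp

lemma comp_word_dist_le:
  assumes "w \<in> words" "x \<in> K" "y \<in> K"
  shows "dist (\<Phi> w x) (\<Phi> w y) \<le> dist x y"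
proof -
  have "c ^ length w * dist x y \<le> 1 * dist x y"
    using c by (intro mult_right_mono power_le_one) auto
  then show ?thesis using comp_word_upper[OF assms] by simp
qed

lemma comp_word_diameter:
  assumes "w \<in> words" "x \<in> K" "y \<in> K"
  shows "dist (\<Phi> w x) (\<Phi> w y) \<le> c ^ length w * diameter K"
proof -
  have "c ^ length w * dist x y \<le> c ^ length w * diameter K"
    using c dist_K assms by (intro mult_left_mono) auto
  then show ?thesis using comp_word_upper[OF assms] by simp
qed

text \<open>This justifies the definite description in \<open>coding_map\<close>: a word of length
  \<open>n\<close> maps \<open>K\<close> to a set of diameter at most
  \<open>c ^ n * diameter K\<close>, so the orbits are Cauchy and their limits agree.\<close>

lemma coding_map_tendsto:
  assumes \<omega>: "\<omega> \<in> \<Sigma>" and x: "x \<in> K"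
  shows "(\<lambda>n. word_map S \<omega> n x) \<longlonglongrightarrow> \<pi> \<omega>"
proof -
  have null: "(\<lambda>n. c ^ n * diameter K) \<longlonglongrightarrow> 0"
    using c by (intro tendsto_mult_left_zero LIMSEQ_realpow_zero) auto
  have step: "dist (word_map S \<omega> m y) (word_map S \<omega> n z) \<le> c ^ n * diameter K"
    if "n \<le> m" "y \<in> K" "z \<in> K" for m n y z
  proof -
    have "word_map S \<omega> m y = \<Phi> (map \<omega> [0..<n]) (\<Phi> (map \<omega> [n..<m]) y)"
      using \<open>n \<le> m\<close> upt_add_eq_append[of 0 n "m - n"]
      by (simp add: word_map_eq_comp_word comp_word_append)
    moreover have "\<Phi> (map \<omega> [n..<m]) y \<in> K"
      using \<omega> \<open>y \<in> K\<close> by (intro comp_word_in) (auto simp: full_shift_def)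
    ultimately show ?thesis
      using comp_word_diameter[OF map_upt_in_lists[OF \<omega>], of _ z n] \<open>z \<in> K\<close>
      by (simp add: word_map_eq_comp_word)
  qed
  have "Cauchy (\<lambda>n. word_map S \<omega> n x)"
  proof (rule metric_CauchyI)
    fix e :: real assume "0 < e"
    then obtain M where M: "\<And>n. n \<ge> M \<Longrightarrow> c ^ n * diameter K < e"
      using order_tendstoD(2)[OF null] unfolding eventually_sequentially by blast
    have *: "dist (word_map S \<omega> m x) (word_map S \<omega> n x) < e" if "m \<ge> n" "n \<ge> M" for m n
      using step[OF that(1) x x] M[OF that(2)] by linarith
    show "\<exists>M. \<forall>m\<ge>M. \<forall>n\<ge>M. dist (word_map S \<omega> m x) (word_map S \<omega> n x) < e"
      using * by (metis dist_commute linear)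
  qed
  then obtain l where l: "(\<lambda>n. word_map S \<omega> n x) \<longlonglongrightarrow> l"
    using Cauchy_convergent convergentD by blast
  have all: "(\<lambda>n. word_map S \<omega> n y) \<longlonglongrightarrow> l" if y: "y \<in> K" for y
  proof -
    have "(\<lambda>n. dist (word_map S \<omega> n x) (word_map S \<omega> n y)) \<longlonglongrightarrow> 0"
      by (rule tendsto_sandwich[OF _ _ tendsto_const null]) (auto intro!: always_eventually step x y)
    then have "(\<lambda>n. word_map S \<omega> n x - word_map S \<omega> n y) \<longlonglongrightarrow> 0"
      unfolding dist_norm by (rule tendsto_norm_zero_cancel)
    then show ?thesis by (rule Lim_transform2[OF l])
  qed
  have "\<pi> \<omega> = l"
    unfolding coding_map_def
    using all l x by (intro the_equality) (auto intro: LIMSEQ_unique)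
  then show ?thesis using l by simp
qed

lemma coding_map_in: "\<omega> \<in> \<Sigma> \<Longrightarrow> \<pi> \<omega> \<in> K"
proof -
  assume \<omega>: "\<omega> \<in> \<Sigma>"
  obtain x where x: "x \<in> K" using K_nonempty by blast
  have "\<forall>n. word_map S \<omega> n x \<in> K"
    using comp_word_in[OF map_upt_in_lists[OF \<omega>] x] by (simp add: word_map_eq_comp_word)
  then show ?thesis
    using closed_sequentially[OF compact_imp_closed[OF compact_K] _ coding_map_tendsto[OF \<omega> x]] by blast
qed

text \<open>Links the two sides: it lets a cylinder of the shift be compared with the image of the
  coding map under \<open>\<Phi> w\<close>. The limit passes through \<open>\<Phi> w\<close> because
  that map does not increase distances on \<open>K\<close>.\<close>

lemma coding_map_prepend:
  assumes w: "w \<in> words" and \<omega>: "\<omega> \<in> \<Sigma>"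
  shows "\<pi> (prepend w \<omega>) = \<Phi> w (\<pi> \<omega>)"
proof -
  obtain x where x: "x \<in> K" using K_nonempty by blast
  have in_K: "word_map S \<omega> n x \<in> K" for n
    using comp_word_in[OF map_upt_in_lists[OF \<omega>] x] by (simp add: word_map_eq_comp_word)
  have "(\<lambda>n. word_map S (prepend w \<omega>) (n + length w) x) \<longlonglongrightarrow> \<pi> (prepend w \<omega>)"
    using coding_map_tendsto[OF prepend_in_full_shift[OF w \<omega>] x] by (rule LIMSEQ_ignore_initial_segment)
  moreover have "word_map S (prepend w \<omega>) (n + length w) x = \<Phi> w (word_map S \<omega> n x)" for n
    using map_prepend[of w \<omega> n] by (simp add: word_map_eq_comp_word comp_word_append add.commute)
  ultimately have 1: "(\<lambda>n. \<Phi> w (word_map S \<omega> n x)) \<longlonglongrightarrow> \<pi> (prepend w \<omega>)" by simp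
  have "(\<lambda>n. dist (word_map S \<omega> n x) (\<pi> \<omega>)) \<longlonglongrightarrow> 0"
    using coding_map_tendsto[OF \<omega> x] unfolding tendsto_dist_iff[of _ "\<pi> \<omega>"] .
  then have "(\<lambda>n. dist (\<Phi> w (word_map S \<omega> n x)) (\<Phi> w (\<pi> \<omega>))) \<longlonglongrightarrow> 0"
    by (rule tendsto_sandwich[OF _ _ tendsto_const, rotated 2])
      (auto intro!: always_eventually comp_word_dist_le w in_K coding_map_in \<omega>)
  then have "(\<lambda>n. \<Phi> w (word_map S \<omega> n x)) \<longlonglongrightarrow> \<Phi> w (\<pi> \<omega>)"
    unfolding tendsto_dist_iff[of _ "\<Phi> w (\<pi> \<omega>)"] .
  with 1 show ?thesis by (rule LIMSEQ_unique)
qed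

lemma coding_map_dist:
  assumes "\<omega> \<in> \<Sigma>" "\<tau> \<in> \<Sigma>" "map \<omega> [0..<n] = map \<tau> [0..<n]"
  shows "dist (\<pi> \<omega>) (\<pi> \<tau>) \<le> c ^ n * diameter K"
proof -
  have *: "\<pi> \<sigma> = \<Phi> (map \<sigma> [0..<n]) (\<pi> (\<lambda>k. \<sigma> (n + k)))" if "\<sigma> \<in> \<Sigma>" for \<sigma>
    using coding_map_prepend[OF map_upt_in_lists[OF that] drop_in_full_shift[OF that], of n n]
    by (simp only: prepend_take_drop)
  show ?thesis
    using comp_word_diameter[OF map_upt_in_lists[OF assms(1)], of "\<pi> (\<lambda>k. \<omega> (n + k))" "\<pi> (\<lambda>k. \<tau> (n + k))" n]
      *[OF assms(1)] *[OF assms(2)] assms(3) coding_map_in[OF drop_in_full_shift] assms(1,2)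
    by (metis length_map length_upt minus_nat.diff_0)
qed

text \<open>The last letters of a word act first. After \<open>k0\<close> of them the image of
  \<open>K\<close> fits into a ball of radius \<open>\<delta>\<close>, and from then on every
  further letter costs a factor \<open>\<eta>\<close> only. As \<open>\<eta>\<close> may be taken
  arbitrarily close to 1, the distortion grows subexponentially in the length.\<close>

lemma comp_word_distortion:
  assumes \<eta>: "\<eta> > 1"
  obtains C where "C \<ge> 1" "\<And>w x y x' y'. w \<in> words \<Longrightarrow> x \<in> K \<Longrightarrow> y \<in> K \<Longrightarrow> x' \<in> K \<Longrightarrow> y' \<in> K \<Longrightarrow>
    dist (\<Phi> w x) (\<Phi> w y) * dist x' y' \<le> C * \<eta> ^ length w * dist (\<Phi> w x') (\<Phi> w y') * dist x y"
proof -
  obtain \<delta> where \<delta>: "\<delta> > 0" "\<And>i p x y x' y'. i \<in> {1..N} \<Longrightarrow> p \<in> K \<Longrightarrow> {x, y, x', y'} \<subseteq> K \<inter> ball p \<delta> \<Longrightarrow>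
       dist (S i x) (S i y) * dist x' y' \<le> \<eta> * dist (S i x') (S i y') * dist x y"
    using local_distortion[OF \<eta>] by (elim exE conjE) (rule that, assumption, meson)
  have "(\<lambda>n. c ^ n * diameter K) \<longlonglongrightarrow> 0"
    using c by (intro tendsto_mult_left_zero LIMSEQ_realpow_zero) auto
  from order_tendstoD(2)[OF this \<delta>(1)]
  obtain k0 where k0: "\<And>n. n \<ge> k0 \<Longrightarrow> c ^ n * diameter K < \<delta>"
    unfolding eventually_sequentially by blast
  \<comment> \<open>For words of length at most \<open>k0\<close> the ratio between the upper bound
    1 and the lower bound \<open>b ^ k0\<close> is enough.\<close>
  define C where "C = (1 / b) ^ k0"
  have C: "C \<ge> 1" unfolding C_def using b by (intro one_le_power) (simp add: field_simps)
  have short: "dist (\<Phi> w x) (\<Phi> w y) * dist x' y' \<le> C * \<eta> ^ length w * dist (\<Phi> w x') (\<Phi> w y') * dist x y"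
    if w: "w \<in> words" "length w \<le> k0" and K: "x \<in> K" "y \<in> K" "x' \<in> K" "y' \<in> K" for w x y x' y'
  proof -
    have "b ^ k0 * dist x' y' \<le> b ^ length w * dist x' y'"
      using w b by (intro mult_right_mono power_decreasing) auto
    also have "\<dots> \<le> dist (\<Phi> w x') (\<Phi> w y')" using w K by (intro comp_word_lower) auto
    finally have "dist x' y' \<le> C * dist (\<Phi> w x') (\<Phi> w y')"
      using b by (simp add: C_def field_simps)
    also have "\<dots> \<le> (C * \<eta> ^ length w) * dist (\<Phi> w x') (\<Phi> w y')"
      using C \<eta> one_le_power[of \<eta> "length w"] by (intro mult_right_mono) auto
    finally have "dist (\<Phi> w x) (\<Phi> w y) * dist x' y' \<le> dist x y * ((C * \<eta> ^ length w) * dist (\<Phi> w x') (\<Phi> w y'))"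
      using w K by (intro mult_mono comp_word_dist_le) auto
    then show ?thesis by (simp add: mult_ac)
  qed
  have "dist (\<Phi> w x) (\<Phi> w y) * dist x' y' \<le> C * \<eta> ^ length w * dist (\<Phi> w x') (\<Phi> w y') * dist x y"
    if "w \<in> words" and K: "x \<in> K" "y \<in> K" "x' \<in> K" "y' \<in> K" for w x y x' y'
    using that(1)
  proof (induction w)
    case Nil
    show ?case using short[of "[]", OF _ _ K] by simp
  next
    case (Cons i w)
    then have w: "w \<in> words" "i \<in> {1..N}" by auto
    show ?case
    proof (cases "length (i # w) \<le> k0")
      case True
      then show ?thesis using short[OF _ _ K, of "i # w"] w by simp
    next
      case False
      let ?d = "\<lambda>u v. dist (\<Phi> w u) (\<Phi> w v)" and ?D = "\<lambda>u v. dist (\<Phi> (i # w) u) (\<Phi> (i # w) v)"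
      have small: "?d x u < \<delta>" if "u \<in> K" for u
      proof -
        have "c ^ length w * diameter K < \<delta>" using False by (intro k0) simp
        with comp_word_diameter[OF w(1) K(1) that] show ?thesis by (rule le_less_trans)
      qed
      have "{\<Phi> w x, \<Phi> w y, \<Phi> w x', \<Phi> w y'} \<subseteq> K \<inter> ball (\<Phi> w x) \<delta>"
        using small K comp_word_in[OF w(1)] \<delta>(1) by simp
      then have step: "?D x y * ?d x' y' \<le> \<eta> * ?D x' y' * ?d x y"
        using \<delta>(2)[OF w(2), of "\<Phi> w x" "\<Phi> w x" "\<Phi> w y" "\<Phi> w x'" "\<Phi> w y'", OF comp_word_in[OF w(1) K(1)]]
        by simp
      \<comment> \<open>The induction hypothesis and \<open>step\<close> are multiplied and the
        factor \<open>?d x' y'\<close> is cancelled; if it vanishes then \<open>x' = y'\<close> by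
        the lower Lipschitz bound.\<close>
      show ?thesis
      proof (cases "?d x' y' = 0")
        case True
        then have "b ^ length w * dist x' y' \<le> 0" using comp_word_lower[OF w(1) K(3,4)] by simp
        moreover have "b ^ length w > 0" using b by simp
        ultimately have "dist x' y' = 0" by (simp add: mult_le_0_iff)
        then show ?thesis using \<eta> C by simp
      next
        case False
        have "(?D x y * dist x' y') * ?d x' y' \<le> (\<eta> * ?D x' y' * ?d x y) * dist x' y'"
          using mult_right_mono[OF step, of "dist x' y'"] by (simp add: mult_ac)
        also have "\<dots> = \<eta> * ?D x' y' * (?d x y * dist x' y')" by simp
        also have "\<dots> \<le> \<eta> * ?D x' y' * (C * \<eta> ^ length w * ?d x' y' * dist x y)"
          using Cons.IH w \<eta> by (intro mult_left_mono) auto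
        also have "\<dots> = (C * \<eta> ^ length (i # w) * ?D x' y' * dist x y) * ?d x' y'"
          by (simp add: mult_ac)
        finally show ?thesis using False by (simp add: mult_le_cancel_right)
      qed
    qed
  qed
  then show ?thesis using that C by blast
qed

text \<open>The words of \<open>W\<close> are those at which the distance of the images of two fixed points of \<open>K\<close>
  first drops below a threshold \<open>\<tau>\<close>. The distortion \<open>C * \<eta> ^ length w\<close> is absorbed into \<open>\<epsilon>\<close>, because
  \<open>c ^ (length w - 1) > \<tau>\<close> bounds the length of such words.\<close>

lemma cut_set:
  assumes \<epsilon>: "\<epsilon> > 0"
  obtains B where "B > 0" "\<And>h. 0 < h \<Longrightarrow> h < 1 \<Longrightarrow> \<exists>W. finite W \<and> W \<subseteq> words \<and>
    (\<forall>\<omega>\<in>\<Sigma>. \<exists>!w. w \<in> W \<and> \<omega> \<in> word_cyl N w) \<and>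
    (\<forall>w\<in>W. \<forall>x\<in>K. \<forall>y\<in>K. dist (\<Phi> w x) (\<Phi> w y) \<le> h \<and>
       B * h powr (1 + \<epsilon>) * dist x y \<le> dist (\<Phi> w x) (\<Phi> w y))"
proof (cases "\<exists>x\<in>K. \<exists>y\<in>K. x \<noteq> y")
  \<comment> \<open>If \<open>K\<close> is a single point the empty word does.\<close>
  case False
  then have eq: "x = y" if "x \<in> K" "y \<in> K" for x y using that by blast
  show ?thesis
  proof (rule that[of 1])
    fix h :: real assume "0 < h" "h < 1"
    have "dist (\<Phi> [] x) (\<Phi> [] y) \<le> h \<and> 1 * h powr (1 + \<epsilon>) * dist x y \<le> dist (\<Phi> [] x) (\<Phi> [] y)"
      if "x \<in> K" "y \<in> K" for x y using eq[OF that] \<open>0 < h\<close> by simp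
    then show "\<exists>W. finite W \<and> W \<subseteq> words \<and> (\<forall>\<omega>\<in>\<Sigma>. \<exists>!w. w \<in> W \<and> \<omega> \<in> word_cyl N w) \<and>
      (\<forall>w\<in>W. \<forall>x\<in>K. \<forall>y\<in>K. dist (\<Phi> w x) (\<Phi> w y) \<le> h \<and>
       1 * h powr (1 + \<epsilon>) * dist x y \<le> dist (\<Phi> w x) (\<Phi> w y))"
      by (intro exI[of _ "{[]}"]) (auto simp: word_cyl_iff)
  qed simp
next
  case True
  then obtain x0 y0 where x0: "x0 \<in> K" "y0 \<in> K" "dist x0 y0 > 0" by auto
  \<comment> \<open>Distances under the cut words will lie between multiples of
    \<open>\<tau> powr (1 + e)\<close> and \<open>\<tau> powr (1 - e)\<close>; \<open>e\<close> is
    chosen so that the quotient of these exponents is \<open>1 + \<epsilon>\<close>.\<close>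
  define e where "e = \<epsilon> / (2 + \<epsilon>)"
  have e: "0 < e" "e < 1" "(1 + e) / (1 - e) = 1 + \<epsilon>"
    using \<epsilon> by (simp_all add: e_def field_simps)
  \<comment> \<open>With this rate, \<open>\<tau> < c ^ n\<close> implies
    \<open>\<eta> ^ n \<le> \<tau> powr (- e)\<close>: the distortion of every word that has not yet
    reached the threshold is a small power of \<open>\<tau>\<close>.\<close>
  define \<eta> where "\<eta> = (1 / c) powr e"
  have \<eta>: "\<eta> > 1" unfolding \<eta>_def using c e by (intro gr_one_powr) (auto simp: field_simps)
  obtain C where C: "C \<ge> 1"
    "\<And>w x y x' y'. w \<in> words \<Longrightarrow> x \<in> K \<Longrightarrow> y \<in> K \<Longrightarrow> x' \<in> K \<Longrightarrow> y' \<in> K \<Longrightarrow>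
      dist (\<Phi> w x) (\<Phi> w y) * dist x' y' \<le> C * \<eta> ^ length w * dist (\<Phi> w x') (\<Phi> w y') * dist x y"
    using comp_word_distortion[OF \<eta>] by metis
  define l where "l w = dist (\<Phi> w x0) (\<Phi> w y0) / dist x0 y0" for w
  have l_c: "l w \<le> c ^ length w" if "w \<in> words" for w
    using comp_word_upper[OF that x0(1,2)] x0(3) by (simp add: l_def field_simps)
  have l_upper: "dist (\<Phi> w x) (\<Phi> w y) \<le> C * \<eta> ^ length w * l w * dist x y"
    if "w \<in> words" "x \<in> K" "y \<in> K" for w x y
    using C(2)[OF that x0(1,2)] x0(3) by (simp add: l_def field_simps)
  have l_lower: "l w * dist x y \<le> C * \<eta> ^ length w * dist (\<Phi> w x) (\<Phi> w y)"
    if "w \<in> words" "x \<in> K" "y \<in> K" for w x y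
    using C(2)[OF that(1) x0(1,2) that(2,3)] x0(3) by (simp add: l_def field_simps)
  have \<eta>_power: "\<eta> ^ n \<le> \<tau> powr (- e)" if "0 < \<tau>" "\<tau> < c ^ n" for \<tau> n
  proof -
    have "\<eta> ^ n = (c ^ n) powr (- e)"
      using c by (simp add: \<eta>_def powr_minus_divide powr_divide power_one_over powr_power
          powr_powr mult.commute flip: powr_realpow)
    also have "\<dots> \<le> \<tau> powr (- e)" using that e by (intro powr_mono2') auto
    finally show ?thesis .
  qed
  define L where "L = C * \<eta> * diameter K"
  have L: "L \<ge> 0"
    using C(1) \<eta> diameter_ge_0[OF compact_imp_bounded[OF compact_K]] by (simp add: L_def)
  define B where "B = b / C / (L + 1) powr (1 + \<epsilon>)"
  have "B > 0" using b C(1) L by (simp add: B_def)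
  show ?thesis
  proof (rule that[OF \<open>B > 0\<close>])
    fix h :: real assume h: "0 < h" "h < 1"
    \<comment> \<open>Solves \<open>(L + 1) * \<tau> powr (1 - e) = h\<close>; the
      \<open>+ 1\<close> ensures that \<open>\<tau> < 1\<close>.\<close>
    define \<tau> where "\<tau> = (h / (L + 1)) powr (1 / (1 - e))"
    have "h / (L + 1) < 1" using h L by (simp add: field_simps)
    moreover have "0 < h / (L + 1)" using h L by simp
    ultimately have \<tau>: "0 < \<tau>" "\<tau> < 1"
      unfolding \<tau>_def using e(2) powr01_less_one[of "h / (L + 1)"] by fastforce+
    have \<tau>_minus: "\<tau> powr (1 - e) = h / (L + 1)"
      using h L e by (simp add: \<tau>_def powr_powr)
    have \<tau>_plus: "\<tau> powr (1 + e) = h powr (1 + \<epsilon>) / (L + 1) powr (1 + \<epsilon>)"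
      using h L e(2,3) by (simp add: \<tau>_def powr_powr powr_divide add_divide_distrib)
    \<comment> \<open>A stopping rule: the condition on proper prefixes makes the stopping time
      along each sequence unique.\<close>
    define W where "W = {w \<in> words. l w \<le> \<tau> \<and> (\<forall>n<length w. \<tau> < l (take n w))}"
    have "(\<lambda>n. c ^ n) \<longlonglongrightarrow> 0" using c by (intro LIMSEQ_realpow_zero) auto
    from order_tendstoD(2)[OF this \<tau>(1)] obtain k0 where k0: "\<And>n. n \<ge> k0 \<Longrightarrow> c ^ n < \<tau>"
      unfolding eventually_sequentially by blast
    have len: "length w \<le> k0" if "w \<in> W" for w
    proof (rule ccontr)
      assume "\<not> length w \<le> k0"
      then have "\<tau> < l (take k0 w)" using that by (auto simp: W_def)
      also have "take k0 w \<in> words" using that by (auto simp: W_def dest: in_set_takeD)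
      then have "l (take k0 w) \<le> c ^ k0" using l_c[of "take k0 w"] \<open>\<not> length w \<le> k0\<close> by simp
      finally show False using k0[of k0] by simp
    qed
    have "finite W"
      by (rule finite_subset[OF _ finite_lists_length_le[of "{1..N}" k0]])
        (use len in \<open>auto simp: W_def\<close>)
    have unique: "\<exists>!w. w \<in> W \<and> \<omega> \<in> word_cyl N w" if \<omega>: "\<omega> \<in> \<Sigma>" for \<omega>
    proof -
      let ?w = "\<lambda>n. map \<omega> [0..<n]"
      define n where "n = (LEAST n. l (?w n) \<le> \<tau>)"
      have "l (?w k0) \<le> \<tau>"
        using l_c[OF map_upt_in_lists[OF \<omega>], of k0] k0[of k0] by simp
      then have n: "l (?w n) \<le> \<tau>" unfolding n_def by (rule LeastI)
      have less: "\<tau> < l (?w m)" if "m < n" for m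
        using not_less_Least[OF that[unfolded n_def]] by simp
      have take_w: "take m (?w k) = ?w m" if "m < k" for m k
        using that by (simp add: take_map)
      have "?w n \<in> W"
        using n less map_upt_in_lists[OF \<omega>] take_w by (simp add: W_def)
      moreover have "v = ?w n" if "v \<in> W" "\<omega> \<in> word_cyl N v" for v
      proof -
        have v: "v = ?w (length v)" using that(2) unfolding word_cyl_iff by simp
        have "l (?w (length v)) \<le> \<tau>" using that(1) v unfolding W_def by simp
        then have "\<not> length v < n" using less[of "length v"] by linarith
        moreover have "\<not> n < length v"
        proof
          assume "n < length v"
          then have "\<tau> < l (take n v)" using that(1) unfolding W_def by simp
          moreover have "take n v = ?w n" using take_w[OF \<open>n < length v\<close>] v by simp
          ultimately show False using n by simp
        qed
        ultimately have "length v = n" by simp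
        then show ?thesis using v by simp
      qed
      moreover have "\<omega> \<in> word_cyl N (?w n)" using \<omega> unfolding word_cyl_iff by simp
      ultimately show ?thesis by (intro ex1I[of _ "?w n"] conjI) blast+
    qed
    have bounds: "dist (\<Phi> w x) (\<Phi> w y) \<le> h \<and>
       B * h powr (1 + \<epsilon>) * dist x y \<le> dist (\<Phi> w x) (\<Phi> w y)"
      if "w \<in> W" and x: "x \<in> K" "y \<in> K" for w x y
    proof -
      have w: "w \<in> words" "l w \<le> \<tau>" "\<And>n. n < length w \<Longrightarrow> \<tau> < l (take n w)"
        using \<open>w \<in> W\<close> by (auto simp: W_def)
      \<comment> \<open>As \<open>l [] = 1 > \<tau>\<close>, a cut word has a last letter. Without
        it the word is still above the threshold, so the bound \<open>\<eta>_power\<close> applies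
        to \<open>v\<close>.\<close>
      have "w \<noteq> []" using w(2) \<tau>(2) x0(3) by (auto simp: l_def)
      then obtain v j where vj: "w = v @ [j]" by (metis append_butlast_last_id)
      have v: "v \<in> words" "j \<in> {1..N}" using w(1) vj by auto
      have \<tau>v: "\<tau> < l v" using w(3)[of "length v"] vj by simp
      have "\<tau> < c ^ length v" using \<tau>v l_c[OF v(1)] by linarith
      from \<eta>_power[OF \<tau>(1) this] have \<eta>v: "\<eta> ^ length v \<le> \<tau> powr (- e)" .
      have "dist (\<Phi> w x) (\<Phi> w y) \<le> C * \<eta> ^ length w * l w * dist x y"
        by (rule l_upper[OF w(1) x])
      also have "\<dots> \<le> C * (\<eta> * \<tau> powr (- e)) * \<tau> * diameter K"
        using w(2) \<eta>v vj dist_K[OF x] \<eta> C(1) \<tau>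
        by (intro mult_mono mult_left_mono) (auto simp: l_def)
      also have "\<dots> = L * \<tau> powr (1 - e)"
        using \<tau> by (simp add: L_def powr_diff powr_minus_divide)
      also have "\<dots> = L / (L + 1) * h" by (simp add: \<tau>_minus)
      also have "\<dots> \<le> 1 * h" using h L by (intro mult_right_mono) auto
      finally have 1: "dist (\<Phi> w x) (\<Phi> w y) \<le> h" by simp
      \<comment> \<open>The last letter lowers the scale by a factor of at least \<open>b\<close>;
        this is the origin of \<open>b\<close> in \<open>B\<close>.\<close>
      have "\<tau> * (b * dist x y) \<le> l v * dist (S j x) (S j y)"
        using \<tau>v lower[OF v(2) x] \<tau>(1) b by (intro mult_mono) auto
      also have "\<dots> \<le> C * \<eta> ^ length v * dist (\<Phi> w x) (\<Phi> w y)"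
        using l_lower[OF v(1) S_in[OF v(2) x(1)] S_in[OF v(2) x(2)]]
        by (simp add: vj comp_word_append)
      also have "\<dots> \<le> C * \<tau> powr (- e) * dist (\<Phi> w x) (\<Phi> w y)"
        using \<eta>v C(1) by (intro mult_right_mono mult_left_mono) auto
      finally have "b / C * (\<tau> * \<tau> powr e) * dist x y \<le> dist (\<Phi> w x) (\<Phi> w y)"
        using C(1) \<tau> by (simp add: powr_minus field_simps)
      moreover have "\<tau> * \<tau> powr e = \<tau> powr (1 + e)" using \<tau> by (simp add: powr_add)
      ultimately show ?thesis using 1 by (simp add: \<tau>_plus B_def)
    qed
    show "\<exists>W. finite W \<and> W \<subseteq> words \<and> (\<forall>\<omega>\<in>\<Sigma>. \<exists>!w. w \<in> W \<and> \<omega> \<in> word_cyl N w) \<and>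
      (\<forall>w\<in>W. \<forall>x\<in>K. \<forall>y\<in>K. dist (\<Phi> w x) (\<Phi> w y) \<le> h \<and>
       B * h powr (1 + \<epsilon>) * dist x y \<le> dist (\<Phi> w x) (\<Phi> w y))"
    proof (intro exI[of _ W] conjI ballI)
      show "W \<subseteq> words" by (auto simp: W_def)
    qed (use \<open>finite W\<close> unique bounds in \<open>simp_all\<close>)
  qed
qed

end

section \<open>Gibbs measures\<close>

lemma shift_funpow: "(shift ^^ n) \<omega> = (\<lambda>k. \<omega> (n + k))"
  by (induction n arbitrary: \<omega>) (auto simp: shift_def)

text \<open>Both words are read off one sequence \<open>\<omega>\<close>, so their Birkhoff sums add
  up exactly to that of the concatenation. The Gibbs comparison is used once for each of the three
  cylinders, whence the constant \<open>c ^ 3\<close>.\<close>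

lemma shift_gibbs_measure_quasi_Bernoulli:
  assumes gibbs: "shift_gibbs_measure N \<mu>" and N: "N > 0"
  obtains g where "g > 0" "\<And>v w. v \<in> lists {1..N} \<Longrightarrow> w \<in> lists {1..N} \<Longrightarrow>
    measure \<mu> (word_cyl N v) * measure \<mu> (word_cyl N w) \<le> g * measure \<mu> (word_cyl N (v @ w))"
proof -
  obtain \<psi> :: "(nat \<Rightarrow> nat) \<Rightarrow> real" and c p where c: "c \<ge> 1"
    and \<psi>: "\<And>\<omega> n. \<omega> \<in> full_shift N \<Longrightarrow>
       (let R = measure \<mu> (cylinder N \<omega> n) / exp ((\<Sum>k<n. \<psi> ((shift ^^ k) \<omega>)) - real n * p)
        in 1 / c \<le> R \<and> R \<le> c)"
    using gibbs unfolding shift_gibbs_measure_def by metis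
  define E where "E \<omega> n = exp ((\<Sum>k<n. \<psi> ((shift ^^ k) \<omega>)) - real n * p)" for \<omega> n
  have E: "E \<omega> n \<le> c * measure \<mu> (cylinder N \<omega> n)" "measure \<mu> (cylinder N \<omega> n) \<le> c * E \<omega> n"
    if "\<omega> \<in> full_shift N" for \<omega> n
    using \<psi>[OF that, of n] c by (auto simp: Let_def E_def field_simps)
  have E_add: "E \<omega> (n + m) = E \<omega> n * E ((shift ^^ n) \<omega>) m" for \<omega> n m
  proof -
    have "(\<Sum>k<n + m. \<psi> ((shift ^^ k) \<omega>)) =
        (\<Sum>k<n. \<psi> ((shift ^^ k) \<omega>)) + (\<Sum>k<m. \<psi> ((shift ^^ k) ((shift ^^ n) \<omega>)))"
      by (induction m) (auto simp: shift_funpow add_ac)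
    then show ?thesis by (simp add: E_def algebra_simps flip: exp_add)
  qed
  have "measure \<mu> (word_cyl N v) * measure \<mu> (word_cyl N w) \<le> c ^ 3 * measure \<mu> (word_cyl N (v @ w))"
    if vw: "v \<in> lists {1..N}" "w \<in> lists {1..N}" for v w
  proof -
    define \<omega> where "\<omega> = prepend (v @ w) (\<lambda>_. 1)"
    have "(\<lambda>_. 1) \<in> full_shift N" using N by (auto simp: full_shift_def)
    then have \<omega>: "\<omega> \<in> full_shift N"
      unfolding \<omega>_def using vw by (intro prepend_in_full_shift) auto
    have \<omega>': "(shift ^^ length v) \<omega> \<in> full_shift N"
      unfolding shift_funpow by (rule drop_in_full_shift[OF \<omega>])
    \<comment> \<open>The Gibbs inequality holds for every sequence in a cylinder; the shifted
      \<open>\<omega>\<close> is the one taken for \<open>w\<close>.\<close>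
    have cyls: "word_cyl N v = cylinder N \<omega> (length v)"
      "word_cyl N w = cylinder N ((shift ^^ length v) \<omega>) (length w)"
      "word_cyl N (v @ w) = cylinder N \<omega> (length v + length w)"
      by (auto simp: cylinder_def \<omega>_def prepend_def nth_append shift_funpow)
    have "measure \<mu> (word_cyl N v) * measure \<mu> (word_cyl N w) \<le>
        (c * E \<omega> (length v)) * (c * E ((shift ^^ length v) \<omega>) (length w))"
      unfolding cyls using c E(2)[OF \<omega>] E(2)[OF \<omega>'] by (intro mult_mono) (auto simp: E_def)
    also have "\<dots> = c\<^sup>2 * E \<omega> (length v + length w)"
      by (simp add: E_add power2_eq_square)
    also have "\<dots> \<le> c\<^sup>2 * (c * measure \<mu> (word_cyl N (v @ w)))"
      unfolding cyls using E(1)[OF \<omega>] by (intro mult_left_mono) auto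
    finally show ?thesis by (simp add: power3_eq_cube power2_eq_square mult_ac)
  qed
  then show ?thesis using that[of "c ^ 3"] c by simp
qed

text \<open>Uniform continuity with respect to the length of the common prefix, which on the compact
  full shift is continuity. In this form it hands over directly the depth at which \<open>F\<close>
  is almost constant on cylinders.\<close>

definition cyl_continuous :: "nat \<Rightarrow> ((nat \<Rightarrow> nat) \<Rightarrow> 'a::metric_space) \<Rightarrow> bool" where
  "cyl_continuous N F \<longleftrightarrow> (\<forall>e>0. \<exists>n. \<forall>\<omega>\<in>full_shift N. \<forall>\<tau>\<in>full_shift N.
     map \<omega> [0..<n] = map \<tau> [0..<n] \<longrightarrow> dist (F \<omega>) (F \<tau>) \<le> e)"

lemma cyl_continuousE:
  assumes "cyl_continuous N F" "e > 0"
  obtains n where "\<And>\<omega> \<tau>. \<omega> \<in> full_shift N \<Longrightarrow> \<tau> \<in> full_shift N \<Longrightarrow>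
     map \<omega> [0..<n] = map \<tau> [0..<n] \<Longrightarrow> dist (F \<omega>) (F \<tau>) \<le> e"
  using assms unfolding cyl_continuous_def by (metis (no_types, lifting))

lemma cyl_continuous_prepend:
  assumes F: "cyl_continuous N F" and w: "w \<in> lists {1..N}"
  shows "cyl_continuous N (\<lambda>\<omega>. F (prepend w \<omega>))"
  unfolding cyl_continuous_def
proof (intro allI impI)
  fix e :: real assume "e > 0"
  then obtain n where n: "\<And>\<omega> \<tau>. \<omega> \<in> full_shift N \<Longrightarrow> \<tau> \<in> full_shift N \<Longrightarrow>
     map \<omega> [0..<n] = map \<tau> [0..<n] \<Longrightarrow> dist (F \<omega>) (F \<tau>) \<le> e"
    using cyl_continuousE[OF F] by metis
  show "\<exists>n. \<forall>\<omega>\<in>full_shift N. \<forall>\<tau>\<in>full_shift N.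
      map \<omega> [0..<n] = map \<tau> [0..<n] \<longrightarrow> dist (F (prepend w \<omega>)) (F (prepend w \<tau>)) \<le> e"
  proof (intro exI[of _ n] ballI impI)
    fix \<omega> \<tau> assume "\<omega> \<in> full_shift N" "\<tau> \<in> full_shift N" "map \<omega> [0..<n] = map \<tau> [0..<n]"
    then show "dist (F (prepend w \<omega>)) (F (prepend w \<tau>)) \<le> e"
      by (intro n prepend_in_full_shift w) (auto simp: prepend_def)
  qed
qed

locale shift_measure = prob_space \<mu> for N :: nat and \<mu> :: "(nat \<Rightarrow> nat) measure" +
  assumes alphabet_nonempty: "N > 0" and sets_\<mu>: "sets \<mu> = sets (restrict_space borel (full_shift N))"
begin

lemma space_\<mu>: "space \<mu> = full_shift N"
  using sets_eq_imp_space_eq[OF sets_\<mu>] by (simp add: space_restrict_space)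

lemma word_cyl_measurable [measurable]: "word_cyl N w \<in> sets \<mu>"
proof -
  have "closed {\<tau>::nat \<Rightarrow> nat. k < length w \<longrightarrow> \<tau> k = w ! k}" for k
  proof (cases "k < length w")
    case True
    have "closed {\<tau>::nat \<Rightarrow> nat. \<tau> k = w ! k}"
      by (intro closed_Collect_eq continuous_on_product_coordinates continuous_on_const)
    then show ?thesis using True by simp
  qed simp
  then have "closed {\<tau>::nat \<Rightarrow> nat. \<forall>k. k < length w \<longrightarrow> \<tau> k = w ! k}"
    by (rule closed_Collect_all)
  moreover have "word_cyl N w = full_shift N \<inter> {\<tau>. \<forall>k. k < length w \<longrightarrow> \<tau> k = w ! k}"
    by (auto simp: cylinder_def)
  ultimately show ?thesis unfolding sets_\<mu> sets_restrict_space by (auto intro: borel_closed)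
qed

definition words_of :: "nat \<Rightarrow> nat list set" where
  "words_of n = {w. set w \<subseteq> {1..N} \<and> length w = n}"

lemma finite_words_of: "finite (words_of n)"
  unfolding words_of_def by (rule finite_lists_length_eq) simp

lemma map_in_words_of: "\<omega> \<in> full_shift N \<Longrightarrow> map \<omega> [0..<n] \<in> words_of n"
  by (auto simp: words_of_def full_shift_def)

lemma ones_in_full_shift: "(\<lambda>_. 1) \<in> full_shift N"
  using alphabet_nonempty by (auto simp: full_shift_def)

text \<open>Functions of \<open>sample n \<omega>\<close> are constant on the cylinders of depth
  \<open>n\<close>, hence measurable, and they approximate a \<open>cyl_continuous\<close> function
  as \<open>n\<close> grows.\<close>

definition sample :: "nat \<Rightarrow> (nat \<Rightarrow> nat) \<Rightarrow> nat \<Rightarrow> nat" where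
  "sample n \<omega> = prepend (map \<omega> [0..<n]) (\<lambda>_. 1)"

lemma sample_in_full_shift: "\<omega> \<in> full_shift N \<Longrightarrow> sample n \<omega> \<in> full_shift N"
  unfolding sample_def by (intro prepend_in_full_shift map_upt_in_lists ones_in_full_shift)

lemma map_sample: "map (sample n \<omega>) [0..<n] = map \<omega> [0..<n]"
  by (auto simp: sample_def prepend_def)

lemma measurable_sample:
  fixes F :: "(nat \<Rightarrow> nat) \<Rightarrow> 'b::topological_space"
  shows "(\<lambda>\<omega>. F (sample n \<omega>)) \<in> measurable \<mu> borel"
proof (rule measurableI)
  fix A :: "'b set" assume "A \<in> sets borel"
  let ?W = "{w \<in> words_of n. F (prepend w (\<lambda>_. 1)) \<in> A}"
  have "(\<lambda>\<omega>. F (sample n \<omega>)) -` A \<inter> space \<mu> = (\<Union>w\<in>?W. word_cyl N w)"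
  proof (intro equalityI subsetI)
    fix \<omega> assume "\<omega> \<in> (\<lambda>\<omega>. F (sample n \<omega>)) -` A \<inter> space \<mu>"
    then have \<omega>: "\<omega> \<in> full_shift N" "F (sample n \<omega>) \<in> A" by (auto simp: space_\<mu>)
    then have "map \<omega> [0..<n] \<in> ?W" using map_in_words_of by (auto simp: sample_def)
    moreover have "\<omega> \<in> word_cyl N (map \<omega> [0..<n])" using \<omega>(1) unfolding word_cyl_iff by simp
    ultimately show "\<omega> \<in> (\<Union>w\<in>?W. word_cyl N w)" by blast
  next
    fix \<omega> assume "\<omega> \<in> (\<Union>w\<in>?W. word_cyl N w)"
    then obtain w where w: "w \<in> words_of n" "F (prepend w (\<lambda>_. 1)) \<in> A" "\<omega> \<in> word_cyl N w" by blast
    then have "\<omega> \<in> full_shift N" "map \<omega> [0..<n] = w"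
      unfolding word_cyl_iff by (auto simp: words_of_def)
    then show "\<omega> \<in> (\<lambda>\<omega>. F (sample n \<omega>)) -` A \<inter> space \<mu>"
      using w(2) by (simp add: space_\<mu> sample_def)
  qed
  also have "\<dots> \<in> sets \<mu>"
    using finite_words_of[of n] by (intro sets.finite_UN word_cyl_measurable) auto
  finally show "(\<lambda>\<omega>. F (sample n \<omega>)) -` A \<inter> space \<mu> \<in> sets \<mu>" .
qed simp

lemma cyl_continuous_measurable:
  fixes F :: "(nat \<Rightarrow> nat) \<Rightarrow> 'a::metric_space"
  assumes F: "cyl_continuous N F"
  shows "F \<in> borel_measurable \<mu>"
proof (rule borel_measurable_LIMSEQ_metric)
  show "(\<lambda>\<omega>. F (sample n \<omega>)) \<in> borel_measurable \<mu>" for n by (rule measurable_sample)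
  fix \<omega> assume "\<omega> \<in> space \<mu>"
  then have \<omega>: "\<omega> \<in> full_shift N" by (simp add: space_\<mu>)
  show "(\<lambda>n. F (sample n \<omega>)) \<longlonglongrightarrow> F \<omega>"
  proof (rule metric_LIMSEQ_I)
    fix e :: real assume "e > 0"
    then obtain n where n: "\<And>\<omega> \<tau>. \<omega> \<in> full_shift N \<Longrightarrow> \<tau> \<in> full_shift N \<Longrightarrow>
       map \<omega> [0..<n] = map \<tau> [0..<n] \<Longrightarrow> dist (F \<omega>) (F \<tau>) \<le> e / 2"
      using cyl_continuousE[OF F half_gt_zero] by metis
    have "dist (F (sample m \<omega>)) (F \<omega>) < e" if "m \<ge> n" for m
    proof -
      have "map (sample m \<omega>) [0..<n] = map \<omega> [0..<n]"
        using map_sample[of m \<omega>] that by (auto simp: sample_def prepend_def)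
      from n[OF sample_in_full_shift[OF \<omega>] \<omega> this] show ?thesis using \<open>e > 0\<close> by simp
    qed
    then show "\<exists>n. \<forall>m\<ge>n. dist (F (sample m \<omega>)) (F \<omega>) < e" by blast
  qed
qed

text \<open>With \<open>w = []\<close> this splits the whole shift, otherwise a single cylinder; the
  integral comparison below uses it in both ways.\<close>

lemma sum_indicator_words_of:
  assumes "\<omega> \<in> full_shift N"
  shows "(\<Sum>v\<in>words_of n. indicator (word_cyl N (w @ v)) \<omega>) = (indicator (word_cyl N w) \<omega> :: real)"
proof (cases "\<omega> \<in> word_cyl N w")
  case True
  let ?u = "map (\<lambda>k. \<omega> (length w + k)) [0..<n]"
  have w: "map \<omega> [0..<length w] = w" using True by (simp add: word_cyl_iff)
  have "map \<omega> [0..<length w + n] = w @ ?u"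
    using map_prepend[of w "\<lambda>k. \<omega> (length w + k)" n] w prepend_take_drop[of \<omega> "length w"] by simp
  moreover have "\<omega> \<in> word_cyl N (w @ v) \<longleftrightarrow> map \<omega> [0..<length w + n] = w @ v"
    if "v \<in> words_of n" for v
    using assms that unfolding word_cyl_iff by (simp add: words_of_def)
  ultimately have "\<omega> \<in> word_cyl N (w @ v) \<longleftrightarrow> v = ?u" if "v \<in> words_of n" for v
    using that by auto
  then have "(\<Sum>v\<in>words_of n. indicator (word_cyl N (w @ v)) \<omega>) =
      (\<Sum>v\<in>words_of n. if v = ?u then 1 else (0::real))"
    by (intro sum.cong) (auto simp: indicator_def)
  also have "\<dots> = 1"
    using finite_words_of[of n] map_in_words_of[OF drop_in_full_shift[OF assms]] by simp
  finally show ?thesis using True by simp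
next
  case False
  then have "\<omega> \<notin> word_cyl N (w @ v)" for v
    by (auto simp: cylinder_def nth_append)
  then show ?thesis using False by simp
qed

lemma integrable_cyl_continuous:
  fixes F :: "(nat \<Rightarrow> nat) \<Rightarrow> real"
  assumes F: "cyl_continuous N F"
    and bound: "\<And>\<omega>. \<omega> \<in> full_shift N \<Longrightarrow> \<bar>F \<omega>\<bar> \<le> M"
  shows "integrable \<mu> F" "integrable \<mu> (\<lambda>\<omega>. indicator (word_cyl N w) \<omega> * F \<omega>)"
proof -
  show *: "integrable \<mu> F"
    by (rule integrable_const_bound[of _ M])
      (use bound cyl_continuous_measurable[OF F] in \<open>auto simp: space_\<mu>\<close>)
  show "integrable \<mu> (\<lambda>\<omega>. indicator (word_cyl N w) \<omega> * F \<omega>)"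
    using integrable_mult_indicator[OF word_cyl_measurable *, of w] by simp
qed

text \<open>The quasi-Bernoulli property passes from cylinders to integrands by approximating \<open>F\<close> on
  cylinders of depth \<open>n\<close>.\<close>

lemma quasi_Bernoulli_integral:
  fixes F :: "(nat \<Rightarrow> nat) \<Rightarrow> real"
  assumes g: "g > 0" "\<And>v. v \<in> lists {1..N} \<Longrightarrow>
    prob (word_cyl N w) * prob (word_cyl N v) \<le> g * prob (word_cyl N (w @ v))"
    and w: "w \<in> lists {1..N}" and F: "cyl_continuous N F"
    and bound: "\<And>\<omega>. \<omega> \<in> full_shift N \<Longrightarrow> 0 \<le> F \<omega> \<and> F \<omega> \<le> M"
  shows "prob (word_cyl N w) * (\<integral>\<omega>. F (prepend w \<omega>) \<partial>\<mu>) \<le>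
    g * (\<integral>\<omega>. indicator (word_cyl N w) \<omega> * F \<omega> \<partial>\<mu>)"
proof -
  let ?G = "\<lambda>\<omega>. F (prepend w \<omega>)" and ?I = "\<lambda>w \<omega>. (indicator (word_cyl N w) \<omega> :: real)"
  note int_F = integrable_cyl_continuous[OF F, of M]
  have bound': "\<bar>F \<omega>\<bar> \<le> M" if "\<omega> \<in> full_shift N" for \<omega> using bound[OF that] by simp
  have int_G: "integrable \<mu> ?G"
    by (rule integrable_cyl_continuous(1)[OF cyl_continuous_prepend[OF F w]])
      (use bound' prepend_in_full_shift[OF w] in auto)
  have int_I: "integrable \<mu> (?I v)" for v
    by (intro integrable_real_indicator word_cyl_measurable) (simp add: emeasure_eq_measure)
  have int_eq: "(\<integral>\<omega>. ?I v \<omega> \<partial>\<mu>) = prob (word_cyl N v)" for v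
    using word_cyl_measurable[of v] by simp
  have approx: "prob (word_cyl N w) * (\<integral>\<omega>. ?G \<omega> \<partial>\<mu>) \<le>
    g * (\<integral>\<omega>. ?I w \<omega> * F \<omega> \<partial>\<mu>) + 2 * g * e" if e: "e > 0" for e
  proof -
    obtain n where n: "\<And>\<omega> \<tau>. \<omega> \<in> full_shift N \<Longrightarrow> \<tau> \<in> full_shift N \<Longrightarrow>
       map \<omega> [0..<n] = map \<tau> [0..<n] \<Longrightarrow> dist (F \<omega>) (F \<tau>) \<le> e"
      using cyl_continuousE[OF F e] by metis
    define a where "a v = F (prepend (w @ v) (\<lambda>_. 1))" for v
    have words: "v \<in> lists {1..N}" if "v \<in> words_of n" for v
      using that by (auto simp: words_of_def)
    have a_nonneg: "0 \<le> a v" if "v \<in> words_of n" for v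
      unfolding a_def using bound prepend_in_full_shift[OF _ ones_in_full_shift] w words[OF that] by simp
    \<comment> \<open>Sequences in this cylinder share \<open>length w + n\<close> letters with the
      sample point, more than the \<open>n\<close> that the choice of depth asks for.\<close>
    have near: "\<bar>F \<omega> - a v\<bar> \<le> e" if "v \<in> words_of n" "\<omega> \<in> word_cyl N (w @ v)" for \<omega> v
    proof -
      have "map \<omega> [0..<n] = map (prepend (w @ v) (\<lambda>_. 1)) [0..<n]"
        using that by (auto simp: words_of_def cylinder_def prepend_def)
      then show ?thesis
        unfolding a_def dist_real_def[symmetric]
        using that w words[OF that(1)]
        by (intro n prepend_in_full_shift ones_in_full_shift) (auto simp: cylinder_def)
    qed
    have "(\<integral>\<omega>. ?G \<omega> \<partial>\<mu>) \<le> (\<integral>\<omega>. (\<Sum>v\<in>words_of n. (a v + e) * ?I v \<omega>) \<partial>\<mu>)"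
    proof (intro integral_mono int_G Bochner_Integration.integrable_sum integrable_mult_right int_I)
      fix \<omega> assume "\<omega> \<in> space \<mu>"
      then have \<omega>: "\<omega> \<in> full_shift N" by (simp add: space_\<mu>)
      have "?G \<omega> = (\<Sum>v\<in>words_of n. ?G \<omega> * ?I v \<omega>)"
        using sum_indicator_words_of[OF \<omega>, of "[]" n] \<omega>
        by (simp add: cylinder_def flip: sum_distrib_left)
      also have "\<dots> \<le> (\<Sum>v\<in>words_of n. (a v + e) * ?I v \<omega>)"
      proof (intro sum_mono)
        fix v assume v: "v \<in> words_of n"
        show "?G \<omega> * ?I v \<omega> \<le> (a v + e) * ?I v \<omega>"
        proof (cases "\<omega> \<in> word_cyl N v")
          case True
          then have "map (prepend w \<omega>) [0..<length (w @ v)] = w @ v"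
            using map_prepend[of w \<omega> "length v"] by (simp add: word_cyl_iff)
          then have "prepend w \<omega> \<in> word_cyl N (w @ v)"
            using prepend_in_full_shift[OF w \<omega>] unfolding word_cyl_iff by simp
          from near[OF v this] show ?thesis using True by simp
        qed simp
      qed
      finally show "?G \<omega> \<le> (\<Sum>v\<in>words_of n. (a v + e) * ?I v \<omega>)" .
    qed
    also have "\<dots> = (\<Sum>v\<in>words_of n. (a v + e) * prob (word_cyl N v))"
      by (subst Bochner_Integration.integral_sum)
        (auto intro: integrable_mult_right int_I simp: word_cyl_measurable)
    finally have "prob (word_cyl N w) * (\<integral>\<omega>. ?G \<omega> \<partial>\<mu>) \<le>
        prob (word_cyl N w) * (\<Sum>v\<in>words_of n. (a v + e) * prob (word_cyl N v))"
      by (intro mult_left_mono) auto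
    also have "\<dots> = (\<Sum>v\<in>words_of n. (a v + e) * (prob (word_cyl N w) * prob (word_cyl N v)))"
      by (simp add: sum_distrib_left mult_ac)
    also have "\<dots> \<le> (\<Sum>v\<in>words_of n. (a v + e) * (g * prob (word_cyl N (w @ v))))"
      using a_nonneg g(2)[OF words] that by (intro sum_mono mult_left_mono) auto
    also have "\<dots> = g * (\<Sum>v\<in>words_of n. (a v + e) * prob (word_cyl N (w @ v)))"
      by (simp only: sum_distrib_left mult.left_commute)
    also have "(\<Sum>v\<in>words_of n. (a v + e) * prob (word_cyl N (w @ v))) =
        (\<integral>\<omega>. (\<Sum>v\<in>words_of n. (a v + e) * ?I (w @ v) \<omega>) \<partial>\<mu>)"
      by (subst Bochner_Integration.integral_sum[OF integrable_mult_right[OF int_I]])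
        (simp only: integral_mult_right_zero int_eq)
    \<comment> \<open>On the cylinder \<open>a v \<le> F \<omega> + e\<close>; the second
      \<open>e\<close> was spent when \<open>?G\<close> was replaced by step values.\<close>
    also have "g * \<dots> \<le> g * (\<integral>\<omega>. ?I w \<omega> * F \<omega> + ?I w \<omega> * (2 * e) \<partial>\<mu>)"
    proof (intro mult_left_mono integral_mono Bochner_Integration.integrable_sum
        Bochner_Integration.integrable_add integrable_mult_right integrable_mult_left int_I int_F(2) bound')
      fix \<omega> assume "\<omega> \<in> space \<mu>"
      then have \<omega>: "\<omega> \<in> full_shift N" by (simp add: space_\<mu>)
      have "(\<Sum>v\<in>words_of n. (a v + e) * ?I (w @ v) \<omega>) \<le> (\<Sum>v\<in>words_of n. (F \<omega> + 2 * e) * ?I (w @ v) \<omega>)"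
      proof (intro sum_mono)
        fix v assume v: "v \<in> words_of n"
        show "(a v + e) * ?I (w @ v) \<omega> \<le> (F \<omega> + 2 * e) * ?I (w @ v) \<omega>"
        proof (cases "\<omega> \<in> word_cyl N (w @ v)")
          case True
          from near[OF v this] show ?thesis using True by simp
        qed simp
      qed
      also have "\<dots> = ?I w \<omega> * F \<omega> + ?I w \<omega> * (2 * e)"
        unfolding sum_distrib_left[symmetric] sum_indicator_words_of[OF \<omega>] by (simp add: algebra_simps)
      finally show "(\<Sum>v\<in>words_of n. (a v + e) * ?I (w @ v) \<omega>) \<le> ?I w \<omega> * F \<omega> + ?I w \<omega> * (2 * e)" .
    qed (use g in auto)
    also have "\<dots> = g * ((\<integral>\<omega>. ?I w \<omega> * F \<omega> \<partial>\<mu>) + prob (word_cyl N w) * (2 * e))"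
      by (subst Bochner_Integration.integral_add)
        (auto intro!: int_F(2) bound' integrable_mult_left int_I simp: word_cyl_measurable)
    also have "\<dots> \<le> g * ((\<integral>\<omega>. ?I w \<omega> * F \<omega> \<partial>\<mu>) + 1 * (2 * e))"
      using g(1) that by (intro mult_left_mono add_left_mono mult_right_mono) auto
    finally show ?thesis using that g(1) by (simp add: algebra_simps)
  qed
  have *: "prob (word_cyl N w) * (\<integral>\<omega>. ?G \<omega> \<partial>\<mu>) \<le> g * (\<integral>\<omega>. ?I w \<omega> * F \<omega> \<partial>\<mu>) + e"
    if "e > 0" for e
    using approx[of "e / (2 * g)"] that g(1) by simp
  show ?thesis by (rule field_le_epsilon) (rule *)
qed

end

section \<open>The lower bound\<close>

text \<open>The optimal allocation of \<open>n\<close> centers to pieces of masses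
  \<open>P i\<close>: the left side is the minimum of the right side over allocations, reached for
  \<open>m i\<close> proportional to \<open>P i powr q\<close>.\<close>

lemma Hoelder_negative_exponent:
  fixes P m :: "'i \<Rightarrow> real"
  assumes I: "finite I" "I \<noteq> {}" and q: "0 < q" "q < 1"
    and P: "\<And>i. i \<in> I \<Longrightarrow> P i > 0" and m: "\<And>i. i \<in> I \<Longrightarrow> m i > 0" and n: "(\<Sum>i\<in>I. m i) \<le> n"
  shows "(\<Sum>i\<in>I. P i powr q) powr (1 / q) * n powr (- ((1 - q) / q)) \<le>
    (\<Sum>i\<in>I. P i * m i powr (- ((1 - q) / q)))"
proof -
  let ?\<kappa> = "(1 - q) / q"
  define u where "u i = P i * m i powr (- ?\<kappa>)" for i
  define U where "U = (\<Sum>i\<in>I. u i)"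
  have u: "u i > 0" if "i \<in> I" for i
    using P[OF that] m[OF that] by (simp add: u_def)
  have U: "U > 0" unfolding U_def using I u by (intro sum_pos) auto
  have "0 < (\<Sum>i\<in>I. m i)" using I m by (intro sum_pos) auto
  then have n0: "n > 0" using n by linarith
  \<comment> \<open>Young's inequality after normalizing \<open>u\<close> by its sum and
    \<open>m\<close> by \<open>n\<close>; summing over \<open>i\<close> then leaves a bracket of at
    most 1.\<close>
  have "P i powr q \<le> U powr q * n powr (1 - q) * (q * (u i / U) + (1 - q) * (m i / n))"
    if i: "i \<in> I" for i
  proof -
    have "u i powr q = P i powr q * m i powr (- (1 - q))"
      using q by (simp add: u_def powr_mult powr_powr)
    then have "P i powr q = u i powr q * m i powr (1 - q)"
      using m[OF i] by (simp add: mult.assoc flip: powr_add)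
    also have "\<dots> = U powr q * n powr (1 - q) * ((u i / U) powr q * (m i / n) powr (1 - q))"
      using U n0 u[OF i] m[OF i] by (simp add: powr_divide)
    also have "\<dots> \<le> U powr q * n powr (1 - q) * (q * (u i / U) + (1 - q) * (m i / n))"
      using U n0 u[OF i] m[OF i] q by (intro mult_left_mono Youngs_inequality_0) auto
    finally show ?thesis .
  qed
  then have "(\<Sum>i\<in>I. P i powr q) \<le>
      (\<Sum>i\<in>I. U powr q * n powr (1 - q) * (q * (u i / U) + (1 - q) * (m i / n)))"
    by (rule sum_mono)
  also have "\<dots> = U powr q * n powr (1 - q) * (q * (U / U) + (1 - q) * ((\<Sum>i\<in>I. m i) / n))"
    by (simp add: U_def sum.distrib flip: sum_distrib_left sum_divide_distrib)
  also have "\<dots> \<le> U powr q * n powr (1 - q) * (q * 1 + (1 - q) * 1)"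
    using U n n0 q by (intro mult_left_mono add_mono) auto
  finally have "(\<Sum>i\<in>I. P i powr q) powr (1 / q) \<le> (U powr q * n powr (1 - q)) powr (1 / q)"
    using q by (intro powr_mono2 sum_nonneg) auto
  also have "\<dots> = U * n powr ?\<kappa>"
    using U n0 q by (simp add: powr_mult powr_powr)
  finally show ?thesis using n0 by (simp add: powr_minus field_simps U_def u_def)
qed

locale gibbs_ifs = quasi_conformal_ifs N K S c b + shift_measure N \<mu>
  for N :: nat and K :: "(real^'d) set" and S c b and \<mu> :: "(nat \<Rightarrow> nat) measure" +
  fixes g :: real
  assumes g: "g > 0" and quasi_Bernoulli: "\<And>v w. v \<in> lists {1..N} \<Longrightarrow> w \<in> lists {1..N} \<Longrightarrow>
    prob (word_cyl N v) * prob (word_cyl N w) \<le> g * prob (word_cyl N (v @ w))"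
begin

lemma cyl_continuous_coding:
  assumes h: "continuous_on K h"
  shows "cyl_continuous N (\<lambda>\<omega>. h (\<pi> \<omega>))"
  unfolding cyl_continuous_def
proof (intro allI impI)
  fix e :: real assume "e > 0"
  have "uniformly_continuous_on K h" using h compact_K by (rule compact_uniformly_continuous)
  then obtain \<delta> where \<delta>: "\<delta> > 0" "\<And>x y. x \<in> K \<Longrightarrow> y \<in> K \<Longrightarrow> dist x y < \<delta> \<Longrightarrow> dist (h x) (h y) < e"
    using \<open>e > 0\<close> unfolding uniformly_continuous_on_def by metis
  have "(\<lambda>n. c ^ n * diameter K) \<longlonglongrightarrow> 0"
    using c by (intro tendsto_mult_left_zero LIMSEQ_realpow_zero) auto
  from order_tendstoD(2)[OF this \<delta>(1)] obtain n where n: "c ^ n * diameter K < \<delta>"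
    unfolding eventually_sequentially by blast
  show "\<exists>n. \<forall>\<omega>\<in>\<Sigma>. \<forall>\<tau>\<in>\<Sigma>. map \<omega> [0..<n] = map \<tau> [0..<n] \<longrightarrow> dist (h (\<pi> \<omega>)) (h (\<pi> \<tau>)) \<le> e"
  proof (intro exI[of _ n] ballI impI)
    fix \<omega> \<tau> assume *: "\<omega> \<in> \<Sigma>" "\<tau> \<in> \<Sigma>" "map \<omega> [0..<n] = map \<tau> [0..<n]"
    have "dist (\<pi> \<omega>) (\<pi> \<tau>) < \<delta>" using coding_map_dist[OF *] n by (rule le_less_trans)
    from \<delta>(2)[OF coding_map_in[OF *(1)] coding_map_in[OF *(2)] this]
    show "dist (h (\<pi> \<omega>)) (h (\<pi> \<tau>)) \<le> e" by simp
  qed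
qed

lemma measurable_coding: "\<pi> \<in> borel_measurable \<mu>"
  using cyl_continuous_measurable[OF cyl_continuous_coding[OF continuous_on_id]] by simp

lemma bounded_on_K:
  fixes h :: "real^'d \<Rightarrow> real"
  assumes "continuous_on K h"
  obtains M where "\<And>x. x \<in> K \<Longrightarrow> \<bar>h x\<bar> \<le> M"
proof -
  have "bounded (h ` K)"
    by (rule compact_imp_bounded[OF compact_continuous_image[OF assms compact_K]])
  then show ?thesis using that unfolding bounded_iff by auto
qed

lemma integrable_coding:
  fixes h :: "real^'d \<Rightarrow> real"
  assumes h: "continuous_on K h"
  shows "integrable \<mu> (\<lambda>\<omega>. h (\<pi> \<omega>))"
proof -
  obtain M where "\<And>x. x \<in> K \<Longrightarrow> \<bar>h x\<bar> \<le> M" by (rule bounded_on_K[OF h]) (rule that)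
  then show ?thesis
    by (intro integrable_cyl_continuous(1)[OF cyl_continuous_coding[OF h], of M])
      (use coding_map_in in auto)
qed

lemma comp_word_continuous: "w \<in> words \<Longrightarrow> continuous_on K (\<Phi> w)"
  by (rule lipschitz_on_continuous_on[OF lipschitz_onI[of _ _ 1]]) (auto intro: comp_word_dist_le)

lemma sum_words_integral_le:
  fixes h :: "real^'d \<Rightarrow> real"
  assumes W: "finite W" "W \<subseteq> words"
    and disj: "\<And>\<omega> v w. \<omega> \<in> \<Sigma> \<Longrightarrow> v \<in> W \<Longrightarrow> w \<in> W \<Longrightarrow> \<omega> \<in> word_cyl N v \<Longrightarrow> \<omega> \<in> word_cyl N w \<Longrightarrow> v = w"
    and h: "continuous_on K h" and nonneg: "\<And>x. x \<in> K \<Longrightarrow> 0 \<le> h x"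
  shows "(\<Sum>w\<in>W. prob (word_cyl N w) * (\<integral>\<omega>. h (\<Phi> w (\<pi> \<omega>)) \<partial>\<mu>)) \<le> g * (\<integral>\<omega>. h (\<pi> \<omega>) \<partial>\<mu>)"
proof -
  obtain M where M: "\<And>x. x \<in> K \<Longrightarrow> \<bar>h x\<bar> \<le> M" by (rule bounded_on_K[OF h]) (rule that)
  let ?F = "\<lambda>\<omega>. h (\<pi> \<omega>)" and ?I = "\<lambda>w \<omega>. (indicator (word_cyl N w) \<omega> :: real)"
  note F = cyl_continuous_coding[OF h]
  have bound: "0 \<le> ?F \<omega> \<and> ?F \<omega> \<le> M" "\<bar>?F \<omega>\<bar> \<le> M" if "\<omega> \<in> \<Sigma>" for \<omega>
    using M[OF coding_map_in[OF that]] nonneg[OF coding_map_in[OF that]] by auto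
  have "(\<Sum>w\<in>W. prob (word_cyl N w) * (\<integral>\<omega>. h (\<Phi> w (\<pi> \<omega>)) \<partial>\<mu>)) \<le>
      (\<Sum>w\<in>W. g * (\<integral>\<omega>. ?I w \<omega> * ?F \<omega> \<partial>\<mu>))"
  proof (rule sum_mono)
    fix w assume "w \<in> W"
    then have w: "w \<in> words" using W by auto
    have "(\<integral>\<omega>. h (\<Phi> w (\<pi> \<omega>)) \<partial>\<mu>) = (\<integral>\<omega>. ?F (prepend w \<omega>) \<partial>\<mu>)"
      by (intro Bochner_Integration.integral_cong) (auto simp: space_\<mu> coding_map_prepend[OF w])
    then show "prob (word_cyl N w) * (\<integral>\<omega>. h (\<Phi> w (\<pi> \<omega>)) \<partial>\<mu>) \<le> g * (\<integral>\<omega>. ?I w \<omega> * ?F \<omega> \<partial>\<mu>)"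
      using quasi_Bernoulli_integral[OF g quasi_Bernoulli[OF w] w F bound(1)] by simp
  qed
  also have "\<dots> = g * (\<integral>\<omega>. (\<Sum>w\<in>W. ?I w \<omega> * ?F \<omega>) \<partial>\<mu>)"
    by (subst Bochner_Integration.integral_sum)
      (auto intro!: integrable_cyl_continuous(2)[OF F bound(2)] simp: sum_distrib_left)
  also have "\<dots> \<le> g * (\<integral>\<omega>. ?F \<omega> \<partial>\<mu>)"
  proof (intro mult_left_mono integral_mono Bochner_Integration.integrable_sum
      integrable_cyl_continuous[OF F bound(2)])
    fix \<omega> assume "\<omega> \<in> space \<mu>"
    then have \<omega>: "\<omega> \<in> \<Sigma>" by (simp add: space_\<mu>)
    show "(\<Sum>w\<in>W. ?I w \<omega> * ?F \<omega>) \<le> ?F \<omega>"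
    proof (cases "\<exists>w\<in>W. \<omega> \<in> word_cyl N w")
      case True
      then obtain v where v: "v \<in> W" "\<omega> \<in> word_cyl N v" by blast
      have "(\<Sum>w\<in>W. ?I w \<omega> * ?F \<omega>) = (\<Sum>w\<in>W. if w = v then ?F \<omega> else 0)"
        using v disj[OF \<omega>] by (intro sum.cong) (auto simp: indicator_def)
      also have "\<dots> = ?F \<omega>" using W v by simp
      finally show ?thesis by simp
    next
      case False
      then have "(\<Sum>w\<in>W. ?I w \<omega> * ?F \<omega>) = 0" by (intro sum.neutral) auto
      then show ?thesis using bound(1)[OF \<omega>] by simp
    qed
  qed (use g in auto)
  finally show ?thesis .
qed

lemma continuous_on_infdist_powr:
  fixes f :: "real^'d \<Rightarrow> real^'d"
  assumes "continuous_on A f" "r > 0"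
  shows "continuous_on A (\<lambda>x. infdist (f x) \<alpha> powr r)"
  using assms by (intro continuous_on_powr' continuous_on_infdist continuous_on_const)
    (auto simp: infdist_nonneg)

text \<open>Each center is replaced by the point of \<open>K\<close> whose image is nearest to it, at the cost of a
  factor \<open>2\<close>.\<close>

lemma pull_back_centers:
  assumes w: "w \<in> words" and l: "l > 0" "\<And>x y. x \<in> K \<Longrightarrow> y \<in> K \<Longrightarrow> l * dist x y \<le> dist (\<Phi> w x) (\<Phi> w y)"
    and \<alpha>: "finite \<alpha>" "\<alpha> \<noteq> {}"
  obtains \<beta> where "finite \<beta>" "\<beta> \<noteq> {}" "card \<beta> \<le> card \<alpha>"
    "\<And>x a. x \<in> K \<Longrightarrow> a \<in> \<alpha> \<Longrightarrow> l / 2 * infdist x \<beta> \<le> dist (\<Phi> w x) a"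
proof -
  have "\<exists>y\<in>K. \<forall>x\<in>K. dist (\<Phi> w y) a \<le> dist (\<Phi> w x) a" for a
    by (intro continuous_attains_inf compact_K K_nonempty continuous_on_dist
        comp_word_continuous[OF w] continuous_on_const)
  then obtain y where y: "\<And>a. y a \<in> K" "\<And>a x. x \<in> K \<Longrightarrow> dist (\<Phi> w (y a)) a \<le> dist (\<Phi> w x) a"
    by metis
  have "l / 2 * infdist x (y ` \<alpha>) \<le> dist (\<Phi> w x) a" if "x \<in> K" "a \<in> \<alpha>" for x a
  proof -
    have "l * infdist x (y ` \<alpha>) \<le> l * dist x (y a)"
      using l(1) that by (intro mult_left_mono infdist_le) auto
    also have "\<dots> \<le> dist (\<Phi> w x) (\<Phi> w (y a))" using that y(1) by (intro l(2))
    also have "\<dots> \<le> dist (\<Phi> w x) a + dist (\<Phi> w (y a)) a" by (rule dist_triangle2)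
    also have "\<dots> \<le> 2 * dist (\<Phi> w x) a" using y(2)[OF that(1), of a] by simp
    finally show ?thesis by simp
  qed
  then show ?thesis using that[of "y ` \<alpha>"] \<alpha> card_image_le[OF \<alpha>(1)] by blast
qed

text \<open>By induction on \<open>n\<close>: the centers near \<open>z i\<close> serve only the pieces \<open>\<Phi> w K\<close>, \<open>w \<in> V i\<close>. If some
  \<open>z i\<close> has no center nearby, then the error is bounded below outright; otherwise each \<open>z i\<close> has fewer
  than \<open>n\<close> of them, and the Hoelder inequality recombines the induction hypotheses.\<close>

lemma quantization_lower_bound:
  fixes z :: "'i \<Rightarrow> real^'d"
  assumes r: "r > 0" and q: "0 < q" "q < 1" and I: "finite I" "card I \<ge> 2"
    and W: "finite W" "W \<subseteq> words"
    and disj: "\<And>\<omega> v w. \<omega> \<in> \<Sigma> \<Longrightarrow> v \<in> W \<Longrightarrow> w \<in> W \<Longrightarrow> \<omega> \<in> word_cyl N v \<Longrightarrow> \<omega> \<in> word_cyl N w \<Longrightarrow> v = w"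
    and V: "\<And>i. i \<in> I \<Longrightarrow> V i \<subseteq> W" and \<rho>: "\<rho> > 0"
    and close: "\<And>i w x. i \<in> I \<Longrightarrow> w \<in> V i \<Longrightarrow> x \<in> K \<Longrightarrow> dist (\<Phi> w x) (z i) \<le> \<rho>"
    and sep: "\<And>i j. i \<in> I \<Longrightarrow> j \<in> I \<Longrightarrow> i \<noteq> j \<Longrightarrow> 4 * \<rho> < dist (z i) (z j)"
    and l: "l > 0" "\<And>i w x y. i \<in> I \<Longrightarrow> w \<in> V i \<Longrightarrow> x \<in> K \<Longrightarrow> y \<in> K \<Longrightarrow> l * dist x y \<le> dist (\<Phi> w x) (\<Phi> w y)"
    and P: "\<And>i. i \<in> I \<Longrightarrow> 0 < P i" "\<And>i. i \<in> I \<Longrightarrow> P i = (\<Sum>w\<in>V i. prob (word_cyl N w))"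
    and gap: "g \<le> (l / 6) powr r * (\<Sum>i\<in>I. P i powr q) powr (1 / q)"
  obtains A where "A > 0" "\<And>n \<alpha>. finite \<alpha> \<Longrightarrow> \<alpha> \<noteq> {} \<Longrightarrow> card \<alpha> \<le> n \<Longrightarrow>
    A * real n powr (- ((1 - q) / q)) \<le> (\<integral>\<omega>. infdist (\<pi> \<omega>) \<alpha> powr r \<partial>\<mu>)"
proof -
  let ?\<kappa> = "(1 - q) / q"
  have "I \<noteq> {}" using I by auto
  \<comment> \<open>The least error enforced by a piece family without a nearby center. This bound
    is free of \<open>n\<close>, and \<open>n powr (- ?\<kappa>) \<le> 1\<close> for
    \<open>n \<ge> 1\<close>.\<close>
  define A where "A = Min ((\<lambda>i. P i * \<rho> powr r / g) ` I)"
  have A: "A > 0" "\<And>i. i \<in> I \<Longrightarrow> A \<le> P i * \<rho> powr r / g"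
    unfolding A_def using I \<open>I \<noteq> {}\<close> P(1) \<rho> g by (auto intro!: Min_le divide_pos_pos)
  \<comment> \<open>A word belonging to two families would bring their base points within
    \<open>2 * \<rho>\<close>.\<close>
  have V_disj: "V i \<inter> V j = {}" if "i \<in> I" "j \<in> I" "i \<noteq> j" for i j
  proof (rule ccontr)
    assume "V i \<inter> V j \<noteq> {}"
    then obtain w where w: "w \<in> V i" "w \<in> V j" by blast
    obtain x where "x \<in> K" using K_nonempty by blast
    then have "dist (z i) (z j) \<le> \<rho> + \<rho>"
      using close[OF that(1) w(1)] close[OF that(2) w(2)] dist_triangle3[of "z i" "z j" "\<Phi> w x"]
      by fastforce
    then show False using sep[OF that] \<rho> by simp
  qed
  have V_fin: "finite (V i)" if "i \<in> I" for i using V[OF that] W(1) by (rule finite_subset)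
  have split: "(\<Sum>i\<in>I. \<Sum>w\<in>V i. prob (word_cyl N w) * (\<integral>\<omega>. infdist (\<Phi> w (\<pi> \<omega>)) \<alpha> powr r \<partial>\<mu>))
      \<le> g * (\<integral>\<omega>. infdist (\<pi> \<omega>) \<alpha> powr r \<partial>\<mu>)" for \<alpha>
  proof -
    let ?t = "\<lambda>w. prob (word_cyl N w) * (\<integral>\<omega>. infdist (\<Phi> w (\<pi> \<omega>)) \<alpha> powr r \<partial>\<mu>)"
    have t: "?t w \<ge> 0" for w by (intro mult_nonneg_nonneg Bochner_Integration.integral_nonneg) auto
    have "(\<Sum>i\<in>I. \<Sum>w\<in>V i. ?t w) = (\<Sum>w\<in>(\<Union>i\<in>I. V i). ?t w)"
      using I V_fin V_disj by (intro sum.UNION_disjoint[symmetric]) auto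
    also have "\<dots> \<le> (\<Sum>w\<in>W. ?t w)" using W V t by (intro sum_mono2) auto
    also have "\<dots> \<le> g * (\<integral>\<omega>. infdist (\<pi> \<omega>) \<alpha> powr r \<partial>\<mu>)"
      using sum_words_integral_le[OF W disj continuous_on_infdist_powr[OF continuous_on_id r]] by simp
    finally show ?thesis .
  qed
  have integral_ge: "M \<le> (\<integral>\<omega>. infdist (\<Phi> w (\<pi> \<omega>)) \<alpha> powr r \<partial>\<mu>)"
    if w: "w \<in> words" and M: "\<And>x. x \<in> K \<Longrightarrow> M \<le> infdist (\<Phi> w x) \<alpha> powr r" for M w \<alpha>
  proof -
    have "(\<integral>\<omega>. M \<partial>\<mu>) \<le> (\<integral>\<omega>. infdist (\<Phi> w (\<pi> \<omega>)) \<alpha> powr r \<partial>\<mu>)"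
      by (intro integral_mono integrable_coding[OF continuous_on_infdist_powr[OF comp_word_continuous[OF w] r]])
        (auto simp: space_\<mu> intro: M coding_map_in)
    then show ?thesis by (simp add: prob_space)
  qed
  have "A * real n powr (- ?\<kappa>) \<le> (\<integral>\<omega>. infdist (\<pi> \<omega>) \<alpha> powr r \<partial>\<mu>)"
    if \<alpha>: "finite \<alpha>" "\<alpha> \<noteq> {}" "card \<alpha> \<le> n" for n \<alpha>
    using \<alpha>
  proof (induction n arbitrary: \<alpha> rule: less_induct)
    case (less n)
    note \<alpha> = \<open>finite \<alpha>\<close> \<open>\<alpha> \<noteq> {}\<close> \<open>card \<alpha> \<le> n\<close>
    let ?e = "\<integral>\<omega>. infdist (\<pi> \<omega>) \<alpha> powr r \<partial>\<mu>"
    have "n \<ge> 1" using \<alpha> card_gt_0_iff[of \<alpha>] by linarith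
    \<comment> \<open>The pieces lie within \<open>\<rho>\<close> of \<open>z i\<close>, so centers
      outside radius \<open>2 * \<rho>\<close> keep distance \<open>\<rho>\<close> from them, while
      the separation by \<open>4 * \<rho>\<close> makes these center sets disjoint.\<close>
    define a where "a i = {x \<in> \<alpha>. dist x (z i) \<le> 2 * \<rho>}" for i
    have far: "\<rho> \<le> dist (\<Phi> w x) y" if "i \<in> I" "w \<in> V i" "x \<in> K" "y \<in> \<alpha>" "y \<notin> a i" for i w x y
      using that(4,5) close[OF that(1-3)] dist_triangle[of y "z i" "\<Phi> w x"]
      by (auto simp: a_def dist_commute)
    show ?case
    proof (cases "\<exists>j\<in>I. a j = {}")
      case True
      then obtain j where j: "j \<in> I" "a j = {}" by blast
      have "P j * \<rho> powr r = (\<Sum>w\<in>V j. prob (word_cyl N w) * \<rho> powr r)"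
        by (simp add: P(2)[OF j(1)] sum_distrib_right)
      also have "\<dots> \<le> (\<Sum>w\<in>V j. prob (word_cyl N w) * (\<integral>\<omega>. infdist (\<Phi> w (\<pi> \<omega>)) \<alpha> powr r \<partial>\<mu>))"
      proof (intro sum_mono mult_left_mono integral_ge)
        fix w x assume w: "w \<in> V j" and x: "x \<in> K"
        have "\<rho> \<le> infdist (\<Phi> w x) \<alpha>"
          unfolding infdist_notempty[OF \<alpha>(2)]
          using far[OF j(1) w x] j(2) by (intro cINF_greatest \<alpha>(2)) auto
        then show "\<rho> powr r \<le> infdist (\<Phi> w x) \<alpha> powr r" using \<rho> r by (intro powr_mono2) auto
      qed (use V[OF j(1)] W(2) in auto)
      also have "\<dots> \<le> (\<Sum>i\<in>I. \<Sum>w\<in>V i. prob (word_cyl N w) * (\<integral>\<omega>. infdist (\<Phi> w (\<pi> \<omega>)) \<alpha> powr r \<partial>\<mu>))"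
        by (rule member_le_sum[OF j(1) _ I(1)])
          (auto intro!: sum_nonneg mult_nonneg_nonneg Bochner_Integration.integral_nonneg)
      also have "\<dots> \<le> g * ?e" by (rule split)
      finally have "P j * \<rho> powr r / g \<le> ?e" using g by (simp add: field_simps)
      then have "A \<le> ?e" using A(2)[OF j(1)] by simp
      moreover have "real n powr (- ?\<kappa>) \<le> 1 powr (- ?\<kappa>)"
        using q \<open>n \<ge> 1\<close> by (intro powr_mono2') auto
      then have "A * real n powr (- ?\<kappa>) \<le> A * 1" using A(1) by (intro mult_left_mono) auto
      ultimately show ?thesis by simp
    next
      case False
      then have a_ne: "a i \<noteq> {}" if "i \<in> I" for i using that by blast
      have a_fin: "finite (a i)" for i using \<alpha>(1) by (simp add: a_def)
      have card_pos: "card (a i) > 0" if "i \<in> I" for i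
        using a_ne[OF that] a_fin by (simp add: card_gt_0_iff)
      have a_disj: "a i \<inter> a j = {}" if "i \<in> I" "j \<in> I" "i \<noteq> j" for i j
      proof (rule ccontr)
        assume "a i \<inter> a j \<noteq> {}"
        then obtain x where "dist x (z i) \<le> 2 * \<rho>" "dist x (z j) \<le> 2 * \<rho>" by (auto simp: a_def)
        then have "dist (z i) (z j) \<le> 2 * \<rho> + 2 * \<rho>"
          using dist_triangle3[of "z i" "z j" x] by linarith
        then show False using sep[OF that] by simp
      qed
      have "(\<Sum>i\<in>I. card (a i)) = card (\<Union>i\<in>I. a i)"
        using I a_fin a_disj by (intro card_UN_disjoint[symmetric]) auto
      also have "\<dots> \<le> card \<alpha>" using \<alpha>(1) by (intro card_mono) (auto simp: a_def)
      finally have sum_card: "(\<Sum>i\<in>I. card (a i)) \<le> n" using \<alpha>(3) by simp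
      \<comment> \<open>This makes the induction descend: a second index exists and claims at least
        one center for itself.\<close>
      have card_less: "card (a i) < n" if i: "i \<in> I" for i
      proof -
        obtain j where j: "j \<in> I" "j \<noteq> i"
        proof -
          have "I \<noteq> {i}" using I(2) by auto
          then show thesis using that i by blast
        qed
        have "(\<Sum>k\<in>{i, j}. card (a k)) \<le> (\<Sum>k\<in>I. card (a k))"
          using I i j by (intro sum_mono2) auto
        then show ?thesis using sum_card card_pos[OF j(1)] j(2) by simp
      qed
      have piece: "(l / 6) powr r * (A * real (card (a i)) powr (- ?\<kappa>)) \<le>
          (\<integral>\<omega>. infdist (\<Phi> w (\<pi> \<omega>)) \<alpha> powr r \<partial>\<mu>)" if i: "i \<in> I" and w: "w \<in> V i" for i w
      proof -
        have ww: "w \<in> words" using V[OF i] W w by auto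
        obtain \<beta> where \<beta>: "finite \<beta>" "\<beta> \<noteq> {}" "card \<beta> \<le> card (a i)"
          "\<And>x y. x \<in> K \<Longrightarrow> y \<in> a i \<Longrightarrow> l / 2 * infdist x \<beta> \<le> dist (\<Phi> w x) y"
          using pull_back_centers[OF ww l(1) l(2)[OF i w] a_fin a_ne[OF i]] by blast
        have low: "l / 6 * infdist x \<beta> \<le> infdist (\<Phi> w x) \<alpha>" if x: "x \<in> K" for x
          unfolding infdist_notempty[OF \<alpha>(2)]
        proof (intro cINF_greatest \<alpha>(2))
          fix y assume y: "y \<in> \<alpha>"
          \<comment> \<open>A center outside \<open>a i\<close> is at distance at least
            \<open>\<rho>\<close>, and every center of \<open>a i\<close> at distance at most
            \<open>3 * \<rho>\<close>, so restricting to \<open>a i\<close> costs a factor 3.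
            Together with the 2 from \<open>pull_back_centers\<close> this gives
            \<open>l / 6\<close>.\<close>
          have "l / 2 * infdist x \<beta> \<le> 3 * dist (\<Phi> w x) y"
          proof (cases "y \<in> a i")
            case True
            have "l / 2 * infdist x \<beta> \<le> dist (\<Phi> w x) y" by (rule \<beta>(4)[OF x True])
            then show ?thesis using zero_le_dist[of "\<Phi> w x" y] by linarith
          next
            case False
            obtain y' where y': "y' \<in> a i" using a_ne[OF i] by blast
            have "l / 2 * infdist x \<beta> \<le> dist (\<Phi> w x) y'" by (rule \<beta>(4)[OF x y'])
            also have "\<dots> \<le> dist (\<Phi> w x) (z i) + dist y' (z i)" by (rule dist_triangle2)
            also have "\<dots> \<le> \<rho> + 2 * \<rho>" using close[OF i w x] y' by (intro add_mono) (auto simp: a_def)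
            finally show ?thesis using far[OF i w x y False] by simp
          qed
          then show "l / 6 * infdist x \<beta> \<le> dist (\<Phi> w x) y" by simp
        qed
        have scale: "(l / 6 * infdist x \<beta>) powr r = (l / 6) powr r * infdist x \<beta> powr r" for x
          by (rule powr_mult)
        have "(l / 6) powr r * (A * real (card (a i)) powr (- ?\<kappa>)) \<le>
            (l / 6) powr r * (\<integral>\<omega>. infdist (\<pi> \<omega>) \<beta> powr r \<partial>\<mu>)"
          by (intro mult_left_mono less.IH card_less i \<beta>) auto
        also have "\<dots> = (\<integral>\<omega>. (l / 6 * infdist (\<pi> \<omega>) \<beta>) powr r \<partial>\<mu>)"
          by (simp only: scale integral_mult_right_zero)
        also have "\<dots> \<le> (\<integral>\<omega>. infdist (\<Phi> w (\<pi> \<omega>)) \<alpha> powr r \<partial>\<mu>)"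
        proof (rule integral_mono)
          have "integrable \<mu> (\<lambda>\<omega>. (l / 6) powr r * infdist (\<pi> \<omega>) \<beta> powr r)"
            by (intro integrable_mult_right integrable_coding continuous_on_infdist_powr r continuous_on_id)
          then show "integrable \<mu> (\<lambda>\<omega>. (l / 6 * infdist (\<pi> \<omega>) \<beta>) powr r)"
            by (simp only: scale)
          show "integrable \<mu> (\<lambda>\<omega>. infdist (\<Phi> w (\<pi> \<omega>)) \<alpha> powr r)"
            by (rule integrable_coding[OF continuous_on_infdist_powr[OF comp_word_continuous[OF ww] r]])
          show "(l / 6 * infdist (\<pi> \<omega>) \<beta>) powr r \<le> infdist (\<Phi> w (\<pi> \<omega>)) \<alpha> powr r"
            if "\<omega> \<in> space \<mu>" for \<omega>
            using low[OF coding_map_in] that r l(1)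
            by (intro powr_mono2) (auto simp: space_\<mu> infdist_nonneg)
        qed
        finally show ?thesis .
      qed
      \<comment> \<open>The hypothesis \<open>gap\<close> is designed to absorb \<open>g\<close> and
        the contraction, so that the constant \<open>A\<close> survives unchanged.\<close>
      have "g * (A * real n powr (- ?\<kappa>)) \<le>
          ((l / 6) powr r * (\<Sum>i\<in>I. P i powr q) powr (1 / q)) * (A * real n powr (- ?\<kappa>))"
        using gap A(1) by (intro mult_right_mono) auto
      also have "\<dots> = (l / 6) powr r * A * ((\<Sum>i\<in>I. P i powr q) powr (1 / q) * real n powr (- ?\<kappa>))"
        by (simp add: mult_ac)
      also have "\<dots> \<le> (l / 6) powr r * A * (\<Sum>i\<in>I. P i * real (card (a i)) powr (- ?\<kappa>))"
        using I \<open>I \<noteq> {}\<close> q P(1) card_pos A(1) sum_card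
        by (intro mult_left_mono Hoelder_negative_exponent) (auto simp flip: of_nat_sum)
      also have "\<dots> = (\<Sum>i\<in>I. \<Sum>w\<in>V i. prob (word_cyl N w) *
          ((l / 6) powr r * (A * real (card (a i)) powr (- ?\<kappa>))))"
        unfolding sum_distrib_left by (intro sum.cong refl)
          (simp add: P(2) mult_ac flip: sum_distrib_left sum_distrib_right)
      also have "\<dots> \<le> (\<Sum>i\<in>I. \<Sum>w\<in>V i. prob (word_cyl N w) * (\<integral>\<omega>. infdist (\<Phi> w (\<pi> \<omega>)) \<alpha> powr r \<partial>\<mu>))"
        by (intro sum_mono mult_left_mono piece) auto
      also have "\<dots> \<le> g * ?e" by (rule split)
      finally show ?thesis using g by simp
    qed
  qed
  then show ?thesis using that A(1) by blast
qed

end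

section \<open>Dyadic cubes and the spectrum\<close>

text \<open>Ceiling minus one instead of the floor, because the cubes contain their upper and not
  their lower faces.\<close>

definition cube_index :: "nat \<Rightarrow> real^'d \<Rightarrow> int^'d" where
  "cube_index n x = (\<chi> i. \<lceil>2 ^ n * x $ i\<rceil> - 1)"

definition corner :: "nat \<Rightarrow> int^'d \<Rightarrow> real^'d" where
  "corner n k = (\<chi> i. of_int (k $ i) / 2 ^ n)"

lemma mem_dyadic_cube_iff: "x \<in> dyadic_cube n k \<longleftrightarrow> k = cube_index n x"
proof -
  have "(of_int (k $ i) / 2 ^ n < x $ i \<and> x $ i \<le> (of_int (k $ i) + 1) / 2 ^ n) \<longleftrightarrow>
      k $ i = \<lceil>2 ^ n * x $ i\<rceil> - 1" for i
  proof -
    have "(of_int (k $ i) / 2 ^ n < x $ i \<and> x $ i \<le> (of_int (k $ i) + 1) / 2 ^ n) \<longleftrightarrow>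
        of_int (k $ i) < 2 ^ n * x $ i \<and> 2 ^ n * x $ i \<le> of_int (k $ i) + 1"
      by (simp add: field_simps)
    also have "\<dots> \<longleftrightarrow> k $ i = \<lceil>2 ^ n * x $ i\<rceil> - 1"
      by (auto simp: eq_diff_eq intro!: ceiling_unique[symmetric]) linarith+
    finally show ?thesis .
  qed
  then show ?thesis by (auto simp: dyadic_cube_def cube_index_def vec_eq_iff)
qed

lemma inj_dyadic_cube: "inj (dyadic_cube n)"
proof (rule injI)
  fix k l :: "int^'d" assume eq: "dyadic_cube n k = dyadic_cube n l"
  have "(\<chi> i. (of_int (k $ i) + 1) / 2 ^ n) \<in> dyadic_cube n k"
    by (auto simp: dyadic_cube_def divide_strict_right_mono)
  then show "k = l" using eq mem_dyadic_cube_iff by metis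
qed

lemma dyadic_cube_borel [measurable]: "dyadic_cube n k \<in> sets borel"
proof -
  have "dyadic_cube n k = (\<Inter>i. {x. of_int (k $ i) / 2 ^ n < x $ i} \<inter> {x. x $ i \<le> (of_int (k $ i) + 1) / 2 ^ n})"
    by (auto simp: dyadic_cube_def)
  also have "\<dots> \<in> sets borel"
    by (intro sets.finite_INT sets.Int borel_open borel_closed open_halfspace_component_gt_cart
        closed_halfspace_component_le_cart) auto
  finally show ?thesis .
qed

lemma dist_corner:
  fixes x :: "real^'d"
  assumes "x \<in> dyadic_cube n k"
  shows "dist x (corner n k) \<le> CARD('d) / 2 ^ n"
proof -
  have "\<bar>(x - corner n k) $ i\<bar> \<le> 1 / 2 ^ n" for i
    using assms by (auto simp: dyadic_cube_def corner_def abs_le_iff add_divide_distrib algebra_simps less_imp_le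
        intro: order_trans[OF less_imp_le])
  then have "(\<Sum>i\<in>UNIV. \<bar>(x - corner n k) $ i\<bar>) \<le> (\<Sum>i\<in>(UNIV::'d set). 1 / 2 ^ n)"
    by (intro sum_mono)
  then show ?thesis using norm_le_l1_cart[of "x - corner n k"] by (simp add: dist_norm)
qed

lemma card_vec_le:
  assumes "finite A"
  shows "finite {v :: 'a^'d. \<forall>i. v $ i \<in> A}" "card {v :: 'a^'d. \<forall>i. v $ i \<in> A} \<le> card A ^ CARD('d)"
proof -
  let ?B = "{v :: 'a^'d. \<forall>i. v $ i \<in> A}" and ?P = "PiE (UNIV :: 'd set) (\<lambda>_. A)"
  have inj: "inj_on vec_nth ?B" by (auto simp: inj_on_def vec_nth_inject)
  have sub: "vec_nth ` ?B \<subseteq> ?P" by (auto simp: PiE_def)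
  have fin: "finite ?P" using assms by (intro finite_PiE) auto
  show "finite ?B" using inj sub fin by (rule inj_on_finite)
  show "card ?B \<le> card A ^ CARD('d)"
    using card_inj_on_le[OF inj sub fin] by (simp add: card_PiE)
qed

locale compact_prob_measure = prob_space \<nu> for \<nu> :: "(real^'d) measure" +
  fixes K :: "(real^'d) set"
  assumes sets_\<nu> [measurable_cong]: "sets \<nu> = sets borel" and compact: "compact K" and prob_K: "prob K = 1"
begin

lemma space_\<nu>: "space \<nu> = UNIV"
  using sets_eq_imp_space_eq[OF sets_\<nu>] by simp

lemma K_sets: "K \<in> sets \<nu>"
  unfolding sets_\<nu> using compact by (intro borel_closed compact_imp_closed)

lemma AE_in_K: "AE x in \<nu>. x \<in> K"
  using K_sets prob_K by (simp add: AE_in_set_eq_1)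

lemma K_ne: "K \<noteq> {}"
  using prob_K by auto

definition cube_prob :: "nat \<Rightarrow> int^'d \<Rightarrow> real" where
  "cube_prob n k = prob (dyadic_cube n k)"

text \<open>Cubes meeting \<open>K\<close>, not cubes of positive mass: their number is bounded in
  terms of \<open>K\<close> alone, and those left out have measure zero.\<close>

definition active_cubes :: "nat \<Rightarrow> (int^'d) set" where
  "active_cubes n = {k. dyadic_cube n k \<inter> K \<noteq> {}}"

lemma cube_index_active: "x \<in> K \<Longrightarrow> cube_index n x \<in> active_cubes n"
  using mem_dyadic_cube_iff[of x n] by (auto simp: active_cubes_def)

lemma card_active_cubes:
  obtains D where "D \<ge> 1" "\<And>n. finite (active_cubes n)" "\<And>n. real (card (active_cubes n)) \<le> D * 2 powr (real n * CARD('d))"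
proof -
  obtain R0 where R0: "\<And>x. x \<in> K \<Longrightarrow> norm x \<le> R0"
    using compact_imp_bounded[OF compact] unfolding bounded_iff by blast
  define R where "R = nat \<lceil>max R0 1\<rceil>"
  have R: "R \<ge> 1" "\<And>x. x \<in> K \<Longrightarrow> norm x \<le> real R"
  proof -
    show "R \<ge> 1" by (simp add: R_def le_nat_iff)
    show "norm x \<le> real R" if "x \<in> K" for x
      using R0[OF that] real_nat_ceiling_ge[of "max R0 1"] unfolding R_def by linarith
  qed
  \<comment> \<open>The extra \<open>- 1\<close> at the lower end comes from the index being a
    ceiling minus one.\<close>
  define A where "A n = {- int (R * 2 ^ n) - 1 .. int (R * 2 ^ n)}" for n
  have sub: "active_cubes n \<subseteq> {k. \<forall>i. k $ i \<in> A n}" for n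
  proof
    fix k assume "k \<in> active_cubes n"
    then obtain x where x: "x \<in> dyadic_cube n k" "x \<in> K" by (auto simp: active_cubes_def)
    show "k \<in> {k. \<forall>i. k $ i \<in> A n}"
    proof (intro CollectI allI)
      fix i
      have "\<bar>x $ i\<bar> \<le> R" using component_le_norm_cart[of x i] R(2)[OF x(2)] by linarith
      then have "\<bar>2 ^ n * x $ i\<bar> \<le> 2 ^ n * real R" by (simp add: abs_mult)
      moreover have "of_int (k $ i) < 2 ^ n * x $ i" "2 ^ n * x $ i \<le> of_int (k $ i) + 1"
        using x(1) by (auto simp: dyadic_cube_def field_simps)
      ultimately have "of_int (k $ i) < real (R * 2 ^ n)" "- real (R * 2 ^ n) \<le> of_int (k $ i) + 1"
        unfolding of_nat_mult of_nat_power of_nat_numeral by (simp_all only: mult.commute abs_le_iff) linarith+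
      then have "real_of_int (k $ i) < real_of_int (int (R * 2 ^ n))"
        "real_of_int (- int (R * 2 ^ n)) \<le> real_of_int (k $ i + 1)"
        by (simp_all only: of_int_of_nat_eq of_int_minus of_int_add of_int_1)
      then show "k $ i \<in> A n" unfolding A_def of_int_less_iff of_int_le_iff by simp
    qed
  qed
  have fin: "finite (active_cubes n)" for n
    by (rule finite_subset[OF sub card_vec_le(1)]) (simp add: A_def)
  have "real (card (active_cubes n)) \<le> (real R * 4) ^ CARD('d) * 2 powr (real n * CARD('d))" for n
  proof -
    have "card (active_cubes n) \<le> card {k :: int^'d. \<forall>i. k $ i \<in> A n}"
      by (intro card_mono sub card_vec_le) (simp add: A_def)
    also have "\<dots> \<le> card (A n) ^ CARD('d)" by (intro card_vec_le) (simp add: A_def)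
    also have "card (A n) = nat (int (R * 2 ^ n) - (- int (R * 2 ^ n) - 1) + 1)"
      by (simp only: A_def card_atLeastAtMost_int)
    also have "\<dots> = 2 * (R * 2 ^ n) + 2" by linarith
    also have "2 * (R * 2 ^ n) + 2 \<le> R * 4 * 2 ^ n"
    proof -
      have "1 \<le> R * 2 ^ n" using R(1) by simp
      then show ?thesis by linarith
    qed
    finally have "card (active_cubes n) \<le> (R * 4 * 2 ^ n) ^ CARD('d)" by (simp add: power_mono)
    then have "real (card (active_cubes n)) \<le> real ((R * 4 * 2 ^ n) ^ CARD('d))" by (rule of_nat_mono)
    moreover have "2 powr (real n * CARD('d)) = (2::real) ^ (n * CARD('d))"
      by (simp flip: powr_realpow)
    ultimately show ?thesis by (simp add: power_mult_distrib flip: power_mult)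
  qed
  moreover have "(real R * 4) ^ CARD('d) \<ge> 1" using R(1) by (intro one_le_power) simp
  ultimately show ?thesis using that fin by blast
qed

lemma finite_active_cubes: "finite (active_cubes n)"
  by (rule card_active_cubes) auto

lemma cube_prob_nonneg: "0 \<le> cube_prob n k" and cube_prob_le_1: "cube_prob n k \<le> 1"
  by (auto simp: cube_prob_def)

lemma cube_prob_inactive: "k \<notin> active_cubes n \<Longrightarrow> cube_prob n k = 0"
proof -
  assume "k \<notin> active_cubes n"
  then have "prob (dyadic_cube n k) \<le> prob (space \<nu> - K)"
    using K_sets by (intro finite_measure_mono) (auto simp: active_cubes_def space_\<nu> sets_\<nu>)
  also have "\<dots> = 0" using K_sets prob_K by (simp add: prob_compl)
  finally show ?thesis by (simp add: cube_prob_def measure_le_0_iff)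
qed

lemma sum_cube_prob: "(\<Sum>k\<in>active_cubes n. cube_prob n k) = 1"
proof -
  have "(\<Sum>k\<in>active_cubes n. cube_prob n k) = prob (\<Union>k\<in>active_cubes n. dyadic_cube n k)"
    unfolding cube_prob_def
    by (intro finite_measure_finite_Union[symmetric] finite_active_cubes)
      (auto simp: sets_\<nu> disjoint_family_on_def mem_dyadic_cube_iff)
  moreover have "K \<subseteq> (\<Union>k\<in>active_cubes n. dyadic_cube n k)"
    using cube_index_active mem_dyadic_cube_iff by blast
  then have "prob K \<le> prob (\<Union>k\<in>active_cubes n. dyadic_cube n k)"
    by (intro finite_measure_mono sets.finite_UN finite_active_cubes) (auto simp: sets_\<nu>)
  ultimately show ?thesis using prob_K prob_le_1 by (simp add: antisym)
qed

section \<open>Power sums over the active cubes and their growth rates\<close>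

definition power_sum :: "nat \<Rightarrow> real \<Rightarrow> real" where
  "power_sum n q = (\<Sum>k\<in>active_cubes n. cube_prob n k powr q)"

lemma power_sum_pos: "power_sum n q > 0"
proof (rule ccontr)
  assume "\<not> power_sum n q > 0"
  then have "power_sum n q = 0" by (simp add: power_sum_def antisym sum_nonneg not_less)
  then have "\<forall>k\<in>active_cubes n. cube_prob n k powr q = 0" unfolding power_sum_def by (subst (asm) sum_nonneg_eq_0_iff) (auto simp: finite_active_cubes)
  then have "(\<Sum>k\<in>active_cubes n. cube_prob n k) = 0" by (intro sum.neutral) simp
  then show False using sum_cube_prob by simp
qed

lemma power_sum_antimono: "q \<le> q' \<Longrightarrow> power_sum n q' \<le> power_sum n q"
  unfolding power_sum_def by (intro sum_mono powr_mono' cube_prob_nonneg cube_prob_le_1)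

lemma Lq_spectrum_eq: "Lq_spectrum \<nu> q = limsup (\<lambda>n. ereal (ln (power_sum n q) / ln (2 ^ n)))"
proof -
  have "(\<Sum>\<^sub>\<infinity>C\<in>dyadic_cubes n. measure \<nu> C powr q) = power_sum n q" for n
  proof -
    have "(\<Sum>\<^sub>\<infinity>C\<in>dyadic_cubes n. measure \<nu> C powr q) = (\<Sum>\<^sub>\<infinity>k. cube_prob n k powr q)"
      unfolding dyadic_cubes_def cube_prob_def by (subst infsum_reindex[OF inj_dyadic_cube]) (simp add: o_def)
    also have "\<dots> = (\<Sum>\<^sub>\<infinity>k\<in>active_cubes n. cube_prob n k powr q)"
      by (rule infsum_cong_neutral) (auto simp: cube_prob_inactive)
    finally show ?thesis by (simp add: power_sum_def infsum_finite[OF finite_active_cubes])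
  qed
  then show ?thesis unfolding Lq_spectrum_def by simp
qed

lemma ln_ratio_less_iff: "n \<ge> 1 \<Longrightarrow> ln (power_sum n q) / ln (2 ^ n) < t \<longleftrightarrow> power_sum n q < 2 powr (real n * t)"
  using ln_less_cancel_iff[of "power_sum n q" "2 powr (real n * t)"] power_sum_pos[of n q]
  by (simp add: ln_realpow ln_powr field_simps)

lemma Lq_spectrum_lessE:
  assumes "Lq_spectrum \<nu> q < ereal u"
  obtains t where "t < u" "\<forall>\<^sub>F n in sequentially. power_sum n q \<le> 2 powr (real n * t)"
proof -
  obtain t where t: "Lq_spectrum \<nu> q < ereal t" "ereal t < ereal u"
    using ereal_dense2[OF assms] by blast
  then have "\<forall>\<^sub>F n in sequentially. ereal (ln (power_sum n q) / ln (2 ^ n)) < ereal t"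
    unfolding Lq_spectrum_eq by (intro Limsup_lessD)
  then have "\<forall>\<^sub>F n in sequentially. power_sum n q \<le> 2 powr (real n * t)"
    using eventually_ge_at_top[of 1]
    by eventually_elim (use ln_ratio_less_iff in \<open>fastforce intro: less_imp_le\<close>)
  then show ?thesis using that t by simp
qed

text \<open>A limsup yields infinitely many levels and no more, which is why the lower bound has to
  be built from a single one.\<close>

lemma Lq_spectrum_gt:
  assumes "ereal t < Lq_spectrum \<nu> q"
  shows "\<exists>\<^sub>F n in sequentially. 2 powr (real n * t) \<le> power_sum n q"
proof (rule ccontr)
  assume "\<not> ?thesis"
  then have "\<forall>\<^sub>F n in sequentially. power_sum n q < 2 powr (real n * t)"
    by (simp add: not_frequently not_le)
  then have "\<forall>\<^sub>F n in sequentially. ereal (ln (power_sum n q) / ln (2 ^ n)) \<le> ereal t"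
    using eventually_ge_at_top[of 1]
    by eventually_elim (use ln_ratio_less_iff in \<open>fastforce intro: less_imp_le\<close>)
  then have "Lq_spectrum \<nu> q \<le> ereal t" unfolding Lq_spectrum_eq by (rule Limsup_bounded)
  then show False using assms by simp
qed

text \<open>The elementary estimate \<open>x powr q \<le> t powr q + x * t powr (q - 1)\<close> with \<open>t = 2 ^ (- n d)\<close>
  replaces Jensen's inequality here.\<close>

lemma Lq_spectrum_less:
  assumes q: "0 < q" "q < 1" and u: "real CARD('d) * (1 - q) < u"
  shows "Lq_spectrum \<nu> q < ereal u"
proof -
  let ?d = "real CARD('d)"
  obtain D where D: "D \<ge> 1" "\<And>n. real (card (active_cubes n)) \<le> D * 2 powr (real n * ?d)"
    by (rule card_active_cubes) blast
  have s_le: "power_sum n q \<le> (D + 1) * 2 powr (real n * (?d * (1 - q)))" for n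
  proof -
    \<comment> \<open>Up to a constant, the mass per cube if it were spread evenly; this balances
      the two terms of the estimate.\<close>
    define t :: real where "t = 2 powr (- (real n * ?d))"
    have t: "t > 0" by (simp add: t_def)
    have "x powr q \<le> t powr q + x * t powr (q - 1)" if "x \<ge> 0" for x
    proof (cases "x \<le> t")
      case True
      have "x powr q \<le> t powr q" using True that q by (intro powr_mono2) auto
      then show ?thesis using that by (simp add: add_increasing2)
    next
      case False
      have "x powr q = x * x powr (q - 1)" using False t by (simp add: powr_diff)
      also have "\<dots> \<le> x * t powr (q - 1)"
        using False that t q by (intro mult_left_mono powr_mono2') auto
      finally show ?thesis by (simp add: add_increasing)
    qed
    then have "power_sum n q \<le> (\<Sum>k\<in>active_cubes n. t powr q + cube_prob n k * t powr (q - 1))"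
      unfolding power_sum_def by (intro sum_mono) (auto intro: cube_prob_nonneg)
    also have "\<dots> = card (active_cubes n) * t powr q + t powr (q - 1)"
      using sum_cube_prob[of n] by (simp add: sum.distrib flip: sum_distrib_right)
    also have "\<dots> \<le> D * 2 powr (real n * ?d) * t powr q + t powr (q - 1)"
      by (intro add_right_mono mult_right_mono D) simp
    also have "\<dots> = (D + 1) * 2 powr (real n * (?d * (1 - q)))"
      by (simp add: t_def powr_powr algebra_simps flip: powr_add)
    finally show ?thesis .
  qed
  obtain t where t: "?d * (1 - q) < t" "t < u" using dense[OF u] by blast
  \<comment> \<open>The gap between the two rates yields a geometric factor that eventually exceeds
    \<open>D + 1\<close>.\<close>
  define a where "a = 2 powr (t - ?d * (1 - q))"
  have "a > 1" using t by (simp add: a_def)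
  then obtain n0 where n0: "D + 1 < a ^ n0" using real_arch_pow by blast
  have "ereal (ln (power_sum n q) / ln (2 ^ n)) \<le> ereal t" if n: "n \<ge> max 1 n0" for n
  proof -
    have "power_sum n q \<le> (D + 1) * 2 powr (real n * (?d * (1 - q)))" by (rule s_le)
    also have "\<dots> < a ^ n * 2 powr (real n * (?d * (1 - q)))"
      using less_le_trans[OF n0 power_increasing[of n0 n a]] n \<open>a > 1\<close>
      by (intro mult_strict_right_mono) auto
    also have "\<dots> = 2 powr (real n * t)"
      by (simp add: a_def algebra_simps powr_power flip: powr_add)
    finally show ?thesis using ln_ratio_less_iff[of n q t] n by simp
  qed
  then have "\<forall>\<^sub>F n in sequentially. ereal (ln (power_sum n q) / ln (2 ^ n)) \<le> ereal t"
    unfolding eventually_sequentially by blast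
  then have "Lq_spectrum \<nu> q \<le> ereal t" unfolding Lq_spectrum_eq by (rule Limsup_bounded)
  then show ?thesis using t(2) by (simp add: le_less_trans)
qed

end

section \<open>The upper bound\<close>

context compact_prob_measure
begin

text \<open>The centers are the corners of the cubes with \<open>cube_prob n k * 2 powr (- r * n) \<ge> \<tau>\<close>. A point is within
  \<open>d * 2 ^ (1 - n)\<close> of a center, where \<open>n\<close> is the first level at which its cube is not among these.\<close>

lemma quantization_upper_bound_threshold:
  assumes r: "r > 0" and q: "0 < q" "q < 1" and \<tau>: "\<tau> > 0"
    and M: "\<And>m. (\<Sum>n<m. 2 powr (- (real n * r * q)) * power_sum n q) \<le> M"
  obtains \<alpha> where "finite \<alpha>" "\<alpha> \<noteq> {}" "real (card \<alpha>) \<le> M * \<tau> powr (- q) + 1"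
    "(\<integral>x. infdist x \<alpha> powr r \<partial>\<nu>) \<le> ((2 * real CARD('d)) powr r + diameter K powr r) * M * \<tau> powr (1 - q)"
proof -
  let ?d = "real CARD('d)"
  define c1 where "c1 = (2 * ?d) powr r + diameter K powr r"
  define J where "J n k = cube_prob n k * 2 powr (- (real n * r))" for n k
  have J: "0 \<le> J n k" "J n k powr q = 2 powr (- (real n * r * q)) * cube_prob n k powr q" for n k
    using cube_prob_nonneg by (auto simp: J_def powr_mult powr_powr)
  have "(\<lambda>n. (2 powr (- r)) ^ n) \<longlonglongrightarrow> 0"
    using r by (intro LIMSEQ_realpow_zero) (auto simp: powr_minus_divide)
  from order_tendstoD(2)[OF this \<tau>] obtain m where m: "\<And>n. n \<ge> m \<Longrightarrow> (2 powr (- r)) ^ n < \<tau>"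
    unfolding eventually_sequentially by blast
  \<comment> \<open>From level \<open>m\<close> on no cube passes the threshold, whatever its mass,
    so the selection \<open>E\<close> is finite.\<close>
  have J_less: "J n k < \<tau>" if "n \<ge> m" for n k
  proof -
    have "J n k \<le> 1 * 2 powr (- (real n * r))" unfolding J_def by (intro mult_right_mono cube_prob_le_1) simp
    also have "\<dots> < \<tau>" using m[OF that] by (simp add: powr_power mult.commute)
    finally show ?thesis .
  qed
  have sum_J: "(\<Sum>n<l. \<Sum>k\<in>active_cubes n. J n k powr q) \<le> M" for l
    using M[of l] by (simp add: J(2) power_sum_def sum_distrib_left)
  define E where "E = (SIGMA n:{..<m}. {k \<in> active_cubes n. \<tau> \<le> J n k})"
  have "finite E" unfolding E_def using finite_active_cubes by auto
  obtain x0 where x0: "x0 \<in> K" using K_ne by blast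
  define \<alpha> where "\<alpha> = insert x0 ((\<lambda>(n, k). corner n k) ` E)"
  have \<alpha>: "finite \<alpha>" "\<alpha> \<noteq> {}" using \<open>finite E\<close> by (auto simp: \<alpha>_def)
  have "card \<alpha> \<le> card E + 1"
    unfolding \<alpha>_def using card_image_le[OF \<open>finite E\<close>, of "\<lambda>(n, k). corner n k"] \<open>finite E\<close>
    by (simp add: card_insert_if)
  \<comment> \<open>Chebyshev's inequality: each selected cube contributes at least
    \<open>\<tau> powr q\<close> to a sum bounded by \<open>M\<close>.\<close>
  moreover have "real (card E) * \<tau> powr q \<le> M"
  proof -
    have "real (card E) * \<tau> powr q = (\<Sum>n<m. \<Sum>k\<in>{k \<in> active_cubes n. \<tau> \<le> J n k}. \<tau> powr q)"
      unfolding E_def using finite_active_cubes by (simp add: sum_distrib_right)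
    also have "\<dots> \<le> (\<Sum>n<m. \<Sum>k\<in>{k \<in> active_cubes n. \<tau> \<le> J n k}. J n k powr q)"
      using \<tau> q by (intro sum_mono powr_mono2) auto
    also have "\<dots> \<le> (\<Sum>n<m. \<Sum>k\<in>active_cubes n. J n k powr q)"
      by (intro sum_mono sum_mono2 finite_active_cubes) auto
    also have "\<dots> \<le> M" by (rule sum_J)
    finally show ?thesis .
  qed
  then have "real (card E) \<le> M * \<tau> powr (- q)" using \<tau> by (simp add: powr_minus field_simps)
  ultimately have card_\<alpha>: "real (card \<alpha>) \<le> M * \<tau> powr (- q) + 1" by linarith
  \<comment> \<open>A majorant that charges a point for every level at which its cube is light; one
    of these is the first, which determines the distance. That first level can be \<open>m\<close>
    itself, hence \<open>Suc m\<close>.\<close>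
  define H where "H x = (\<Sum>n<Suc m. \<Sum>k\<in>active_cubes n.
    (if J n k < \<tau> then 2 powr (- (real n * r)) else 0) * indicator (dyadic_cube n k) x)" for x :: "real^'d"
  have pointwise: "infdist x \<alpha> powr r \<le> c1 * H x" if x: "x \<in> K" for x
  proof -
    let ?k = "\<lambda>n. cube_index n x"
    define n where "n = (LEAST n. J n (?k n) < \<tau>)"
    have n: "J n (?k n) < \<tau>" unfolding n_def by (rule LeastI[of _ m]) (rule J_less, simp)
    have "n \<le> m" unfolding n_def by (rule Least_le) (rule J_less, simp)
    \<comment> \<open>At level 0 there is no coarser cube to supply a corner, so \<open>x0\<close>
      serves and \<open>diameter K\<close> enters \<open>c1\<close>. Otherwise the corner comes from
      the parent level, whose side length is twice as large; hence the 2 in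
      \<open>c1\<close>.\<close>
    have dist_le: "infdist x \<alpha> powr r \<le> c1 * 2 powr (- (real n * r))"
    proof (cases n)
      case 0
      have "infdist x \<alpha> \<le> dist x x0" by (rule infdist_le) (simp add: \<alpha>_def)
      also have "\<dots> \<le> diameter K"
        by (rule diameter_bounded_bound[OF compact_imp_bounded[OF compact] x x0])
      finally have "infdist x \<alpha> powr r \<le> diameter K powr r"
        using r by (intro powr_mono2) (auto simp: infdist_nonneg)
      then show ?thesis using 0 by (simp add: c1_def add_increasing)
    next
      case (Suc j)
      have power_n: "2 powr (- real n) = 1 / (2 ^ n :: real)"
        by (simp add: powr_minus_divide powr_realpow)
      have "\<not> J j (?k j) < \<tau>" using Suc unfolding n_def by (intro not_less_Least) simp
      then have "(j, ?k j) \<in> E" using \<open>n \<le> m\<close> Suc cube_index_active[OF x] by (auto simp: E_def)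
      then have "corner j (?k j) \<in> \<alpha>" by (force simp: \<alpha>_def)
      then have "infdist x \<alpha> \<le> dist x (corner j (?k j))" by (rule infdist_le)
      also have "\<dots> \<le> ?d / 2 ^ j" by (rule dist_corner) (simp add: mem_dyadic_cube_iff)
      also have "\<dots> = 2 * ?d * 2 powr (- real n)"
        using power_n by (simp add: Suc)
      finally have "infdist x \<alpha> powr r \<le> (2 * ?d * 2 powr (- real n)) powr r"
        using r by (intro powr_mono2) (auto simp: infdist_nonneg)
      also have "\<dots> = (2 * ?d) powr r * 2 powr (- (real n * r))"
        by (simp only: powr_mult powr_powr) simp
      also have "\<dots> \<le> c1 * 2 powr (- (real n * r))"
        unfolding c1_def by (intro mult_right_mono) auto
      finally show ?thesis .
    qed
    have "2 powr (- (real n * r)) = (if J n (?k n) < \<tau> then 2 powr (- (real n * r)) else 0) *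
        indicator (dyadic_cube n (?k n)) x"
      using n by (simp add: mem_dyadic_cube_iff)
    also have "\<dots> \<le> (\<Sum>k\<in>active_cubes n. (if J n k < \<tau> then 2 powr (- (real n * r)) else 0) *
        indicator (dyadic_cube n k) x)"
      by (rule member_le_sum[OF cube_index_active[OF x] _ finite_active_cubes]) (auto simp: indicator_def)
    also have "\<dots> \<le> H x"
      unfolding H_def using \<open>n \<le> m\<close>
      by (intro member_le_sum[of n "{..<Suc m}" "\<lambda>n. \<Sum>k\<in>active_cubes n. (if J n k < \<tau> then 2 powr (- (real n * r)) else 0) *
        indicator (dyadic_cube n k) x"]) (auto intro!: sum_nonneg)
    finally have "c1 * 2 powr (- (real n * r)) \<le> c1 * H x" by (intro mult_left_mono) (auto simp: c1_def)
    with dist_le show ?thesis by simp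
  qed
  have int_cube: "integrable \<nu> (\<lambda>x. a * indicator (dyadic_cube n k) x)" for a :: real and n and k :: "int^'d"
    by (intro integrable_mult_right integrable_real_indicator)
      (auto simp: sets_\<nu> emeasure_eq_measure)
  have H_int: "integrable \<nu> H"
    unfolding H_def by (intro Bochner_Integration.integrable_sum int_cube)
  have int_indicator: "(\<integral>x. indicator (dyadic_cube n k) x \<partial>\<nu>) = cube_prob n k" for n k
    by (simp add: cube_prob_def space_\<nu>)
  let ?c = "\<lambda>n k. if J n k < \<tau> then 2 powr (- (real n * r)) else 0"
  have "(\<integral>x. H x \<partial>\<nu>) = (\<Sum>n<Suc m. \<integral>x. (\<Sum>k\<in>active_cubes n. ?c n k * indicator (dyadic_cube n k) x) \<partial>\<nu>)"
    unfolding H_def by (rule Bochner_Integration.integral_sum)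
      (intro Bochner_Integration.integrable_sum int_cube)
  also have "\<dots> = (\<Sum>n<Suc m. \<Sum>k\<in>active_cubes n. \<integral>x. ?c n k * indicator (dyadic_cube n k) x \<partial>\<nu>)"
    by (intro sum.cong refl Bochner_Integration.integral_sum int_cube)
  also have "\<dots> = (\<Sum>n<Suc m. \<Sum>k\<in>active_cubes n. ?c n k * cube_prob n k)"
    by (simp only: integral_mult_right_zero int_indicator)
  also have "\<dots> \<le> (\<Sum>n<Suc m. \<Sum>k\<in>active_cubes n. \<tau> powr (1 - q) * J n k powr q)"
  proof (intro sum_mono)
    fix n k
    show "(if J n k < \<tau> then 2 powr (- (real n * r)) else 0) * cube_prob n k \<le> \<tau> powr (1 - q) * J n k powr q"
    proof (cases "J n k < \<tau>")
      case True
      \<comment> \<open>For light cubes all but a power \<open>q\<close> of \<open>J\<close> is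
        traded for \<open>\<tau>\<close>; the remainder is summable over all levels.\<close>
      have "J n k = J n k powr (1 - q) * J n k powr q"
        using J(1)[of n k] by (simp flip: powr_add)
      also have "\<dots> \<le> \<tau> powr (1 - q) * J n k powr q"
        using True J(1)[of n k] q by (intro mult_right_mono powr_mono2) auto
      finally show ?thesis using True by (simp add: J_def mult.commute)
    qed simp
  qed
  also have "\<dots> = \<tau> powr (1 - q) * (\<Sum>n<Suc m. \<Sum>k\<in>active_cubes n. J n k powr q)"
    by (simp only: sum_distrib_left)
  also have "\<dots> \<le> \<tau> powr (1 - q) * M" by (intro mult_left_mono sum_J) simp
  finally have "(\<integral>x. H x \<partial>\<nu>) \<le> \<tau> powr (1 - q) * M" .
  then have "c1 * (\<integral>x. H x \<partial>\<nu>) \<le> c1 * (\<tau> powr (1 - q) * M)"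
    by (intro mult_left_mono) (auto simp: c1_def)
  moreover have "(\<integral>x. infdist x \<alpha> powr r \<partial>\<nu>) \<le> (\<integral>x. c1 * H x \<partial>\<nu>)"
  proof (rule integral_mono_AE')
    show "AE x in \<nu>. infdist x \<alpha> powr r \<le> c1 * H x"
      using AE_in_K by eventually_elim (rule pointwise)
    show "AE x in \<nu>. 0 \<le> c1 * H x"
      unfolding H_def c1_def by (intro AE_I2 mult_nonneg_nonneg sum_nonneg) auto
  qed (intro integrable_mult_right H_int)
  ultimately have "(\<integral>x. infdist x \<alpha> powr r \<partial>\<nu>) \<le> c1 * M * \<tau> powr (1 - q)" by (simp add: mult_ac)
  then show ?thesis using that \<alpha> card_\<alpha> unfolding c1_def by blast
qed

text \<open>The strict inequality for the spectrum bounds the weighted power sums by a geometric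
  series, which makes the constant \<open>M\<close> finite; the threshold is then fitted to
  \<open>n\<close>.\<close>

lemma quantization_upper_bound:
  assumes r: "r > 0" and q: "0 < q" "q < 1" and Lq: "Lq_spectrum \<nu> q < ereal (r * q)"
  obtains C where "C > 0" "\<And>n. n \<ge> 2 \<Longrightarrow> \<exists>\<alpha>. finite \<alpha> \<and> \<alpha> \<noteq> {} \<and> card \<alpha> \<le> n \<and>
    (\<integral>x. infdist x \<alpha> powr r \<partial>\<nu>) \<le> C * real n powr (- ((1 - q) / q))"
proof -
  let ?\<kappa> = "(1 - q) / q"
  obtain t where t: "t < r * q" "\<forall>\<^sub>F n in sequentially. power_sum n q \<le> 2 powr (real n * t)"
    by (rule Lq_spectrum_lessE[OF Lq])
  let ?f = "\<lambda>n. 2 powr (- (real n * r * q)) * power_sum n q"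
  have f_nonneg: "?f n \<ge> 0" for n using power_sum_pos[of n q] by simp
  have "summable ?f"
  proof (rule summable_comparison_test_ev)
    show "\<forall>\<^sub>F n in sequentially. norm (?f n) \<le> (2 powr (t - r * q)) ^ n"
      using t(2)
    proof eventually_elim
      case (elim n)
      have "norm (?f n) \<le> 2 powr (- (real n * r * q)) * 2 powr (real n * t)"
        using elim f_nonneg[of n] by (simp add: mult_left_mono)
      also have "\<dots> = (2 powr (t - r * q)) ^ n"
        by (simp add: powr_power algebra_simps flip: powr_add)
      finally show ?case .
    qed
    show "summable (\<lambda>n. (2 powr (t - r * q)) ^ n)"
      using t(1) by (intro summable_geometric) (simp add: powr_less_one)
  qed
  define M where "M = suminf ?f"
  have M: "(\<Sum>n<m. ?f n) \<le> M" for m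
    unfolding M_def using \<open>summable ?f\<close> f_nonneg by (intro sum_le_suminf) auto
  have "M > 0"
    unfolding M_def using \<open>summable ?f\<close> power_sum_pos by (intro suminf_pos) auto
  define c1 where "c1 = (2 * real CARD('d)) powr r + diameter K powr r"
  have "c1 > 0" unfolding c1_def by (intro add_pos_nonneg) auto
  define C where "C = c1 * M * (2 * M) powr ?\<kappa>"
  have "C > 0" using \<open>c1 > 0\<close> \<open>M > 0\<close> by (simp add: C_def)
  moreover have "\<exists>\<alpha>. finite \<alpha> \<and> \<alpha> \<noteq> {} \<and> card \<alpha> \<le> n \<and>
      (\<integral>x. infdist x \<alpha> powr r \<partial>\<nu>) \<le> C * real n powr (- ?\<kappa>)" if n: "n \<ge> 2" for n
  proof -
    \<comment> \<open>Solves \<open>M * \<tau> powr (- q) = n - 1\<close>, leaving one center for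
      the point \<open>x0\<close>. The 2 in \<open>C\<close> comes from
      \<open>n \<le> 2 * (n - 1)\<close>.\<close>
    define \<tau> where "\<tau> = (M / (real n - 1)) powr (1 / q)"
    have n1: "real n - 1 > 0" using n by simp
    have "\<tau> > 0" using \<open>M > 0\<close> n1 by (simp add: \<tau>_def)
    obtain \<alpha> where \<alpha>: "finite \<alpha>" "\<alpha> \<noteq> {}" "real (card \<alpha>) \<le> M * \<tau> powr (- q) + 1"
      "(\<integral>x. infdist x \<alpha> powr r \<partial>\<nu>) \<le> c1 * M * \<tau> powr (1 - q)"
      using quantization_upper_bound_threshold[OF r q \<open>\<tau> > 0\<close> M] unfolding c1_def by blast
    have "\<tau> powr (- q) = (real n - 1) / M"
      using q \<open>M > 0\<close> n1 by (simp add: \<tau>_def powr_powr powr_minus)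
    then have card_le: "real (card \<alpha>) \<le> real n" using \<alpha>(3) \<open>M > 0\<close> by simp
    have "\<tau> powr (1 - q) = (M / (real n - 1)) powr ?\<kappa>"
      by (simp add: \<tau>_def powr_powr)
    then have "\<tau> powr (1 - q) \<le> (2 * M / real n) powr ?\<kappa>"
      using q n \<open>M > 0\<close> by (auto intro!: powr_mono2 simp: field_simps)
    then have "c1 * M * \<tau> powr (1 - q) \<le> c1 * M * (2 * M / real n) powr ?\<kappa>"
      using \<open>c1 > 0\<close> \<open>M > 0\<close> by (intro mult_left_mono) auto
    moreover have "(2 * M / real n) powr ?\<kappa> = (2 * M) powr ?\<kappa> * real n powr (- ?\<kappa>)"
      by (simp only: powr_divide powr_minus) (simp only: divide_inverse)
    ultimately have "c1 * M * \<tau> powr (1 - q) \<le> C * real n powr (- ?\<kappa>)"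
      by (simp only: C_def mult.assoc)
    then show ?thesis using \<alpha> card_le by (intro exI[of _ \<alpha>]) auto
  qed
  ultimately show ?thesis by (rule that)
qed

end

section \<open>The quantization dimension\<close>

lemma eventually_powr_gt:
  fixes a X :: real
  assumes "a > 0"
  shows "\<forall>\<^sub>F n in sequentially. X < 2 powr (real n * a)"
proof -
  have a: "1 < 2 powr a" using assms by simp
  then obtain n0 where n0: "X < (2 powr a) ^ n0" using real_arch_pow by blast
  have "X < 2 powr (real n * a)" if "n \<ge> n0" for n
    using less_le_trans[OF n0 power_increasing[OF that less_imp_le[OF a]]]
    by (simp add: powr_power mult.commute)
  then show ?thesis unfolding eventually_sequentially by blast
qed

text \<open>The alternative of a negative sum stands in for a sign condition on \<open>f\<close>;
  where this is applied, positivity of the sum excludes it.\<close>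

lemma pigeonhole_sum:
  fixes f :: "'a \<Rightarrow> real"
  assumes A: "finite A" "A \<noteq> {}" and m: "real (card (h ` A)) \<le> m"
  obtains y where "sum f A \<le> m * (\<Sum>x\<in>{x \<in> A. h x = y}. f x)" | "sum f A < 0"
proof (cases "sum f A < 0")
  case False
  have "\<exists>y\<in>h ` A. sum f A / m \<le> (\<Sum>x\<in>{x \<in> A. h x = y}. f x)"
  proof (rule ccontr)
    assume "\<not> ?thesis"
    then have "(\<Sum>y\<in>h ` A. \<Sum>x\<in>{x \<in> A. h x = y}. f x) < (\<Sum>y\<in>h ` A. sum f A / m)"
      using A by (intro sum_strict_mono) auto
    also have "\<dots> = real (card (h ` A)) / m * sum f A" by simp
    also have "\<dots> \<le> 1 * sum f A"
      using m False by (intro mult_right_mono) (auto simp: divide_le_eq_1)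
    finally show False using sum.image_gen[OF A(1), of f h] by simp
  qed
  then obtain y where y: "sum f A / m \<le> (\<Sum>x\<in>{x \<in> A. h x = y}. f x)" by blast
  have "m > 0" using m A card_gt_0_iff[of "h ` A"] by (auto simp: order_less_le_trans)
  then show ?thesis using y that(1)[of y] by (simp add: field_simps)
qed (rule that(2))

lemma abs_diff_ge_of_mod_eq:
  fixes a b m :: int
  assumes "a mod m = b mod m" "a \<noteq> b"
  shows "m \<le> \<bar>a - b\<bar>"
proof -
  have "m dvd a - b" using assms(1) by (simp add: mod_eq_dvd_iff)
  then show ?thesis using assms(2) by (intro zdvd_imp_le) auto
qed

context gibbs_ifs
begin

lemma prob_distr_coding: "A \<in> sets borel \<Longrightarrow>
    measure (distr \<mu> borel \<pi>) A = prob {\<omega> \<in> \<Sigma>. \<pi> \<omega> \<in> A}"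
  using measure_distr[OF measurable_coding, of A]
  by (simp add: space_\<mu> vimage_def Int_def conj_commute)

sublocale image: compact_prob_measure "distr \<mu> borel \<pi>" K
proof -
  interpret nu: prob_space "distr \<mu> borel \<pi>" by (rule prob_space_distr[OF measurable_coding])
  show "compact_prob_measure (distr \<mu> borel \<pi>) K"
  proof
    have "{\<omega> \<in> \<Sigma>. \<pi> \<omega> \<in> K} = space \<mu>" using coding_map_in by (auto simp: space_\<mu>)
    then show "measure (distr \<mu> borel \<pi>) K = 1"
      using compact_K by (simp add: prob_distr_coding prob_space borel_compact)
  qed (simp_all add: compact_K)
qed

lemma integral_distr_coding:
  assumes "r > 0"
  shows "(\<integral>x. infdist x \<alpha> powr r \<partial>distr \<mu> borel \<pi>) = (\<integral>\<omega>. infdist (\<pi> \<omega>) \<alpha> powr r \<partial>\<mu>)"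
  by (rule integral_distr[OF measurable_coding], rule borel_measurable_continuous_onI,
      rule continuous_on_infdist_powr[OF continuous_on_id assms])

text \<open>Chooses one level and verifies there all requirements of
  \<open>quantization_lower_bound\<close>. The masses \<open>P k\<close> of the word families may
  exceed those of the cubes, which only helps.\<close>

lemma lower_bound_of_frequently:
  assumes r: "r > 0" and q: "0 < q" "q < 1" and t: "r * q < t"
    and freq: "\<exists>\<^sub>F n in sequentially. 2 powr (real n * t) \<le> image.power_sum n q"
  obtains A where "A > 0" "\<And>n \<alpha>. finite \<alpha> \<Longrightarrow> \<alpha> \<noteq> {} \<Longrightarrow> card \<alpha> \<le> n \<Longrightarrow>
    A * real n powr (- ((1 - q) / q)) \<le> (\<integral>\<omega>. infdist (\<pi> \<omega>) \<alpha> powr r \<partial>\<mu>)"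
proof -
  \<comment> \<open>The slack \<open>t / q - r\<close> is halved: \<open>r * \<epsilon>\<close> is
    the share lost to distortion, \<open>\<gamma>\<close> is left for the constants.\<close>
  define \<epsilon> where "\<epsilon> = (t / q - r) / (2 * r)"
  define \<gamma> where "\<gamma> = (t / q - r) / 2"
  have "t / q - r > 0" using t q by (simp add: field_simps)
  then have \<epsilon>: "\<epsilon> > 0" and \<gamma>: "\<gamma> > 0" and \<epsilon>\<gamma>: "t / q - r * (1 + \<epsilon>) = \<gamma>"
    using r by (simp_all add: \<epsilon>_def \<gamma>_def field_simps)
  have "t > 0" using t r q by (meson less_trans mult_pos_pos)
  obtain B where B: "B > 0" "\<And>h. 0 < h \<Longrightarrow> h < 1 \<Longrightarrow> \<exists>W. finite W \<and> W \<subseteq> words \<and>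
    (\<forall>\<omega>\<in>\<Sigma>. \<exists>!w. w \<in> W \<and> \<omega> \<in> word_cyl N w) \<and>
    (\<forall>w\<in>W. \<forall>x\<in>K. \<forall>y\<in>K. dist (\<Phi> w x) (\<Phi> w y) \<le> h \<and>
       B * h powr (1 + \<epsilon>) * dist x y \<le> dist (\<Phi> w x) (\<Phi> w y))"
    by (rule cut_set[OF \<epsilon>]) (rule that)
  let ?d = "real CARD('d)"
  have d: "?d \<ge> 1" by (simp add: Suc_le_eq)
  \<comment> \<open>Distinct indices congruent modulo \<open>m\<close> have corners at least
    \<open>m * h\<close> apart, which exceeds \<open>8 * d * h = 4 * \<rho>\<close>. There are at
    most \<open>X\<close> residue classes.\<close>
  define m where "m = 8 * CARD('d) + 1"
  define X where "X = real m ^ CARD('d)"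
  have X: "X > 0" by (simp add: X_def m_def)
  have "\<forall>\<^sub>F n in sequentially. n \<ge> 1 \<and> X < 2 powr (real n * t) \<and>
      g * X powr (1 / q) / (B / 6) powr r < 2 powr (real n * \<gamma>)"
    using eventually_ge_at_top[of 1] eventually_powr_gt[OF \<open>t > 0\<close>, of X]
      eventually_powr_gt[OF \<gamma>, of "g * X powr (1 / q) / (B / 6) powr r"]
    by eventually_elim simp
  from frequently_ex[OF frequently_eventually_frequently[OF freq this]]
  \<comment> \<open>The third condition will force at least two cubes to be kept, the fourth is the
    inequality \<open>gap\<close> in disguise.\<close>
  obtain n where n: "2 powr (real n * t) \<le> image.power_sum n q" "n \<ge> 1" "X < 2 powr (real n * t)"
    "g * X powr (1 / q) / (B / 6) powr r < 2 powr (real n * \<gamma>)" by blast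
  define h :: real where "h = 2 powr (- real n)"
  have h: "0 < h" "h < 1" "h = 1 / 2 ^ n"
    using n(2) by (auto simp: h_def powr_minus_divide powr_realpow)
  obtain W where W: "finite W" "W \<subseteq> words" "\<forall>\<omega>\<in>\<Sigma>. \<exists>!w. w \<in> W \<and> \<omega> \<in> word_cyl N w"
    and W_bounds: "\<forall>w\<in>W. \<forall>x\<in>K. \<forall>y\<in>K. dist (\<Phi> w x) (\<Phi> w y) \<le> h \<and>
       B * h powr (1 + \<epsilon>) * dist x y \<le> dist (\<Phi> w x) (\<Phi> w y)"
    using B(2)[OF h(1,2)] by (elim exE conjE) (rule that)
  define residue :: "int^'d \<Rightarrow> int^'d" where "residue k = (\<chi> i. k $ i mod int m)" for k
  have "residue ` image.active_cubes n \<subseteq> {v. \<forall>i. v $ i \<in> {0..<int m}}"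
    by (auto simp: residue_def m_def)
  from card_mono[OF card_vec_le(1) this]
  have "card (residue ` image.active_cubes n) \<le> card {v :: int^'d. \<forall>i. v $ i \<in> {0..<int m}}" by simp
  also have "\<dots> \<le> card {0..<int m} ^ CARD('d)" by (rule card_vec_le) simp
  finally have card_residue: "real (card (residue ` image.active_cubes n)) \<le> X"
    unfolding X_def by (simp flip: of_nat_power)
  have "image.active_cubes n \<noteq> {}" using image.sum_cube_prob[of n] by auto
  obtain c0 where c0: "image.power_sum n q \<le> X * (\<Sum>k\<in>{k \<in> image.active_cubes n. residue k = c0}. image.cube_prob n k powr q)"
    using pigeonhole_sum[OF image.finite_active_cubes \<open>image.active_cubes n \<noteq> {}\<close> card_residue, of "\<lambda>k. image.cube_prob n k powr q"]
      image.power_sum_pos[of n q] unfolding image.power_sum_def by (metis less_asym)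
  \<comment> \<open>Null cubes are dropped to make all \<open>P k\<close> positive; the sum is
    unaffected since \<open>0 powr q = 0\<close>.\<close>
  define I where "I = {k \<in> image.active_cubes n. residue k = c0 \<and> 0 < image.cube_prob n k}"
  have "finite I" using image.finite_active_cubes by (simp add: I_def)
  have I_sum: "(\<Sum>k\<in>{k \<in> image.active_cubes n. residue k = c0}. image.cube_prob n k powr q) = (\<Sum>k\<in>I. image.cube_prob n k powr q)"
  proof (rule sum.mono_neutral_right)
    show "\<forall>k\<in>{k \<in> image.active_cubes n. residue k = c0} - I. image.cube_prob n k powr q = 0"
      using image.cube_prob_nonneg[of n] by (auto simp: I_def less_le)
  qed (auto simp: I_def image.finite_active_cubes)
  have I_large: "2 powr (real n * t) / X \<le> (\<Sum>k\<in>I. image.cube_prob n k powr q)"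
    using order_trans[OF n(1) c0] X unfolding I_sum by (simp add: field_simps)
  \<comment> \<open>A sum above 1 of terms at most 1 has at least two of them.\<close>
  have "1 < 2 powr (real n * t) / X" using n(3) X by simp
  also have "\<dots> \<le> (\<Sum>k\<in>I. image.cube_prob n k powr q)" by (rule I_large)
  also have "\<dots> \<le> (\<Sum>k\<in>I. 1)"
    using q image.cube_prob_nonneg image.cube_prob_le_1 by (intro sum_mono powr_le1) auto
  finally have "card I \<ge> 2" by simp
  \<comment> \<open>All pieces meeting the cube, so that together they carry at least its mass. They
    may stick out, but by at most \<open>h\<close>.\<close>
  define V where "V k = {w \<in> W. \<exists>x\<in>K. \<Phi> w x \<in> dyadic_cube n k}" for k
  define P where "P k = (\<Sum>w\<in>V k. prob (word_cyl N w))" for k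
  have p_le_P: "image.cube_prob n k \<le> P k" for k
  proof -
    have "{\<omega> \<in> \<Sigma>. \<pi> \<omega> \<in> dyadic_cube n k} \<subseteq> (\<Union>w\<in>V k. word_cyl N w)"
    proof
      fix \<omega> assume "\<omega> \<in> {\<omega> \<in> \<Sigma>. \<pi> \<omega> \<in> dyadic_cube n k}"
      then have \<omega>: "\<omega> \<in> \<Sigma>" "\<pi> \<omega> \<in> dyadic_cube n k" by auto
      obtain w where w: "w \<in> W" "\<omega> \<in> word_cyl N w" using W(3) \<omega>(1) by blast
      then have "map \<omega> [0..<length w] = w" unfolding word_cyl_iff by simp
      then have "\<omega> = prepend w (\<lambda>k. \<omega> (length w + k))" using prepend_take_drop[of \<omega> "length w"] by simp
      then have "\<pi> \<omega> = \<Phi> w (\<pi> (\<lambda>k. \<omega> (length w + k)))"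
        using coding_map_prepend[of w "\<lambda>k. \<omega> (length w + k)"] w(1) W(2) drop_in_full_shift[OF \<omega>(1)]
        by auto
      then have "w \<in> V k"
        unfolding V_def using \<omega> w(1) coding_map_in[OF drop_in_full_shift[OF \<omega>(1)]] by auto
      then show "\<omega> \<in> (\<Union>w\<in>V k. word_cyl N w)" using w(2) by blast
    qed
    moreover have "finite (V k)" using W(1) by (simp add: V_def)
    ultimately have "prob {\<omega> \<in> \<Sigma>. \<pi> \<omega> \<in> dyadic_cube n k} \<le> P k"
      unfolding P_def
      by (intro order_trans[OF finite_measure_mono finite_measure_subadditive_finite]
          sets.finite_UN) (auto intro: word_cyl_measurable)
    then show ?thesis by (simp add: image.cube_prob_def prob_distr_coding dyadic_cube_borel)
  qed
  have P_pos: "P k > 0" if "k \<in> I" for k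
    using p_le_P[of k] that by (simp add: I_def)
  \<comment> \<open>Points of a cube are within \<open>d * h\<close> of its corner, and a piece adds
    its diameter \<open>h \<le> d * h\<close>.\<close>
  define \<rho> where "\<rho> = 2 * ?d * h"
  define l where "l = B * h powr (1 + \<epsilon>)"
  have "l > 0" using B(1) h(1) by (simp add: l_def)
  have gap: "g \<le> (l / 6) powr r * (\<Sum>k\<in>I. P k powr q) powr (1 / q)"
  proof -
    have "g \<le> (B / 6) powr r * 2 powr (real n * \<gamma>) / X powr (1 / q)"
      using n(4) B(1) X by (simp add: field_simps)
    \<comment> \<open>This is \<open>t / q - r * (1 + \<epsilon>) = \<gamma>\<close> in exponential
      form.\<close>
    also have "2 powr (real n * \<gamma>) = (h powr (1 + \<epsilon>)) powr r * (2 powr (real n * t)) powr (1 / q)"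
      unfolding h_def \<epsilon>\<gamma>[symmetric] by (simp add: powr_powr algebra_simps flip: powr_add)
    also have "(B / 6) powr r * ((h powr (1 + \<epsilon>)) powr r * (2 powr (real n * t)) powr (1 / q)) / X powr (1 / q) =
        (l / 6) powr r * (2 powr (real n * t) / X) powr (1 / q)"
      by (simp add: l_def powr_divide powr_mult)
    also have "\<dots> \<le> (l / 6) powr r * (\<Sum>k\<in>I. P k powr q) powr (1 / q)"
    proof (intro mult_left_mono powr_mono2)
      have "(\<Sum>k\<in>I. image.cube_prob n k powr q) \<le> (\<Sum>k\<in>I. P k powr q)"
        using q p_le_P image.cube_prob_nonneg by (intro sum_mono powr_mono2) auto
      then show "2 powr (real n * t) / X \<le> (\<Sum>k\<in>I. P k powr q)" using I_large by linarith
    qed (use q X in auto)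
    finally show ?thesis .
  qed
  show ?thesis
  proof (rule quantization_lower_bound[OF r q \<open>finite I\<close> \<open>card I \<ge> 2\<close> W(1,2),
        where V = V and \<rho> = \<rho> and z = "corner n" and l = l and P = P])
    show "\<rho> > 0" using d h by (simp add: \<rho>_def)
    show "v = w" if "\<omega> \<in> \<Sigma>" "v \<in> W" "w \<in> W" "\<omega> \<in> word_cyl N v" "\<omega> \<in> word_cyl N w" for \<omega> v w
      using W(3) that by blast
    show "V k \<subseteq> W" for k by (auto simp: V_def)
    show "dist (\<Phi> w x) (corner n k) \<le> \<rho>" if w: "w \<in> V k" "x \<in> K" for k w x
    proof -
      obtain y where y: "y \<in> K" "\<Phi> w y \<in> dyadic_cube n k" "w \<in> W" using w by (auto simp: V_def)
      have "dist (\<Phi> w x) (corner n k) \<le> dist (\<Phi> w x) (\<Phi> w y) + dist (\<Phi> w y) (corner n k)"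
        by (rule dist_triangle)
      also have "\<dots> \<le> h + ?d / 2 ^ n" using W_bounds y w by (intro add_mono dist_corner) auto
      also have "\<dots> \<le> ?d * h + ?d * h" using mult_right_mono[OF d, of h] h(1,3) by auto
      finally show ?thesis by (simp add: \<rho>_def mult_ac)
    qed
    show "4 * \<rho> < dist (corner n k) (corner n j)" if "k \<in> I" "j \<in> I" "k \<noteq> j" for k j
    proof -
      obtain i where i: "k $ i \<noteq> j $ i" using \<open>k \<noteq> j\<close> by (auto simp: vec_eq_iff)
      have "residue k = residue j" using that by (simp add: I_def)
      then have "k $ i mod int m = j $ i mod int m" by (simp add: residue_def vec_eq_iff)
      then have "int m \<le> \<bar>k $ i - j $ i\<bar>" using i by (rule abs_diff_ge_of_mod_eq)
      then have "real_of_int (int m) \<le> real_of_int \<bar>k $ i - j $ i\<bar>" by (simp only: of_int_le_iff)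
      then have "real m * h \<le> \<bar>real_of_int (k $ i) - real_of_int (j $ i)\<bar> * h"
        using h by (intro mult_right_mono) auto
      also have "\<dots> = \<bar>(corner n k - corner n j) $ i\<bar>"
        using h by (simp add: corner_def flip: diff_divide_distrib)
      also have "\<dots> \<le> dist (corner n k) (corner n j)"
        unfolding dist_norm by (rule component_le_norm_cart)
      finally have "4 * \<rho> + h \<le> dist (corner n k) (corner n j)"
        by (simp add: \<rho>_def m_def algebra_simps)
      then show ?thesis using h(1) by linarith
    qed
    show "l * dist x y \<le> dist (\<Phi> w x) (\<Phi> w y)" if "w \<in> V k" "x \<in> K" "y \<in> K" for k w x y
      using W_bounds that by (simp add: l_def V_def)
    show "P k = (\<Sum>w\<in>V k. prob (word_cyl N w))" for k by (rule P_def)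
  qed (use \<open>l > 0\<close> P_pos gap that in auto)
qed

end

section \<open>From error bounds to the limit of the quotient\<close>

lemma quantization_error_le:
  fixes \<nu> :: "(real^'d) measure"
  assumes "r > 0" "finite \<alpha>" "\<alpha> \<noteq> {}" "card \<alpha> \<le> n" "(\<integral>x. infdist x \<alpha> powr r \<partial>\<nu>) \<le> X"
  shows "quantization_error n r \<nu> \<le> X powr (1 / r)"
  unfolding quantization_error_def
proof (rule cInf_lower2)
  show "(\<integral>x. infdist x \<alpha> powr r \<partial>\<nu>) powr (1 / r) \<in>
      {(\<integral>x. infdist x \<alpha> powr r \<partial>\<nu>) powr (1 / r) |\<alpha>. finite \<alpha> \<and> 1 \<le> card \<alpha> \<and> card \<alpha> \<le> n}"
    using assms card_gt_0_iff[of \<alpha>] by (auto simp: Suc_le_eq)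
  show "(\<integral>x. infdist x \<alpha> powr r \<partial>\<nu>) powr (1 / r) \<le> X powr (1 / r)"
    using assms by (intro powr_mono2 Bochner_Integration.integral_nonneg) auto
qed (auto intro!: bdd_belowI[of _ 0])

lemma quantization_error_ge:
  fixes \<nu> :: "(real^'d) measure"
  assumes "r > 0" "n \<ge> 1" "X \<ge> 0"
    "\<And>\<alpha>. finite \<alpha> \<Longrightarrow> \<alpha> \<noteq> {} \<Longrightarrow> card \<alpha> \<le> n \<Longrightarrow> X \<le> (\<integral>x. infdist x \<alpha> powr r \<partial>\<nu>)"
  shows "X powr (1 / r) \<le> quantization_error n r \<nu>"
  unfolding quantization_error_def
proof (rule cInf_greatest)
  have "finite {0 :: real^'d} \<and> 1 \<le> card {0 :: real^'d} \<and> card {0 :: real^'d} \<le> n" using assms by simp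
  then show "{(\<integral>x. infdist x \<alpha> powr r \<partial>\<nu>) powr (1 / r) |\<alpha>. finite \<alpha> \<and> 1 \<le> card \<alpha> \<and> card \<alpha> \<le> n} \<noteq> {}"
    by blast
next
  fix y assume "y \<in> {(\<integral>x. infdist x \<alpha> powr r \<partial>\<nu>) powr (1 / r) |\<alpha>. finite \<alpha> \<and> 1 \<le> card \<alpha> \<and> card \<alpha> \<le> n}"
  then obtain \<alpha> where \<alpha>: "y = (\<integral>x. infdist x \<alpha> powr r \<partial>\<nu>) powr (1 / r)"
    "finite \<alpha>" "1 \<le> card \<alpha>" "card \<alpha> \<le> n" by blast
  from \<alpha>(3) have "\<alpha> \<noteq> {}" by auto
  then show "X powr (1 / r) \<le> y"
    unfolding \<alpha>(1) using assms \<alpha> by (intro powr_mono2) auto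
qed

lemma quantization_error_nonneg:
  fixes \<nu> :: "(real^'d) measure"
  assumes "r > 0" "n \<ge> 1"
  shows "0 \<le> quantization_error n r \<nu>"
  using quantization_error_ge[OF assms, of 0 \<nu>] Bochner_Integration.integral_nonneg[of \<nu>] by simp

text \<open>That \<open>q_r < 1\<close> rests on the universal bound \<open>d * (1 - q)\<close> for
  the spectrum, which falls below \<open>r * q\<close> beyond \<open>q = d / (d + r)\<close>. The
  other claims unfold the infimum.\<close>

lemma critical_q_bounds:
  fixes \<nu> :: "(real^'d) measure"
  assumes "compact_prob_measure \<nu> K" and r: "r > 0"
  shows "0 \<le> critical_q r \<nu>" "critical_q r \<nu> < 1"
    "\<And>q. critical_q r \<nu> < q \<Longrightarrow> \<exists>q'>0. q' < q \<and> Lq_spectrum \<nu> q' < ereal (r * q')"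
    "\<And>q. 0 < q \<Longrightarrow> q < critical_q r \<nu> \<Longrightarrow> ereal (r * q) \<le> Lq_spectrum \<nu> q"
proof -
  interpret compact_prob_measure \<nu> K by fact
  let ?d = "real CARD('d)"
  let ?Q = "{q. q > 0 \<and> Lq_spectrum \<nu> q < ereal (r * q)}"
  have "?d / (?d + r) < 1" using r by (simp add: add_nonneg_pos)
  then obtain q1 where q1: "?d / (?d + r) < q1" "q1 < 1" using dense by blast
  have "?d / (?d + r) > 0" using r by (simp add: add_pos_pos)
  then have "q1 > 0" using q1 by linarith
  have "?d < q1 * (?d + r)" using q1(1) r by (simp add: field_simps add_nonneg_pos)
  then have "?d * (1 - q1) < r * q1" by (simp add: algebra_simps)
  then have q1_Q: "q1 \<in> ?Q" using Lq_spectrum_less[OF \<open>q1 > 0\<close> q1(2)] \<open>q1 > 0\<close> by simp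
  have bdd: "bdd_below ?Q" by (rule bdd_belowI[of _ 0]) auto
  show "0 \<le> critical_q r \<nu>"
    unfolding critical_q_def using q1_Q by (intro cInf_greatest) auto
  show "critical_q r \<nu> < 1"
    unfolding critical_q_def using cInf_lower[OF q1_Q bdd] q1(2) by linarith
  show "\<exists>q'>0. q' < q \<and> Lq_spectrum \<nu> q' < ereal (r * q')" if q: "critical_q r \<nu> < q" for q
  proof -
    obtain q' where "q' \<in> ?Q" "q' < q"
      using cInf_lessD[of ?Q q] q q1_Q unfolding critical_q_def by blast
    then show ?thesis by blast
  qed
  show "ereal (r * q) \<le> Lq_spectrum \<nu> q" if "0 < q" "q < critical_q r \<nu>" for q
  proof (rule ccontr)
    assume "\<not> ereal (r * q) \<le> Lq_spectrum \<nu> q"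
    then have "q \<in> ?Q" using that(1) by simp
    then show False using cInf_lower[OF _ bdd] that(2) unfolding critical_q_def by fastforce
  qed
qed

lemma eventually_ln_gt: "\<forall>\<^sub>F n in sequentially. X < ln (real n)"
  using filterlim_compose[OF ln_at_top filterlim_real_sequentially]
  unfolding filterlim_at_top_dense by blast

text \<open>The map \<open>q \<mapsto> r * q / (1 - q)\<close> has the increasing inverse \<open>D \<mapsto> D / (r + D)\<close>.\<close>

lemma dim_less_iff:
  fixes q r D :: real
  assumes "0 \<le> q" "q < 1" "r > 0" "D \<ge> 0"
  shows "r * q / (1 - q) < D \<longleftrightarrow> q < D / (r + D)" "D < r * q / (1 - q) \<longleftrightarrow> D / (r + D) < q"
proof -
  have "r + D > 0" using assms by simp
  then show "r * q / (1 - q) < D \<longleftrightarrow> q < D / (r + D)" "D < r * q / (1 - q) \<longleftrightarrow> D / (r + D) < q"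
    using assms by (simp_all add: pos_divide_less_eq pos_less_divide_eq algebra_simps)
qed

text \<open>The strictness of \<open>r / \<kappa> < D\<close> absorbs \<open>ln C\<close> for large
  \<open>n\<close>. That the error is below 1 is recorded as well, since it fixes the sign of the
  denominator.\<close>

lemma eventually_quotient_less:
  fixes \<nu> :: "(real^'d) measure"
  assumes r: "r > 0" and \<kappa>: "\<kappa> > 0" "r / \<kappa> < D" and C: "C > 0"
    and upper: "\<And>n. n \<ge> 2 \<Longrightarrow> \<exists>\<alpha>. finite \<alpha> \<and> \<alpha> \<noteq> {} \<and> card \<alpha> \<le> n \<and>
      (\<integral>x. infdist x \<alpha> powr r \<partial>\<nu>) \<le> C * real n powr (- \<kappa>)"
  shows "\<forall>\<^sub>F n in sequentially. quantization_error n r \<nu> < 1 \<and> quantization_quotient r \<nu> n < D"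
proof -
  have D: "D > 0" "D * \<kappa> - r > 0"
    using \<kappa> r less_trans[of 0 "r / \<kappa>" D] by (auto simp: field_simps)
  have "\<forall>\<^sub>F n in sequentially. 2 \<le> n \<and> ln C / \<kappa> < ln (real n) \<and> D * ln C / (D * \<kappa> - r) < ln (real n)"
    using eventually_ge_at_top[of 2] eventually_ln_gt[of "ln C / \<kappa>"]
      eventually_ln_gt[of "D * ln C / (D * \<kappa> - r)"]
    by eventually_elim simp
  then show ?thesis
  proof eventually_elim
    case (elim n)
    let ?e = "quantization_error n r \<nu>"
    obtain \<alpha> where "finite \<alpha>" "\<alpha> \<noteq> {}" "card \<alpha> \<le> n"
      "(\<integral>x. infdist x \<alpha> powr r \<partial>\<nu>) \<le> C * real n powr (- \<kappa>)"
      using upper elim by blast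
    then have e_le: "?e \<le> (C * real n powr (- \<kappa>)) powr (1 / r)" by (rule quantization_error_le[OF r])
    have ln_bound: "ln ((C * real n powr (- \<kappa>)) powr (1 / r)) = (ln C - \<kappa> * ln (real n)) / r"
      using C elim by (simp add: ln_powr ln_mult)
    have neg: "(ln C - \<kappa> * ln (real n)) / r < 0"
      using elim \<kappa> r by (simp add: field_simps)
    have "0 \<le> ?e" using elim by (intro quantization_error_nonneg r) linarith
    \<comment> \<open>A vanishing error has the default quotient 0, which lies below
      \<open>D\<close> because \<open>D > 0\<close>.\<close>
    show ?case
    proof (cases "?e = 0")
      case True
      then show ?thesis using D by (simp add: quantization_quotient_def)
    next
      case False
      then have e_pos: "?e > 0" using \<open>0 \<le> ?e\<close> by simp
      have "ln ?e \<le> (ln C - \<kappa> * ln (real n)) / r"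
        using e_le e_pos unfolding ln_bound[symmetric] by (intro ln_mono) auto
      then have le: "(\<kappa> * ln (real n) - ln C) / r \<le> - ln ?e" and "ln ?e < 0"
        using neg by (simp_all add: diff_divide_distrib)
      have "D * ln C < ln (real n) * (D * \<kappa> - r)" using elim D by (simp add: pos_divide_less_eq)
      then have "ln (real n) < D * ((\<kappa> * ln (real n) - ln C) / r)"
        using r by (simp add: field_simps)
      also have "\<dots> \<le> D * - ln ?e" using le D by (intro mult_left_mono) auto
      finally have "ln (real n) < D * - ln ?e" .
      moreover have "0 < - ln ?e" using \<open>ln ?e < 0\<close> by simp
      ultimately have "ln (real n) / - ln ?e < D" by (simp only: pos_divide_less_eq)
      then show ?thesis using False \<open>ln ?e < 0\<close> e_pos by (simp add: quantization_quotient_def)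
    qed
  qed
qed

text \<open>Without \<open>small\<close> the denominator could be negative and the bound on the
  logarithm of the error would say nothing about the quotient.\<close>

lemma eventually_quotient_greater:
  fixes \<nu> :: "(real^'d) measure"
  assumes r: "r > 0" and \<kappa>: "\<kappa> > 0" and D: "0 \<le> D" "D < r / \<kappa>" and A: "A > 0"
    and lower: "\<And>n \<alpha>. finite \<alpha> \<Longrightarrow> \<alpha> \<noteq> {} \<Longrightarrow> card \<alpha> \<le> n \<Longrightarrow>
      A * real n powr (- \<kappa>) \<le> (\<integral>x. infdist x \<alpha> powr r \<partial>\<nu>)"
    and small: "\<forall>\<^sub>F n in sequentially. quantization_error n r \<nu> < 1"
  shows "\<forall>\<^sub>F n in sequentially. D < quantization_quotient r \<nu> n"
proof -
  have D': "r - D * \<kappa> > 0" using D \<kappa> by (simp add: field_simps)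
  have "\<forall>\<^sub>F n in sequentially. 1 \<le> n \<and> - D * ln A / (r - D * \<kappa>) < ln (real n) \<and> quantization_error n r \<nu> < 1"
    using eventually_ge_at_top[of 1] eventually_ln_gt[of "- D * ln A / (r - D * \<kappa>)"] small
    by eventually_elim simp
  then show ?thesis
  proof eventually_elim
    case (elim n)
    let ?e = "quantization_error n r \<nu>"
    have "(A * real n powr (- \<kappa>)) powr (1 / r) \<le> ?e"
      using elim A by (intro quantization_error_ge[OF r] lower) auto
    moreover have "0 < (A * real n powr (- \<kappa>)) powr (1 / r)" using A elim by simp
    ultimately have e_pos: "?e > 0" and "ln ((A * real n powr (- \<kappa>)) powr (1 / r)) \<le> ln ?e"
      using ln_mono by (linarith, blast)
    then have "(ln A - \<kappa> * ln (real n)) / r \<le> ln ?e"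
      using A elim by (simp add: ln_powr ln_mult)
    then have le: "- ln ?e \<le> (\<kappa> * ln (real n) - ln A) / r" by (simp add: diff_divide_distrib)
    have "ln ?e < 0" using elim e_pos by simp
    have "- D * ln A < ln (real n) * (r - D * \<kappa>)"
      using elim D' by (simp only: pos_divide_less_eq)
    then have "D * ((\<kappa> * ln (real n) - ln A) / r) < ln (real n)"
      using r by (simp add: field_simps)
    moreover have "D * - ln ?e \<le> D * ((\<kappa> * ln (real n) - ln A) / r)"
      using le D by (intro mult_left_mono) auto
    ultimately have "D * - ln ?e < ln (real n)" by linarith
    moreover have "0 < - ln ?e" using \<open>ln ?e < 0\<close> by simp
    ultimately have "D < ln (real n) / - ln ?e" by (simp only: pos_less_divide_eq)
    then show ?case using e_pos by (simp add: quantization_quotient_def)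
  qed
qed

text \<open>A target \<open>D\<close> on either side of the limit corresponds to the exponent
  \<open>D / (r + D)\<close> on the same side of \<open>q_r\<close>; an exponent \<open>q\<close>
  strictly between these two leaves room for the constants in the error bound.\<close>

theorem (in gibbs_ifs) quantization_quotient_tendsto:
  assumes r: "r > 0"
  defines "\<nu> \<equiv> distr \<mu> borel \<pi>"
  shows "quantization_quotient r \<nu> \<longlonglongrightarrow> r * critical_q r \<nu> / (1 - critical_q r \<nu>)"
proof -
  let ?q = "critical_q r \<nu>"
  have cpm: "compact_prob_measure \<nu> K" unfolding \<nu>_def by (rule image.compact_prob_measure_axioms)
  note crit = critical_q_bounds[OF cpm r]
  have less: "\<forall>\<^sub>F n in sequentially. quantization_error n r \<nu> < 1 \<and> quantization_quotient r \<nu> n < D"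
    if D: "r * ?q / (1 - ?q) < D" for D
  proof -
    have "0 \<le> r * ?q / (1 - ?q)" using crit(1,2) r by simp
    then have "D > 0" using D by linarith
    then have "?q < D / (r + D)" using dim_less_iff(1)[OF crit(1,2) r, of D] D by simp
    then obtain q where q: "0 < q" "q < D / (r + D)" "Lq_spectrum \<nu> q < ereal (r * q)"
      using crit(3) by blast
    moreover have "D / (r + D) < 1" using r \<open>D > 0\<close> by simp
    ultimately have "q < 1" by linarith
    obtain C where C: "C > 0" "\<And>n. n \<ge> 2 \<Longrightarrow> \<exists>\<alpha>. finite \<alpha> \<and> \<alpha> \<noteq> {} \<and> card \<alpha> \<le> n \<and>
      (\<integral>x. infdist x \<alpha> powr r \<partial>\<nu>) \<le> C * real n powr (- ((1 - q) / q))"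
      using compact_prob_measure.quantization_upper_bound[OF cpm r q(1) \<open>q < 1\<close> q(3)] by metis
    have "r / ((1 - q) / q) < D"
      using dim_less_iff(1)[of q r D] q \<open>q < 1\<close> r \<open>D > 0\<close> by simp
    moreover have "(1 - q) / q > 0" using q \<open>q < 1\<close> by simp
    ultimately show ?thesis using eventually_quotient_less[OF r _ _ C] by blast
  qed
  have small: "\<forall>\<^sub>F n in sequentially. quantization_error n r \<nu> < 1"
    using less[OF less_add_one] by eventually_elim simp
  show ?thesis
  proof (rule order_tendstoI)
    fix D assume "r * ?q / (1 - ?q) < D"
    from less[OF this] show "\<forall>\<^sub>F n in sequentially. quantization_quotient r \<nu> n < D"
      by eventually_elim simp
  next
    fix D assume D: "D < r * ?q / (1 - ?q)"
    show "\<forall>\<^sub>F n in sequentially. D < quantization_quotient r \<nu> n"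
    proof (cases "D < 0")
      \<comment> \<open>A negative \<open>D\<close> is beaten because the quotient is nonnegative
        once the error is below 1. If \<open>q_r = 0\<close>, this is the only case.\<close>
      case True
      show ?thesis
        using small eventually_ge_at_top[of 1]
      proof eventually_elim
        case (elim n)
        have "quantization_quotient r \<nu> n \<ge> 0"
          using elim quantization_error_nonneg[OF r, of n \<nu>]
          by (auto simp: quantization_quotient_def intro!: divide_nonneg_nonpos)
        then show ?case using True by linarith
      qed
    next
      case False
      then have "D \<ge> 0" by simp
      then have "D / (r + D) < ?q" using dim_less_iff(2)[OF crit(1,2) r, of D] D by simp
      then obtain q where q: "D / (r + D) < q" "q < ?q" using dense by blast
      have "0 \<le> D / (r + D)" using \<open>D \<ge> 0\<close> r by simp
      then have "q > 0" using q by linarith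
      have "q < 1" using q crit(2) by linarith
      \<comment> \<open>Below \<open>q_r\<close> the spectrum is only known to satisfy the weak
        inequality. Applied at \<open>q' > q\<close> it gives a rate above \<open>r * q\<close>, and
        by monotonicity the power sums at \<open>q\<close> are at least as large.\<close>
      obtain q' where q': "q < q'" "q' < ?q" using dense[OF q(2)] by blast
      obtain t where t: "r * q < t" "t < r * q'" using dense[of "r * q" "r * q'"] q' r by auto
      have "ereal t < ereal (r * q')" using t by simp
      also have "\<dots> \<le> Lq_spectrum \<nu> q'" using crit(4) q' \<open>q > 0\<close> by simp
      finally have "\<exists>\<^sub>F n in sequentially. 2 powr (real n * t) \<le> image.power_sum n q'"
        unfolding \<nu>_def by (rule image.Lq_spectrum_gt)
      then have "\<exists>\<^sub>F n in sequentially. 2 powr (real n * t) \<le> image.power_sum n q"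
        by (rule frequently_elim1) (use image.power_sum_antimono[of q q'] q' in \<open>force intro: order_trans\<close>)
      then obtain A where A: "A > 0" "\<And>n \<alpha>. finite \<alpha> \<Longrightarrow> \<alpha> \<noteq> {} \<Longrightarrow> card \<alpha> \<le> n \<Longrightarrow>
        A * real n powr (- ((1 - q) / q)) \<le> (\<integral>\<omega>. infdist (\<pi> \<omega>) \<alpha> powr r \<partial>\<mu>)"
        by (rule lower_bound_of_frequently[OF r \<open>q > 0\<close> \<open>q < 1\<close> t(1)]) (rule that)
      have "D < r / ((1 - q) / q)"
        using dim_less_iff(2)[of q r D] q \<open>q > 0\<close> \<open>q < 1\<close> r \<open>D \<ge> 0\<close> by simp
      moreover have "(1 - q) / q > 0" using \<open>q > 0\<close> \<open>q < 1\<close> by simp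
      ultimately show ?thesis
        using eventually_quotient_greater[OF r _ \<open>D \<ge> 0\<close> _ A(1) _ small, of "(1 - q) / q"] A(2)
        unfolding \<nu>_def integral_distr_coding[OF r] by blast
    qed
  qed
qed

theorem corollary1p12:
  fixes N :: nat and K :: "(real^'d) set" and S :: "nat \<Rightarrow> real^'d \<Rightarrow> real^'d"
    and \<nu> :: "(real^'d) measure" and r :: real
  assumes "C1_conformal_ifs N K S"
    and "ifs_gibbs_measure N K S \<nu>"
    and "r > 0"
  shows "quantization_dim_exists r \<nu> \<and>
         quantization_dim r \<nu> = r * critical_q r \<nu> / (1 - critical_q r \<nu>)"
proof -
  obtain c b where ifs: "quasi_conformal_ifs N K S c b"
    by (rule C1_conformal_ifs_imp_quasi_conformal[OF assms(1)])
  have N: "N > 0" using ifs by (rule quasi_conformal_ifs.N_pos)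
  obtain \<mu> where \<mu>: "shift_gibbs_measure N \<mu>" "\<nu> = distr \<mu> borel (coding_map K S)"
    using assms(2) by (auto simp: ifs_gibbs_measure_def)
  obtain g where g: "g > 0" "\<And>v w. v \<in> lists {1..N} \<Longrightarrow> w \<in> lists {1..N} \<Longrightarrow>
    measure \<mu> (word_cyl N v) * measure \<mu> (word_cyl N w) \<le> g * measure \<mu> (word_cyl N (v @ w))"
    using shift_gibbs_measure_quasi_Bernoulli[OF \<mu>(1) N] by metis
  have "prob_space \<mu>" "sets \<mu> = sets (restrict_space borel (full_shift N))"
    using \<mu>(1) by (auto simp: shift_gibbs_measure_def)
  then interpret gibbs_ifs N K S c b \<mu> g
    using ifs N g by (intro gibbs_ifs.intro shift_measure.intro shift_measure_axioms.intro gibbs_ifs_axioms.intro)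
  have "quantization_quotient r \<nu> \<longlonglongrightarrow> r * critical_q r \<nu> / (1 - critical_q r \<nu>)"
    unfolding \<mu>(2) by (rule quantization_quotient_tendsto[OF assms(3)])
  then show ?thesis
    unfolding quantization_dim_exists_def quantization_dim_def by (simp add: convergentI limI)
qed

end
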